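(* For every $n\ge 2$ there is a constant $\kappa=\kappa(n)>0$ depending only on $n$ such that, with $\mu(\varepsilon)$ defined using this $\kappa$ as in the context, the following holds. Let $l\ge 3$, let $1\le d\le n-1$, let $\omega=(0,\tilde\omega)\in\mathbb{R}^d\times\mathbb{R}^{n-d}$ with $\tilde\omega$ non-resonant and $|\tilde\omega|=1$, and let $H:\mathbb{T}^n\times\mathbb{R}^n\to\mathbb{R}$ be a $C^l$ function of the form $$H(\theta,I)=\omega\cdot I+A(\theta)I\cdot I+R(\theta,I),\qquad R(\theta,I)=O_3(I),$$ with $A:\mathbb{T}^n\to\mathrm{Sym}(n,\mathbb{R})$ of class $C^l$. Assume that $\theta^*\in\mathbb{T}^d$ and $i\in\{1,\dots,d\}$ are such that the symmetric matrix $A_i^*:=\partial_{\theta_i}\bar A(\theta^* )$ is negative definite, and let $\lambda_i^*<0$ be a constant such that $A_i^*I\cdot I\le\lambda_i^*|I|^2$ for all $I\in\mathbb{R}^n$. Let $C_1,C_2>0$. Then there exist positive constants $\mu_0=\mu_0(n,C_1,C_2,\lambda_i^* )$, $c=c(n,C_1,\lambda_i^* )$, $\delta=\delta(n,C_1,\lambda_i^* )$ and $C=C(n,C_1,C_2,\lambda_i^* )$, depending only on the indicated quantities, such that for every $\varepsilon>0$ with $\kappa\varepsilon^{-1}\ge\Psi(1)$ for which $$|A|_{C^l(\mathbb{T}^n)}\le C_1,\qquad |\tilde R|_{C^l(\mathbb{T}^n\times B_3)}\le C_2,\qquad \tilde R(\theta,\tilde I):=\varepsilon^{-3}R(\theta,\varepsilon\tilde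 I),$$ and $$0<\mu(\varepsilon)\le\mu_0,$$ and for every $\tilde I_0\in\mathbb{R}^n$ with $|\tilde I_0|=1$, there exists a solution $(\theta(t),I(t))$ of the Hamiltonian system associated to $H$ such that, with $\tau:=\delta\varepsilon^{-1}$, $$I(0)=\varepsilon\tilde I_0,\qquad |I(\tau)-I(0)|\ge I_i(\tau)-I_i(0)\ge c\,\varepsilon,$$ and moreover $$\max_{d+1\le j\le n}|I_j(\tau)-I_j(0)|\le C\varepsilon\mu(\varepsilon).$$
   Context: $\mathbb{T}^n=\mathbb{R}^n/\mathbb{Z}^n$; $\cdot$ is the Euclidean inner product; $|\,.\,|$ is the supremum norm on $\mathbb{R}^m$; $\mathrm{Sym}(n,\mathbb{R})$ is the space of real symmetric $n\times n$ matrices; $B_r:=\{I\in\mathbb{R}^n : |I|<r\}$; $|\,.\,|_{C^l(\cdot)}$ is the usual $C^l$-norm on the indicated domain. $R(\theta,I)=O_3(I)$ means that $R$ is of order at least $3$ in $I$ at $I=0$. The Hamiltonian system associated to $H$ is $\dot\theta=\partial_I H$, $\dot I=-\partial_\theta H$. A vector $\tilde\omega\in\mathbb{R}^{n-d}$ is non-resonant if $k\cdot\tilde\omega\ne0$ for all $k\in\mathbb{Z}^{n-d}\setminus\{0\}$. Averaged map: $\bar A:\mathbb{T}^d\to\mathrm{Sym}(n,\mathbb{R})$, $\bar A(\theta_1,\dots,\theta_d):=\int_{\mathbb{T}^{n-d}}A(\theta_1,\dots,\theta_d,\theta_{d+1},\dots,\theta_n)\,d\theta_{d+1}\cdots d\theta_n$.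 Definition of $\mu(\varepsilon)$: for $Q\ge1$ let $$\Psi(Q):=\max\{|k\cdot\tilde\omega|^{-1} : k\in\mathbb{Z}^{n-d},\ 0<|k_1|+\cdots+|k_{n-d}|\le Q\},$$ for $x\ge\Psi(1)$ let $\Delta(x):=\sup\{Q\ge1 : Q\Psi(Q)\le x\}$, and for $\varepsilon>0$ with $\kappa\varepsilon^{-1}\ge\Psi(1)$ let $\mu(\varepsilon):=\big(\Delta(\kappa\varepsilon^{-1})\big)^{-1}$. *)

theory Defs
  imports "HOL-Analysis.Analysis" "HOL-Library.Landau_Symbols"
begin

(* Objects on the torus R^n / Z^n are represented by their Z^n-periodic lifts to R^n.
   The supremum norm on R^m is the library's infnorm. *)

definition torus_periodic :: "(real ^ 'n \<Rightarrow> 'b) \<Rightarrow> bool" where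
  "torus_periodic f \<longleftrightarrow> (\<forall>k. (\<forall>j. k $ j \<in> \<int>) \<longrightarrow> (\<forall>\<theta>. f (\<theta> + k) = f \<theta>))"

fun Ck :: "nat \<Rightarrow> ('a::euclidean_space \<Rightarrow> 'b::euclidean_space) \<Rightarrow> bool" where
  "Ck 0 f \<longleftrightarrow> continuous_on UNIV f"
| "Ck (Suc l) f \<longleftrightarrow>
     (\<forall>x. f differentiable (at x)) \<and> (\<forall>b\<in>Basis. Ck l (\<lambda>x. frechet_derivative f (at x) b))"

fun iterated_deriv ::
  "'a::euclidean_space list \<Rightarrow> ('a \<Rightarrow> 'b::euclidean_space) \<Rightarrow> 'a \<Rightarrow> 'b" where
  "iterated_deriv [] f = f"
| "iterated_deriv (b # bs) f = iterated_deriv bs (\<lambda>x. frechet_derivative f (at x) b)"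

(* Supremum over S of all partial derivatives of order at most l, meaningful when f is of
   class C^l near S. Values of f are measured in the supremum norm, for matrices the largest
   modulus of an entry. The value is extended real, so that a bound on it is a genuine
   pointwise bound. *)
definition Ck_norm :: "nat \<Rightarrow> 'a::euclidean_space set \<Rightarrow> ('a \<Rightarrow> 'b::euclidean_space) \<Rightarrow> ereal" where
  "Ck_norm l S f =
     (SUP bs \<in> {bs. set bs \<subseteq> Basis \<and> length bs \<le> l}. SUP x \<in> S. ereal (infnorm (iterated_deriv bs f x)))"

(* The first d indices; the type 'n stands for {1..n} with its order. A vector of R^(n-d) is
   represented by the vector of R^n with zeros in the first d places, a point of T^d by any
   point of T^n with these first d coordinates. *)
definition first_indices :: "nat \<Rightarrow> 'n::{finite,linorder} set" where
  "first_indices d = {i. card {j. j < i} < d}"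

abbreviation last_indices :: "nat \<Rightarrow> 'n::{finite,linorder} set" where
  "last_indices d \<equiv> - first_indices d"

definition last_int_vectors :: "nat \<Rightarrow> (int ^ 'n::{finite,linorder}) set" where
  "last_int_vectors d = {k. \<forall>j \<in> first_indices d. k $ j = 0}"

definition freq_dot :: "int ^ 'n::{finite,linorder} \<Rightarrow> (real, 'n) vec \<Rightarrow> real" where
  "freq_dot k \<omega> = (\<Sum>j\<in>UNIV. of_int (k $ j) * \<omega> $ j)"

definition nonresonant :: "nat \<Rightarrow> real ^ 'n::{finite,linorder} \<Rightarrow> bool" where
  "nonresonant d \<omega> \<longleftrightarrow> (\<forall>k \<in> last_int_vectors d. k \<noteq> 0 \<longrightarrow> freq_dot k \<omega> \<noteq> 0)"

definition Psi :: "nat \<Rightarrow> real ^ 'n::{finite,linorder} \<Rightarrow> real \<Rightarrow> real" where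
  "Psi d \<omega> Q =
     Max ((\<lambda>k. 1 / \<bar>freq_dot k \<omega>\<bar>) `
       {k \<in> last_int_vectors d. 0 < (\<Sum>j\<in>UNIV. \<bar>k $ j\<bar>) \<and> of_int (\<Sum>j\<in>UNIV. \<bar>k $ j\<bar>) \<le> Q})"

definition Delta :: "nat \<Rightarrow> real ^ 'n::{finite,linorder} \<Rightarrow> real \<Rightarrow> real" where
  "Delta d \<omega> x = Sup {Q. 1 \<le> Q \<and> Q * Psi d \<omega> Q \<le> x}"

definition mu :: "real \<Rightarrow> nat \<Rightarrow> real ^ 'n::{finite,linorder} \<Rightarrow> real \<Rightarrow> real" where
  "mu \<kappa> d \<omega> \<epsilon> = 1 / Delta d \<omega> (\<kappa> / \<epsilon>)"

(* The coordinates of \<theta> outside the first d are ignored. *)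
definition averaged ::
  "nat \<Rightarrow> ((real, 'n::{finite,linorder}) vec \<Rightarrow> ((real, 'n) vec, 'n) vec) \<Rightarrow> (real, 'n) vec \<Rightarrow> ((real, 'n) vec, 'n) vec" where
  "averaged d A \<theta> =
     (LINT s | Pi\<^sub>M (last_indices d) (\<lambda>_. restrict_space lborel {0..1}).
        A (\<chi> j. if j \<in> first_indices d then \<theta> $ j else s j))"

definition neg_definite :: "real ^ 'n ^ 'n \<Rightarrow> bool" where
  "neg_definite M \<longleftrightarrow> transpose M = M \<and> (\<forall>x. x \<noteq> 0 \<longrightarrow> (M *v x) \<bullet> x < 0)"

definition grad_angle :: "((real ^ 'n) \<times> (real ^ 'n) \<Rightarrow> real) \<Rightarrow> (real ^ 'n) \<times> (real ^ 'n) \<Rightarrow> real ^ 'n" where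
  "grad_angle H z = (\<chi> j. frechet_derivative H (at z) (axis j 1, 0))"

definition grad_action :: "((real ^ 'n) \<times> (real ^ 'n) \<Rightarrow> real) \<Rightarrow> (real ^ 'n) \<times> (real ^ 'n) \<Rightarrow> real ^ 'n" where
  "grad_action H z = (\<chi> j. frechet_derivative H (at z) (0, axis j 1))"

definition hamiltonian_solution ::
  "((real ^ 'n) \<times> (real ^ 'n) \<Rightarrow> real) \<Rightarrow> real set \<Rightarrow> (real \<Rightarrow> real ^ 'n) \<Rightarrow> (real \<Rightarrow> real ^ 'n) \<Rightarrow> bool" where
  "hamiltonian_solution H T \<theta> I \<longleftrightarrow>
     (\<forall>t\<in>T. (\<theta> has_vector_derivative grad_action H (\<theta> t, I t)) (at t within T) \<and>
            (I has_vector_derivative - grad_angle H (\<theta> t, I t)) (at t within T))"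

end

theory Submission
  imports Defs "HOL-Complex_Analysis.Cauchy_Integral_Theorem"
    "HOL-Probability.Characteristic_Functions" "HOL-Probability.Sinc_Integral"
begin

text \<open>
Write \<open>I = \<epsilon> J\<close>. In the variables \<open>(\<theta>, J)\<close> the system reads \<open>\<theta>' = \<omega> + O(\<epsilon>)\<close> and
\<open>J\<^sub>j' = - \<epsilon> (\<partial>\<^sub>j A(\<theta>) J) \<cdot> J + O(\<epsilon>\<^sup>2)\<close>. Over the time \<open>\<delta>/\<epsilon>\<close> the actions therefore move by a
quantity of order \<open>\<delta>\<close>, decided by the time average of the quadratic force along the fast flow.
Suppose this average may be replaced by the mean of the force over the fast angles. For a fast
index \<open>j\<close> the mean of \<open>\<partial>\<^sub>j A\<close> is zero by periodicity (\<open>mean_DA_eq_0\<close>), so \<open>J\<^sub>j\<close> does not drift. For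
the slow index \<open>i\<close> the mean of \<open>- \<partial>\<^sub>i A\<close> is minus the derivative of the averaged matrix, which is
positive definite at \<open>\<theta>s\<close>; the orbit starts with the slow angles of \<open>\<theta>s\<close>, and slow angles and
actions change by \<open>O(\<delta>)\<close> only, so for small \<open>\<delta>\<close> the mean force stays above half of its initial
lower bound and \<open>J\<^sub>i\<close> grows linearly.

Everything rests on an averaging error of the size \<open>\<mu>(\<epsilon>)\<close>, without logarithms or other losses.
Choose \<open>Q\<close> in the set that defines \<open>\<Delta>(1/\<epsilon>)\<close>, above half of its supremum, and put \<open>T = \<Psi>(Q)\<close>; then
\<open>\<epsilon>\<close> and \<open>\<epsilon> T\<close> are at most \<open>1/Q \<le> 2 \<mu>(\<epsilon>)\<close> (\<open>cutoff_exists\<close>). Instead of solving a homological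
equation and changing coordinates, replace \<open>J\<^sub>j(t)\<close> by its mean over the times \<open>t + T s\<close>, where \<open>s\<close> is
random, has a finite first moment, and has a characteristic function that vanishes off \<open>(-4, 4)\<close>
(\<open>bandlimited_prob_measure\<close>). Since \<open>J' = O(\<epsilon>)\<close>, this costs \<open>O(\<epsilon> T)\<close>. The derivative of the new
quantity is, up to \<open>O(\<epsilon> \<cdot> \<epsilon> T)\<close>, the mean over \<open>s\<close> of the force at \<open>(\<theta>(t) + T s \<omega>, J(t))\<close>. All
harmonics \<open>k\<close> of the fast angles with \<open>0 < |k\<^sub>1| + \<dots> + |k\<^sub>n| \<le> Q\<close> are killed exactly, because
\<open>2 \<pi> T |k \<cdot> \<omega>| \<ge> 2 \<pi> > 4\<close>. Finally, the force has bounded second differences in \<open>\<theta>\<close>, so Fejer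
kernels, applied to one fast angle after the other, replace it by a trigonometric polynomial of
degree at most \<open>Q\<close> with an error \<open>O(1/Q)\<close>. This shows that the line mean is the torus mean up to
\<open>O(1/Q)\<close> (\<open>line_mean_close_to_torus_mean\<close>); the resulting comparison of actions and mean forces is
\<open>averaging_lower_bound\<close>. The argument allows \<open>\<kappa> = 1\<close>.

The random times \<open>t + T s\<close> range over the whole line. The actions in the vector field are therefore
truncated to the box of radius 2, where the remainder is controlled; the truncated field is bounded
and Lipschitz, its solutions exist for all times, and up to the time \<open>\<delta>/\<epsilon>\<close> the actions stay in the
box, so that the truncated orbit is an orbit of the given Hamiltonian.
\<close>

section \<open>A probability measure with compactly supported Fourier transform\<close>

lemma norm_complex_sin_le: "norm (sin z) \<le> exp \<bar>Im z\<bar>" for z :: complex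
proof -
  have "norm (exp (\<i> * z) - exp (- (\<i> * z))) \<le> exp (- Im z) + exp (Im z)"
    by (rule order_trans[OF norm_triangle_ineq4]) simp
  also have "\<dots> \<le> 2 * exp \<bar>Im z\<bar>"
    using exp_le_cancel_iff[of "Im z" "\<bar>Im z\<bar>"] exp_le_cancel_iff[of "- Im z" "\<bar>Im z\<bar>"] by linarith
  finally show ?thesis
    by (simp add: sin_exp_eq norm_divide norm_mult)
qed

text \<open>The quotient \<open>sin z / z\<close> with its removable singularity filled, as an entire function for the contour argument.\<close>

definition csinc :: "complex \<Rightarrow> complex" where
  "csinc z = (if z = 0 then 1 else sin z / z)"

definition rsinc :: "real \<Rightarrow> real" where
  "rsinc x = (if x = 0 then 1 else sin x / x)"

lemma borel_measurable_rsinc [measurable]: "rsinc \<in> borel_measurable borel"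
  unfolding rsinc_def[abs_def] by measurable

lemma continuous_on_csinc: "continuous_on S csinc"
proof -
  have "isCont csinc z" for z
  proof (cases "z = 0")
    case True
    have "((\<lambda>z::complex. sin z / z) \<longlongrightarrow> 1) (at 0)"
      using DERIV_sin[of "0::complex"] by (simp add: has_field_derivative_iff)
    hence "(csinc \<longlongrightarrow> 1) (at 0)"
      by (rule Lim_transform_eventually) (auto simp: csinc_def eventually_at_filter)
    thus ?thesis using True by (simp add: isCont_def csinc_def)
  next
    case False
    have "isCont (\<lambda>z. sin z / z) z" using False by (intro continuous_intros) auto
    moreover have "\<forall>\<^sub>F w in nhds z. csinc w = sin w / w"
      using False by (intro eventually_nhds_in_open[of "- {0}", THEN eventually_mono]) (auto simp: csinc_def)
    ultimately show ?thesis by (subst isCont_cong)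
  qed
  thus ?thesis by (simp add: continuous_at_imp_continuous_on)
qed

text \<open>The segment is closed by the upper half circle of radius \<open>R\<close>. There \<open>|sin z|\<^sup>4 \<le> exp (4 Im z)\<close> is
outweighed by \<open>|exp (i \<xi> z)| = exp (- \<xi> Im z)\<close>, which leaves \<open>1/R\<^sup>4\<close> on an arc of length \<open>\<pi> R\<close>.\<close>

lemma integral_sinc4_exp_bound:
  fixes \<xi> R :: real
  assumes "\<xi> \<ge> 4" and R: "R > 0"
  shows "norm (integral {-R..R} (\<lambda>x. of_real (rsinc x ^ 4) * iexp (\<xi> * x))) \<le> pi / R ^ 3"
proof -
  define g where "g z = csinc z ^ 4 * exp (\<i> * \<xi> * z)" for z
  define arc where "arc = part_circlepath 0 R 0 pi"
  define seg where "seg = linepath (of_real (- R)) (of_real R :: complex)"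
  have contg: "continuous_on S g" for S
    unfolding g_def by (intro continuous_intros continuous_on_csinc)
  have diffg: "g field_differentiable at z" if "z \<noteq> 0" for z
  proof -
    have "\<forall>\<^sub>F w in nhds z. csinc w = sin w / w"
      using that by (intro eventually_nhds_in_open[of "- {0}", THEN eventually_mono]) (auto simp: csinc_def)
    hence ev: "\<forall>\<^sub>F w in nhds z. (sin w / w) ^ 4 * exp (\<i> * \<xi> * w) = g w"
      by eventually_elim (simp add: g_def)
    have "(\<lambda>w. (sin w / w) ^ 4 * exp (\<i> * \<xi> * w)) field_differentiable at z"
      using that unfolding field_differentiable_def by (auto intro!: exI derivative_eq_intros)
    thus ?thesis unfolding field_differentiable_def using DERIV_cong_ev[OF refl ev refl] by blast
  qed
  have ends: "pathstart arc = of_real R" "pathfinish arc = of_real (- R)"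
    by (simp_all add: arc_def exp_Euler flip: cis_conv_exp)
  have "(g has_contour_integral 0) (seg +++ arc)"
    by (rule Cauchy_theorem_convex[where S = UNIV and K = "{0}"])
      (auto simp: contg diffg ends seg_def arc_def intro!: valid_path_join)
  hence int: "contour_integral seg g = - contour_integral arc g"
    using contour_integral_join[of g seg arc] contour_integrable_continuous_linepath[OF contg]
      contour_integrable_continuous_part_circlepath[OF contg]
    by (simp add: contour_integral_unique seg_def arc_def add_eq_0_iff)
  have "norm (contour_integral arc g) \<le> 1 / R ^ 4 * R * \<bar>pi - 0\<bar>"
    unfolding arc_def
  proof (rule contour_integral_bound_part_circlepath)
    show "g contour_integrable_on part_circlepath 0 R 0 pi"
      by (rule contour_integrable_continuous_part_circlepath[OF contg])
    fix z assume "z \<in> path_image (part_circlepath 0 R 0 pi)"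
    then obtain t where t: "0 \<le> t" "t \<le> pi" "z = R * exp (\<i> * t)"
      using path_image_part_circlepath[of 0 pi 0 R] by auto
    hence z: "norm z = R" "Im z \<ge> 0" "z \<noteq> 0"
      using R sin_ge_zero by (auto simp: norm_mult Im_exp)
    have "norm (g z) = norm (sin z) ^ 4 / R ^ 4 * exp (- \<xi> * Im z)"
      using z by (simp add: g_def csinc_def norm_mult norm_power norm_divide power_divide)
    also have "\<dots> \<le> exp (Im z) ^ 4 / R ^ 4 * exp (- \<xi> * Im z)"
      using norm_complex_sin_le[of z] z R by (intro mult_right_mono divide_right_mono power_mono) auto
    also have "\<dots> = exp ((4 - \<xi>) * Im z) / R ^ 4"
      by (simp add: left_diff_distrib flip: exp_of_nat_mult exp_add)
    also have "\<dots> \<le> 1 / R ^ 4"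
      using assms z R by (intro divide_right_mono) (auto simp: mult_nonpos_nonneg)
    finally show "norm (g z) \<le> 1 / R ^ 4" .
  qed (use R in auto)
  also have "1 / R ^ 4 * R * \<bar>pi - 0\<bar> = pi / R ^ 3"
    using R by (simp add: power4_eq_xxxx power3_eq_cube)
  finally have "norm (contour_integral seg g) \<le> pi / R ^ 3" using int by simp
  moreover have "contour_integral seg g = integral {-R..R} (\<lambda>x. g (of_real x))"
    using R unfolding seg_def by (subst contour_integral_linepath_Reals_eq) auto
  moreover have "g (of_real x) = of_real (rsinc x ^ 4) * iexp (\<xi> * x)" for x
    by (simp add: g_def csinc_def rsinc_def sin_of_real mult_ac)
  ultimately show ?thesis by simp
qed

text \<open>The fourth power is taken because the square of the sinc function has no first moment.\<close>

lemma integrable_sinc4: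
  "integrable lborel (\<lambda>s. rsinc s ^ 4)" "integrable lborel (\<lambda>s. \<bar>s\<bar> * rsinc s ^ 4)"
proof -
  have int: "integrable lborel (\<lambda>x. 2 * inverse (1 + x\<^sup>2) :: real)"
    using integrable_inverse_1_plus_square
    by (auto simp: set_integrable_def einterval_def intro!: integrable_mult_right)
  have sinc_le: "\<bar>rsinc s\<bar> \<le> 1" for s :: real
    using abs_sin_x_le_abs_x[of s] by (auto simp: rsinc_def divide_le_eq)
  have key: "rsinc s ^ 4 \<le> 2 * inverse (1 + s\<^sup>2)" "\<bar>s\<bar> * rsinc s ^ 4 \<le> 2 * inverse (1 + s\<^sup>2)" for s :: real
  proof -
    have p: "rsinc s ^ 4 \<le> 1" using power_le_one[of "\<bar>rsinc s\<bar>" 4] sinc_le[of s] by simp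
    have "rsinc s ^ 4 \<le> 2 * inverse (1 + s\<^sup>2) \<and> \<bar>s\<bar> * rsinc s ^ 4 \<le> 2 * inverse (1 + s\<^sup>2)"
    proof (cases "\<bar>s\<bar> \<le> 1")
      case True
      have "s\<^sup>2 \<le> 1" using True by (simp add: abs_square_le_1)
      hence "1 \<le> 2 * inverse (1 + s\<^sup>2)" by (simp add: field_simps add_pos_nonneg)
      moreover have "\<bar>s\<bar> * rsinc s ^ 4 \<le> 1 * 1" using True p by (intro mult_mono) auto
      ultimately show ?thesis using p by linarith
    next
      case False
      hence s: "\<bar>s\<bar> > 1" "s \<noteq> 0" by auto
      have s2: "s\<^sup>2 > 1" using s by (metis one_less_power power2_abs zero_less_numeral)
      have "rsinc s ^ 4 = sin s ^ 4 / s ^ 4" using s by (simp add: rsinc_def power_divide)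
      also have "\<dots> \<le> 1 / s ^ 4"
        using power_le_one[of "\<bar>sin s\<bar>" 4] by (intro divide_right_mono) auto
      finally have a: "rsinc s ^ 4 \<le> 1 / s ^ 4" .
      have "\<bar>s\<bar> * rsinc s ^ 4 \<le> \<bar>s\<bar> * (1 / s ^ 4)" using a by (intro mult_left_mono) auto
      also have "\<dots> \<le> s\<^sup>2 * (1 / s ^ 4)"
        using s by (intro mult_right_mono) (auto simp: power2_eq_square abs_mult_self_eq[of s, symmetric] simp del: abs_mult_self_eq)
      also have "\<dots> = 1 / s\<^sup>2" using s by (simp add: power4_eq_xxxx power2_eq_square)
      also have "\<dots> \<le> 2 * inverse (1 + s\<^sup>2)"
        using s2 by (simp add: divide_le_eq inverse_eq_divide le_divide_eq)
      finally have "\<bar>s\<bar> * rsinc s ^ 4 \<le> 2 * inverse (1 + s\<^sup>2)" .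
      moreover have "1 * rsinc s ^ 4 \<le> \<bar>s\<bar> * rsinc s ^ 4" using s by (intro mult_right_mono) auto
      ultimately show ?thesis by linarith
    qed
    thus "rsinc s ^ 4 \<le> 2 * inverse (1 + s\<^sup>2)" "\<bar>s\<bar> * rsinc s ^ 4 \<le> 2 * inverse (1 + s\<^sup>2)" by auto
  qed
  show "integrable lborel (\<lambda>s. rsinc s ^ 4)" "integrable lborel (\<lambda>s. \<bar>s\<bar> * rsinc s ^ 4)"
    by (rule Bochner_Integration.integrable_bound[OF int], use key in \<open>auto simp: abs_mult\<close>)+
qed

lemma char_sinc4_eq_0:
  fixes \<xi> :: real
  assumes "\<bar>\<xi>\<bar> \<ge> 4"
  shows "(CLINT s|lborel. of_real (rsinc s ^ 4) * iexp (\<xi> * s)) = 0"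
proof -
  have int: "integrable lborel (\<lambda>s. of_real (rsinc s ^ 4) * iexp (\<xi> * s))" for \<xi>
    by (rule Bochner_Integration.integrable_bound[OF integrable_sinc4(1)]) (auto simp: norm_mult norm_power)
  have pos: "(CLINT s|lborel. of_real (rsinc s ^ 4) * iexp (\<xi> * s)) = 0" if "\<xi> \<ge> 4" for \<xi>
  proof -
    let ?f = "\<lambda>s. of_real (rsinc s ^ 4) * iexp (\<xi> * s)"
    let ?I = "\<lambda>n. CLINT s|lborel. indicator {- real n..real n} s *\<^sub>R ?f s"
    have "?I \<longlonglongrightarrow> (CLINT s|lborel. ?f s)"
    proof (rule integral_dominated_convergence[where w = "\<lambda>s. norm (?f s)"])
      show "AE x in lborel. (\<lambda>n. indicator {- real n..real n} x *\<^sub>R ?f x) \<longlonglongrightarrow> ?f x"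
      proof (rule AE_I2)
        fix x :: real
        have "\<forall>\<^sub>F n in sequentially. indicator {- real n..real n} x *\<^sub>R ?f x = ?f x"
          using eventually_ge_at_top[of "nat \<lceil>\<bar>x\<bar>\<rceil>"] by eventually_elim (auto simp: indicator_def nat_le_iff ceiling_le_iff)
        thus "(\<lambda>n. indicator {- real n..real n} x *\<^sub>R ?f x) \<longlonglongrightarrow> ?f x" by (rule tendsto_eventually)
      qed
    qed (use int in \<open>auto simp: indicator_def\<close>)
    moreover have "?I \<longlonglongrightarrow> 0"
    proof (rule Lim_null_comparison)
      show "\<forall>\<^sub>F n in sequentially. norm (?I n) \<le> pi / real n ^ 3"
        using eventually_gt_at_top[of 0]
      proof eventually_elim
        case (elim n)
        have "set_integrable lborel {- real n..real n} ?f"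
          unfolding set_integrable_def by (rule integrable_mult_indicator[OF _ int]) auto
        from set_borel_integral_eq_integral(2)[OF this]
        have "?I n = integral {- real n..real n} ?f" by (simp add: set_lebesgue_integral_def)
        thus ?case using integral_sinc4_exp_bound[OF that, of "real n"] elim by simp
      qed
      show "(\<lambda>n. pi / real n ^ 3) \<longlonglongrightarrow> 0"
        by (intro tendsto_divide_0[OF tendsto_const] filterlim_at_top_imp_at_infinity
            filterlim_pow_at_top filterlim_real_sequentially) simp
    qed
    ultimately show ?thesis using LIMSEQ_unique by blast
  qed
  show ?thesis
  proof (cases "\<xi> \<ge> 4")
    case False
    have "cnj (CLINT s|lborel. of_real (rsinc s ^ 4) * iexp (\<xi> * s)) =
      (CLINT s|lborel. of_real (rsinc s ^ 4) * iexp (- \<xi> * s))"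
      by (subst Bochner_Integration.integral_cnj[symmetric])
         (auto intro!: Bochner_Integration.integral_cong simp: exp_cnj)
    also have "\<dots> = 0" using pos[of "- \<xi>"] False assms by auto
    finally show ?thesis by simp
  qed (rule pos)
qed

text \<open>Means over times with this law annihilate every oscillation of frequency at least 4, and the first
moment bounds by how much they change a slowly varying quantity. Such a law cannot have compact
support, as its characteristic function would then be analytic.\<close>

lemma bandlimited_prob_measure:
  obtains M :: "real measure" where "prob_space M" "sets M = sets borel" "integrable M (\<lambda>s. \<bar>s\<bar>)"
    "\<And>\<xi>. \<bar>\<xi>\<bar> \<ge> 4 \<Longrightarrow> char M \<xi> = 0"
proof -
  define Z where "Z = (LINT s|lborel. rsinc s ^ 4)"
  have "Z \<ge> 0" unfolding Z_def by (rule Bochner_Integration.integral_nonneg) simp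
  moreover have "Z \<noteq> 0"
  proof
    assume "Z = 0"
    hence "AE s in lborel. rsinc s ^ 4 = 0"
      unfolding Z_def by (subst (asm) integral_nonneg_eq_0_iff_AE[OF integrable_sinc4(1)]) auto
    hence "AE s in lborel. s \<notin> {0<..<1::real}"
    proof eventually_elim
      case (elim s)
      hence "s \<noteq> 0" "sin s = 0" by (auto simp: rsinc_def split: if_splits)
      thus ?case using sin_gt_zero[of s] pi_gt3 by auto
    qed
    hence "emeasure lborel {0<..<1::real} = 0"
      by (subst (asm) AE_iff_measurable[of "{0<..<1}"]) auto
    thus False by simp
  qed
  ultimately have Z: "Z > 0" by simp
  define M where "M = density lborel (\<lambda>s. ennreal (rsinc s ^ 4 / Z))"
  have meas[measurable]: "(\<lambda>s. rsinc s ^ 4) \<in> borel_measurable borel"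
    using borel_measurable_integrable[OF integrable_sinc4(1)] by simp
  have "emeasure M (space M) = (\<integral>\<^sup>+s. ennreal (rsinc s ^ 4 / Z) \<partial>lborel)"
    unfolding M_def by (subst emeasure_density) auto
  also have "\<dots> = ennreal (LINT s|lborel. rsinc s ^ 4 / Z)"
    using integrable_sinc4(1) Z by (intro nn_integral_eq_integral) auto
  also have "\<dots> = 1" using Z by (simp add: Z_def)
  finally have "prob_space M" by (intro prob_spaceI)
  moreover have "sets M = sets borel" by (simp add: M_def)
  moreover have "integrable M (\<lambda>s. \<bar>s\<bar>)"
    unfolding M_def using Z integrable_sinc4(2) by (subst integrable_density) (auto simp: mult.commute)
  moreover have "char M \<xi> = 0" if "\<bar>\<xi>\<bar> \<ge> 4" for \<xi>
  proof -
    have "char M \<xi> = (CLINT s|lborel. (rsinc s ^ 4 / Z) *\<^sub>R iexp (\<xi> * s))"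
      unfolding M_def char_def using Z by (subst integral_density) auto
    also have "\<dots> = (CLINT s|lborel. of_real (rsinc s ^ 4) * iexp (\<xi> * s) / Z)"
      by (rule Bochner_Integration.integral_cong) (auto simp: scaleR_conv_of_real)
    also have "\<dots> = 0" using char_sinc4_eq_0[OF that] by simp
    finally show ?thesis .
  qed
  ultimately show ?thesis using that by blast
qed

section \<open>Global solutions of Lipschitz differential equations\<close>

text \<open>This is the contraction estimate for the integral operator: integration gains a factor \<open>1/(2L)\<close> on
functions of growth \<open>exp (2 L |t|)\<close>, in both directions of time.\<close>

lemma exp_weighted_bound:
  fixes G :: "real \<Rightarrow> 'a::euclidean_space"
  assumes L: "L > 0" and G0: "G 0 = 0"
    and der: "\<And>t. (G has_vector_derivative g t) (at t)"
    and bd: "\<And>t. norm (g t) \<le> L * K * exp (2 * L * \<bar>t\<bar>)" and "K \<ge> 0"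
  shows "norm (G t) \<le> K / 2 * exp (2 * L * \<bar>t\<bar>)"
proof -
  have pos: "norm (F t) \<le> K / 2 * exp (2 * L * t)"
    if "t > 0" "F 0 = 0" "\<And>t. (F has_vector_derivative f t) (at t)"
      "\<And>t. norm (f t) \<le> L * K * exp (2 * L * \<bar>t\<bar>)" for F :: "real \<Rightarrow> 'a" and f t
  proof -
    have "norm (F t - F 0) \<le> K / 2 * exp (2 * L * t) - K / 2 * exp (2 * L * 0)"
    proof (rule differentiable_bound_general[where f' = f and \<phi>' = "\<lambda>s. L * K * exp (2 * L * s)"])
      show "continuous_on {0..t} F"
        using that(3) by (meson continuous_at_imp_continuous_on has_vector_derivative_continuous)
      show "\<And>x. 0 < x \<Longrightarrow> x < t \<Longrightarrow>
          ((\<lambda>x. K / 2 * exp (2 * L * x)) has_vector_derivative L * K * exp (2 * L * x)) (at x)"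
        unfolding has_real_derivative_iff_has_vector_derivative[symmetric]
        by (auto intro!: derivative_eq_intros)
      show "continuous_on {0..t} (\<lambda>x. K / 2 * exp (2 * L * x))" by (intro continuous_intros)
      fix x assume "0 < x" "x < t" thus "norm (f x) \<le> L * K * exp (2 * L * x)" using that(4)[of x] by auto
    qed (use that in auto)
    thus ?thesis using that \<open>K \<ge> 0\<close> by auto
  qed
  consider "t > 0" | "t = 0" | "t < 0" by linarith
  thus ?thesis
  proof cases
    case 1 thus ?thesis using pos[of t G g] assms by auto
  next
    case 2 thus ?thesis using assms by auto
  next
    case 3
    have "((\<lambda>s. G (- s)) has_vector_derivative - g (- s)) (at s)" for s
    proof -
      have "(uminus has_vector_derivative - 1) (at s)" for s :: real
        by (auto intro!: derivative_eq_intros)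
      from vector_diff_chain_at[OF this[of s], of G "g (- s)"] der[of "- s"]
      show ?thesis by (simp add: o_def)
    qed
    moreover have "norm (- g (- s)) \<le> L * K * exp (2 * L * \<bar>s\<bar>)" for s
      using bd[of "- s"] by simp
    ultimately show ?thesis using pos[of "- t" "\<lambda>s. G (- s)" "\<lambda>s. - g (- s)"] 3 G0 by simp
  qed
qed

text \<open>Picard's fixed point argument on the whole line at once: in the norm
\<open>sup exp (- 2 L |t|) |u(t)|\<close> the integral operator contracts by \<open>1/2\<close> whatever the length of the time
interval, so no local solutions have to be glued.\<close>

lemma lipschitz_bounded_ode_solution:
  fixes X :: "'a::euclidean_space \<Rightarrow> 'a"
  assumes L: "L > 0" and lip: "\<And>x y. norm (X x - X y) \<le> L * norm (x - y)"
    and bd: "\<And>x. norm (X x) \<le> K"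
  obtains z where "z 0 = z0" "\<And>t. (z has_vector_derivative X (z t)) (at t)"
proof -
  have K0: "K \<ge> 0" using bd[of 0] norm_ge_zero order_trans by blast
  have contX: "continuous_on UNIV X"
    by (rule continuous_on_iff[THEN iffD2])
       (metis (no_types, lifting) L lip dist_norm mult.commute pos_less_divide_eq divide_pos_pos order_le_less_trans)
  have anti: "\<exists>F. F 0 = 0 \<and> (\<forall>t. (F has_vector_derivative f t) (at t))"
    if "continuous_on UNIV f" for f :: "real \<Rightarrow> 'a"
  proof -
    have "\<exists>F. \<forall>x. (F has_vector_derivative f x) (at x)"
      using einterval_antiderivative[of "-\<infinity>" "\<infinity>" f] that
      by (simp add: continuous_on_eq_continuous_at)
    then obtain F where F: "\<And>x. (F has_vector_derivative f x) (at x)" by blast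
    have "((\<lambda>t. F t - F 0) has_vector_derivative f t) (at t)" for t
      using F[of t] by (auto intro!: derivative_eq_intros)
    thus ?thesis by (intro exI[of _ "\<lambda>t. F t - F 0"]) auto
  qed
  define w where "w = (\<lambda>t. exp (2 * L * \<bar>t\<bar>))"
  have w: "w t > 0" "w t \<ge> 1" "continuous_on UNIV w" for t
    using L unfolding w_def by (auto intro!: continuous_intros)
  \<comment> \<open>curves are written as \<open>z0 + w v\<close> with \<open>v\<close> bounded, so that the sup norm of \<open>v\<close> is the weighted norm\<close>
  define f where "f v s = X (z0 + w s *\<^sub>R apply_bcontfun v s)" for v :: "real \<Rightarrow>\<^sub>C 'a" and s
  have contf: "continuous_on UNIV (f v)" for v
    unfolding f_def by (rule continuous_on_compose2[OF contX])
      (auto intro!: continuous_intros w(3))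
  define I where "I v = (SOME F. F 0 = 0 \<and> (\<forall>t. (F has_vector_derivative f v t) (at t)))" for v
  have I: "I v 0 = 0" "(I v has_vector_derivative f v t) (at t)" for v t
    using someI_ex[OF anti[OF contf[of v]]] unfolding I_def by auto
  have contI: "continuous_on UNIV (I v)" for v
    using I(2) by (meson continuous_at_imp_continuous_on has_vector_derivative_continuous)
  have "(\<lambda>t. I v t /\<^sub>R w t) \<in> bcontfun" for v
  proof (rule bcontfun_normI)
    show "continuous_on UNIV (\<lambda>t. I v t /\<^sub>R w t)"
      using w by (intro continuous_intros contI) (auto simp: less_imp_neq[symmetric] intro: w(3))
    fix t
    have "norm (f v t) \<le> L * (K / L) * exp (2 * L * \<bar>t\<bar>)" for t
    proof -
      have "norm (f v t) \<le> K * 1" using bd by (auto simp: f_def)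
      also have "\<dots> \<le> K * exp (2 * L * \<bar>t\<bar>)" using K0 w(2)[of t] unfolding w_def by (intro mult_left_mono) auto
      finally show ?thesis using L by simp
    qed
    from exp_weighted_bound[OF L I(1) I(2) this, of t] K0 L
    have "norm (I v t) \<le> K / L / 2 * w t" by (simp add: w_def)
    thus "norm (I v t /\<^sub>R w t) \<le> K / L / 2"
      using w(1)[of t] by (simp add: field_simps)
  qed
  hence T: "apply_bcontfun (Bcontfun (\<lambda>t. I v t /\<^sub>R w t)) = (\<lambda>t. I v t /\<^sub>R w t)" for v
    by (simp add: Bcontfun_inverse)
  define T where "T v = Bcontfun (\<lambda>t. I v t /\<^sub>R w t)" for v
  have contr: "dist (T u) (T v) \<le> 1 / 2 * dist u v" for u v
  proof (rule dist_bound)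
    fix t
    define D where "D t = I u t - I v t" for t
    have "norm (D t) \<le> dist u v / 2 * exp (2 * L * \<bar>t\<bar>)"
    proof (rule exp_weighted_bound[OF L])
      show "D 0 = 0" by (simp add: D_def I)
      show "(D has_vector_derivative f u t - f v t) (at t)" for t
        unfolding D_def by (intro derivative_intros I)
      show "norm (f u t - f v t) \<le> L * dist u v * exp (2 * L * \<bar>t\<bar>)" for t
      proof -
        have "norm (f u t - f v t) \<le> L * norm (w t *\<^sub>R (u t - v t))"
          unfolding f_def using lip[of "z0 + w t *\<^sub>R u t" "z0 + w t *\<^sub>R v t"] by (simp add: scaleR_diff_right)
        also have "\<dots> \<le> L * (w t * dist u v)"
          using L w(1)[of t] dist_bounded[of u t v] by (auto simp: dist_norm)
        finally show ?thesis by (simp add: w_def mult_ac)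
      qed
    qed auto
    hence "norm (D t) \<le> dist u v / 2 * w t" by (simp add: w_def)
    moreover have "dist (T u t) (T v t) = norm (D t) / w t"
      using w(1)[of t] unfolding T_def T D_def dist_norm
      by (simp add: divide_inverse mult.commute flip: scaleR_diff_right)
    ultimately show "dist (T u t) (T v t) \<le> 1 / 2 * dist u v"
      using w(1)[of t] by (simp add: divide_le_eq mult.commute)
  qed
  obtain v where v: "T v = v"
    using banach_fix_type[of "1/2" T] contr by auto
  define z where "z t = z0 + w t *\<^sub>R v t" for t
  have "v t = I v t /\<^sub>R w t" for t using T[of v] v unfolding T_def by metis
  hence z: "z t = z0 + I v t" for t using w(1)[of t] by (simp add: z_def)
  show thesis
  proof (rule that[of z])
    show "z 0 = z0" by (simp add: z I)
    fix t
    have "f v t = X (z t)" by (simp add: f_def z_def)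
    moreover have "((\<lambda>t. z0 + I v t) has_vector_derivative f v t) (at t)"
      using I(2)[of v t] by (auto intro!: derivative_eq_intros)
    ultimately show "(z has_vector_derivative X (z t)) (at t)" using z[abs_def] by simp
  qed
qed

section \<open>Smoothing by Fejer kernels\<close>

definition tone :: "real \<Rightarrow> complex" where
  "tone x = cis (2 * pi * x)"

lemma tone_0 [simp]: "tone 0 = 1"
  and norm_tone [simp]: "norm (tone x) = 1"
  and tone_add: "tone (x + y) = tone x * tone y"
  and cnj_tone: "cnj (tone x) = tone (- x)"
  and tone_of_int [simp]: "tone (of_int k) = 1"
proof -
  show "tone (of_int k) = 1" by (simp add: tone_def cis.ctr complex_eq_iff cos_int_2pin sin_int_2pin)
qed (auto simp: tone_def cis_mult cis_cnj distrib_left)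

lemma continuous_on_tone [continuous_intros]:
  "continuous_on S f \<Longrightarrow> continuous_on S (\<lambda>x. tone (f x))"
  unfolding tone_def by (intro continuous_intros)

lemma integral_tone:
  "integral {a..a + 1} (\<lambda>y. tone (of_int k * y)) = (if k = 0 then 1 else 0)"
proof (cases "k = 0")
  case False
  let ?F = "\<lambda>y. tone (of_int k * y) / (2 * pi * k * \<i>)"
  have "((\<lambda>y. tone (of_int k * y)) has_integral (?F (a + 1) - ?F a)) {a..a + 1}"
  proof (rule fundamental_theorem_of_calculus)
    fix y :: real
    have "((\<lambda>y. exp (\<i> * (2 * pi * (of_int k * y))) / (2 * pi * of_int k * \<i>)) has_field_derivative
        exp (\<i> * (2 * pi * (of_int k * complex_of_real y)))) (at (complex_of_real y))"
      using False by (auto intro!: derivative_eq_intros simp: field_simps)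
    from has_vector_derivative_real_field[OF this, of "{a..a + 1}"]
    show "(?F has_vector_derivative tone (of_int k * y)) (at y within {a..a + 1})"
      by (simp add: tone_def cis_conv_exp)
  qed auto
  moreover have "tone (of_int k * (a + 1)) = tone (of_int k * a)"
    by (simp add: distrib_left tone_add)
  ultimately show ?thesis using False by (simp add: integral_unique)
qed auto

text \<open>The increment of a primitive over one period has derivative zero.\<close>

lemma integral_periodic_shift:
  fixes h :: "real \<Rightarrow> 'a::euclidean_space"
  assumes cont: "continuous_on UNIV h" and per: "\<And>x. h (x + 1) = h x"
  shows "integral {a..a + 1} h = integral {b..b + 1} h"
proof -
  have "\<exists>F. \<forall>x. (F has_vector_derivative h x) (at x)"
    using einterval_antiderivative[of "-\<infinity>" "\<infinity>" h] cont
    by (simp add: continuous_on_eq_continuous_at)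
  then obtain F where F: "\<And>x. (F has_vector_derivative h x) (at x)" by blast
  have int: "integral {c..c + 1} h = F (c + 1) - F c" for c
    by (intro integral_unique fundamental_theorem_of_calculus)
       (auto intro: has_vector_derivative_at_within F)
  have "((\<lambda>c. F (c + 1) - F c) has_vector_derivative 0) (at c)" for c
  proof -
    have "((\<lambda>c. c + 1) has_vector_derivative 1) (at c)" by (auto intro!: derivative_eq_intros)
    from vector_diff_chain_at[OF this F]
    have "((\<lambda>c. F (c + 1)) has_vector_derivative h (c + 1)) (at c)" by (simp add: o_def)
    from has_vector_derivative_diff[OF this F[of c]] show ?thesis by (simp add: per)
  qed
  then obtain k where "\<And>c. F (c + 1) - F c = k"
    using has_vector_derivative_zero_constant[of UNIV "\<lambda>c. F (c + 1) - F c"]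
    by (auto simp: has_vector_derivative_at_within)
  thus ?thesis by (simp add: int)
qed

text \<open>The Fejer kernel of the circle of length one; the square form makes its positivity evident.\<close>

definition fejer :: "nat \<Rightarrow> real \<Rightarrow> real" where
  "fejer N y = (norm (\<Sum>a<N. tone (of_int (int a) * y)))\<^sup>2 / N"

lemma fejer_nonneg: "fejer N y \<ge> 0"
  by (simp add: fejer_def)

lemma fejer_conv_sum:
  "complex_of_real (fejer N y) = (\<Sum>a<N. \<Sum>b<N. tone (of_int (int a - int b) * y)) / N"
proof -
  have "complex_of_real (fejer N y) =
      (\<Sum>a<N. tone (of_int (int a) * y)) * cnj (\<Sum>b<N. tone (of_int (int b) * y)) / N"
    by (simp only: fejer_def of_real_divide of_real_of_nat_eq complex_norm_square cnj_sum)
  also have "\<dots> = (\<Sum>a<N. \<Sum>b<N. tone (of_int (int a - int b) * y)) / N"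
    by (simp add: sum_product cnj_tone left_diff_distrib flip: tone_add)
  finally show ?thesis .
qed

lemma continuous_on_fejer [continuous_intros]:
  "continuous_on S f \<Longrightarrow> continuous_on S (\<lambda>x. fejer N (f x))"
  unfolding fejer_def by (cases "N = 0") (auto intro!: continuous_intros)

lemma fejer_uminus: "fejer N (- y) = fejer N y"
proof -
  have "(\<Sum>a<N. tone (of_int (int a) * - y)) = cnj (\<Sum>a<N. tone (of_int (int a) * y))"
    by (simp add: cnj_tone)
  thus ?thesis unfolding fejer_def by (simp only: complex_mod_cnj)
qed

lemma fejer_periodic: "fejer N (y + 1) = fejer N y"
  by (simp add: fejer_def distrib_left tone_add del: of_int_of_nat_eq)

lemma integral_fejer:
  assumes "N > 0"
  shows "integral {-(1/2)..1/2} (fejer N) = 1"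
proof -
  have "complex_of_real (integral {-(1/2)..1/2} (fejer N)) =
      integral {-(1/2)..-(1/2) + 1} (\<lambda>y. \<Sum>a<N. \<Sum>b<N. tone (of_int (int a - int b) * y) / N)"
  proof -
    have "fejer N integrable_on {-(1/2)..1/2}"
      by (intro integrable_continuous_real continuous_intros)
    from has_integral_linear[OF integrable_integral[OF this] bounded_linear_of_real[where 'a = complex]]
    show ?thesis
      by (simp add: fejer_conv_sum sum_divide_distrib integral_unique o_def)
  qed
  also have "\<dots> = (\<Sum>a<N. \<Sum>b<N. integral {-(1/2)..-(1/2) + 1} (\<lambda>y. tone (of_int (int a - int b) * y)) / N)"
    by (subst integral_sum; (intro finite_lessThan integrable_sum integrable_continuous_real continuous_intros)?;
        (simp add: assms)?)+
  also have "\<dots> = (\<Sum>a<N. \<Sum>b<N. (if a = b then 1 else 0) / of_nat N)"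
    unfolding integral_tone by (intro sum.cong) auto
  also have "\<dots> = 1" using assms by (simp add: sum.delta flip: sum_divide_distrib)
  finally show ?thesis by simp
qed

text \<open>The geometric sum gives \<open>|\<Sum> e(a y)| |e(y) - 1| \<le> 2\<close>, and \<open>|e(y) - 1| = 2 |sin (\<pi> y)| \<ge> 4 |y|\<close> since
sine is concave on the quarter period. The first absolute moment of the kernel is of order
\<open>log N / N\<close>; working with the second one avoids the logarithm.\<close>

lemma fejer_second_moment_bound:
  assumes "\<bar>y\<bar> \<le> 1/2" "N > 0"
  shows "fejer N y * y\<^sup>2 \<le> 1 / (4 * real N)"
proof -
  let ?S = "\<Sum>a<N. tone (of_int (int a) * y)"
  have "norm (tone y - 1) = 2 * \<bar>sin (pi * y)\<bar>"
  proof -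
    have "(norm (tone y - 1))\<^sup>2 = (2 * \<bar>sin (pi * y)\<bar>)\<^sup>2"
    proof -
      let ?c = "cos (2 * pi * y)" and ?s = "sin (2 * pi * y)"
      have "(norm (tone y - 1))\<^sup>2 = (?c - 1)\<^sup>2 + ?s\<^sup>2" by (simp add: tone_def cmod_power2)
      also have "\<dots> = 2 - 2 * ?c"
        using sin_cos_squared_add[of "2 * pi * y"] by (simp add: power2_diff)
      also have "\<dots> = 4 * (sin (pi * y))\<^sup>2"
        using cos_double_sin[of "pi * y"] by (simp add: mult.assoc)
      finally show ?thesis by (simp add: power_mult_distrib)
    qed
    thus ?thesis by (rule power2_eq_imp_eq) auto
  qed
  moreover have "\<bar>sin (pi * y)\<bar> \<ge> 2 * \<bar>y\<bar>"
  proof -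
    have "sin (pi * u) \<ge> 2 * u" if "0 \<le> u" "u \<le> 1/2" for u
    proof -
      have "concave_on {0..1/2} (\<lambda>u. sin (pi * u))"
        by (rule f''_le0_imp_concave[where f' = "\<lambda>u. pi * cos (pi * u)"
                and f'' = "\<lambda>u. - (pi\<^sup>2 * sin (pi * u))"])
          (auto intro!: derivative_eq_intros mult_nonneg_nonneg sin_ge_zero mult_left_le simp: power2_eq_square)
      from concave_onD[OF this, of "2 * u" 0 "1/2"] that show ?thesis by simp
    qed
    from this[of "\<bar>y\<bar>"] assms show ?thesis by (cases "y \<ge> 0") auto
  qed
  ultimately have lower: "norm (tone y - 1) \<ge> 4 * \<bar>y\<bar>" by linarith
  have "(\<Sum>a<N. tone y ^ a) * (tone y - 1) = tone y ^ N - 1"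
    by (metis mult.commute power_diff_1_eq)
  moreover have "tone (of_int (int a) * y) = tone y ^ a" for a
    unfolding tone_def by (subst Complex.DeMoivre, rule arg_cong[where f = cis]) simp
  ultimately have "norm ?S * norm (tone y - 1) \<le> 2"
    by (metis (no_types, lifting) norm_mult norm_triangle_ineq4 norm_one norm_power norm_tone one_add_one power_one sum.cong)
  moreover have "norm ?S * (4 * \<bar>y\<bar>) \<le> norm ?S * norm (tone y - 1)"
    by (intro mult_left_mono lower) auto
  ultimately have "norm ?S * \<bar>y\<bar> \<le> 1/2" by linarith
  hence "(norm ?S * \<bar>y\<bar>)\<^sup>2 \<le> (1/2)\<^sup>2" by (intro power_mono) auto
  hence "(norm ?S)\<^sup>2 * y\<^sup>2 \<le> 1/4" by (simp add: power_mult_distrib power_divide)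
  thus ?thesis using assms by (simp add: fejer_def field_simps)
qed

abbreviation shift :: "real ^ 'n \<Rightarrow> 'n \<Rightarrow> real \<Rightarrow> real ^ 'n" where
  "shift x j y \<equiv> x + y *\<^sub>R axis j 1"

definition fejer_smooth :: "nat \<Rightarrow> 'n \<Rightarrow> (real ^ 'n \<Rightarrow> complex) \<Rightarrow> real ^ 'n \<Rightarrow> complex" where
  "fejer_smooth N j f x = integral {-(1/2)..1/2} (\<lambda>y. of_real (fejer N y) * f (shift x j y))"

text \<open>Second differences rather than second derivatives: averages of translates inherit the bound, and
it is what the Fejer kernel needs.\<close>

definition periodic_C11 :: "real \<Rightarrow> (real ^ 'n \<Rightarrow> complex) \<Rightarrow> bool" where
  "periodic_C11 D f \<longleftrightarrow> continuous_on UNIV f \<and> torus_periodic f \<and>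
     (\<forall>x j y. norm (f (shift x j y) + f (shift x j (- y)) - 2 * f x) \<le> D * y\<^sup>2)"

lemma fejer_smooth_integrable:
  fixes f :: "real ^ 'n \<Rightarrow> complex"
  assumes "continuous_on UNIV f"
  shows "(\<lambda>y. of_real (fejer N y) * f (shift x j y)) integrable_on {-(1/2)..1/2}"
  by (intro integrable_continuous_real continuous_intros continuous_on_compose2[OF assms]) auto

lemma continuous_on_fejer_smooth:
  assumes "continuous_on UNIV f"
  shows "continuous_on UNIV (fejer_smooth N j f)"
  unfolding fejer_smooth_def cbox_interval[symmetric]
  by (rule integral_continuous_on_param)
     (auto simp: split_beta intro!: continuous_intros continuous_on_compose2[OF assms])

lemma norm_fejer_integral_le:
  fixes g :: "real \<Rightarrow> complex"
  assumes "continuous_on UNIV g" "\<And>y. norm (g y) \<le> K" "N > 0"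
  shows "norm (integral {-(1/2)..1/2} (\<lambda>y. of_real (fejer N y) * g y)) \<le> K"
proof -
  have "norm (integral {-(1/2)..1/2} (\<lambda>y. of_real (fejer N y) * g y)) \<le> integral {-(1/2)..1/2} (\<lambda>y. fejer N y * K)"
  proof (rule Henstock_Kurzweil_Integration.integral_norm_bound_integral)
    show "norm (complex_of_real (fejer N y) * g y) \<le> fejer N y * K" for y
      using mult_left_mono[OF assms(2)[of y] fejer_nonneg[of N y]] by (simp add: norm_mult fejer_nonneg)
  qed (auto intro!: integrable_continuous_real continuous_intros continuous_on_subset[OF assms(1)])
  also have "\<dots> = K" using integral_fejer[OF assms(3)] by simp
  finally show ?thesis .
qed

lemma periodic_C11_fejer_smooth:
  assumes f: "periodic_C11 D f" and N: "N > 0"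
  shows "periodic_C11 D (fejer_smooth N j f)"
  unfolding periodic_C11_def
proof (intro conjI allI)
  have cont: "continuous_on UNIV f" and per: "torus_periodic f"
    and dd: "\<And>x j y. norm (f (shift x j y) + f (shift x j (- y)) - 2 * f x) \<le> D * y\<^sup>2"
    using f by (auto simp: periodic_C11_def)
  show "continuous_on UNIV (fejer_smooth N j f)" by (rule continuous_on_fejer_smooth[OF cont])
  show "torus_periodic (fejer_smooth N j f)"
    unfolding torus_periodic_def
  proof (intro allI impI)
    fix k \<theta> :: "real ^ 'a" assume "\<forall>j. k $ j \<in> \<int>"
    hence "f (shift (\<theta> + k) j y) = f (shift \<theta> j y)" for y
      using per[unfolded torus_periodic_def, rule_format, of k "shift \<theta> j y"] by (simp add: add_ac)
    thus "fejer_smooth N j f (\<theta> + k) = fejer_smooth N j f \<theta>" by (simp add: fejer_smooth_def)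
  qed
  fix x :: "real ^ 'a" and k y
  let ?I = "\<lambda>x. \<lambda>t. of_real (fejer N t) * f (shift x j t)"
  note int = fejer_smooth_integrable[OF cont, of N _ j]
  have "fejer_smooth N j f (shift x k y) + fejer_smooth N j f (shift x k (- y)) - 2 * fejer_smooth N j f x
     = integral {-(1/2)..1/2} (\<lambda>t. ?I (shift x k y) t + ?I (shift x k (- y)) t - 2 * ?I x t)"
    unfolding fejer_smooth_def
    by (rule integral_unique[symmetric])
      (intro has_integral_diff has_integral_add has_integral_mult_right integrable_integral int)
  also have "\<dots> = integral {-(1/2)..1/2} (\<lambda>t. of_real (fejer N t) *
      (f (shift (shift x j t) k y) + f (shift (shift x j t) k (- y)) - 2 * f (shift x j t)))"
    by (simp add: algebra_simps)
  also have "norm \<dots> \<le> D * y\<^sup>2"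
    by (rule norm_fejer_integral_le[OF _ dd N])
       (intro continuous_intros continuous_on_compose2[OF cont]; simp)+
  finally show "norm (fejer_smooth N j f (shift x k y) + fejer_smooth N j f (shift x k (- y))
      - 2 * fejer_smooth N j f x) \<le> D * y\<^sup>2" .
qed

text \<open>The kernel is even, so the error is half of the kernel mean of a second difference of size
\<open>D y\<^sup>2\<close>, and the bound on \<open>y\<^sup>2\<close> times the kernel applies.\<close>

lemma fejer_smooth_error:
  assumes f: "periodic_C11 D f" and N: "N > 0"
  shows "norm (fejer_smooth N j f x - f x) \<le> D / (8 * real N)"
proof -
  have cont: "continuous_on UNIV f"
    and dd: "\<And>x j y. norm (f (shift x j y) + f (shift x j (- y)) - 2 * f x) \<le> D * y\<^sup>2"
    using f by (auto simp: periodic_C11_def)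
  have "D * 1\<^sup>2 \<ge> 0" using dd order_trans norm_ge_zero by blast
  hence D: "D \<ge> 0" by simp
  let ?I = "\<lambda>y. of_real (fejer N y) * f (shift x j y)"
  have "integral {-(1/2)..-(-(1/2))} (\<lambda>y. ?I (- y)) = integral {-(1/2)..1/2} ?I"
    by (rule Henstock_Kurzweil_Integration.integral_reflect_real)
  moreover have intr: "(\<lambda>y. ?I (- y)) integrable_on {-(1/2)..1/2}" "?I integrable_on {-(1/2)..1/2}"
     "(\<lambda>y. of_real (fejer N y) * f x) integrable_on {-(1/2)..1/2}"
    by (intro integrable_continuous_real continuous_intros continuous_on_compose2[OF cont]; simp)+
  moreover have "integral {-(1/2)..1/2} (\<lambda>y. of_real (fejer N y) * f x) = f x"
  proof -
    have "fejer N integrable_on {-(1/2)..1/2}"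
      by (intro integrable_continuous_real continuous_intros)
    from has_integral_linear[OF integrable_integral[OF this] bounded_linear_of_real[where 'a = complex]]
    have "((\<lambda>y. complex_of_real (fejer N y)) has_integral 1) {-(1/2)..1/2}"
      by (simp add: integral_fejer[OF N] o_def)
    from integral_unique[OF has_integral_mult_left[OF this, of "f x"]]
    show ?thesis unfolding mult_1_left .
  qed
  ultimately have "2 * (fejer_smooth N j f x - f x) = integral {-(1/2)..1/2} (\<lambda>y. ?I y + ?I (- y) - 2 * (of_real (fejer N y) * f x))"
    by (simp add: fejer_smooth_def Henstock_Kurzweil_Integration.integral_diff
        Henstock_Kurzweil_Integration.integral_add Henstock_Kurzweil_Integration.integrable_add)
  also have "\<dots> = integral {-(1/2)..1/2} (\<lambda>y. of_real (fejer N y) * (f (shift x j y) + f (shift x j (- y)) - 2 * f x))"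
    by (simp add: algebra_simps fejer_uminus)
  also have "norm \<dots> \<le> integral {-(1/2)..1/2} (\<lambda>y::real. D / (4 * real N))"
  proof (rule Henstock_Kurzweil_Integration.integral_norm_bound_integral)
    fix y :: real assume "y \<in> {-(1/2)..1/2}"
    hence y: "\<bar>y\<bar> \<le> 1/2" by auto
    have "norm (of_real (fejer N y) * (f (shift x j y) + f (shift x j (- y)) - 2 * f x)) \<le> fejer N y * (D * y\<^sup>2)"
      using mult_left_mono[OF dd[of x y j] fejer_nonneg[of N y]] by (simp add: norm_mult fejer_nonneg)
    also have "\<dots> \<le> D * (1 / (4 * real N))"
      using mult_left_mono[OF fejer_second_moment_bound[OF y N] D] by (simp add: mult_ac)
    finally show "norm (of_real (fejer N y) * (f (shift x j y) + f (shift x j (- y)) - 2 * f x)) \<le> D / (4 * real N)" by simp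
  qed (intro integrable_continuous_real continuous_intros continuous_on_compose2[OF cont]; simp)+
  finally have "2 * norm (fejer_smooth N j f x - f x) \<le> D / (4 * real N)"
    unfolding norm_mult by simp
  thus ?thesis by (simp add: field_simps)
qed

section \<open>Trigonometric polynomials in some of the angles\<close>

definition independent_of :: "'n set \<Rightarrow> (real ^ 'n \<Rightarrow> 'b) \<Rightarrow> bool" where
  "independent_of J c \<longleftrightarrow> (\<forall>x x'. (\<forall>j. j \<notin> J \<longrightarrow> x $ j = x' $ j) \<longrightarrow> c x = c x')"

text \<open>The coefficients may be arbitrary functions of the angles outside \<open>J\<close>. Being a span, the class has
its properties checked on monomials, with no bookkeeping of coefficient families.\<close>

inductive trig_poly ::
  "'n::{finite,linorder} set \<Rightarrow> nat \<Rightarrow> ((real, 'n) vec \<Rightarrow> complex) \<Rightarrow> bool"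
  for J :: "'n::{finite,linorder} set" and N :: nat where
  monomial: "continuous_on UNIV c \<Longrightarrow> torus_periodic c \<Longrightarrow> independent_of J c \<Longrightarrow> (\<And>j. j \<notin> J \<Longrightarrow> k $ j = 0) \<Longrightarrow>
    (\<And>j. \<bar>k $ j\<bar> < int N) \<Longrightarrow> trig_poly J N (\<lambda>x. c x * tone (freq_dot k x))"
| add: "trig_poly J N f \<Longrightarrow> trig_poly J N g \<Longrightarrow> trig_poly J N (\<lambda>x. f x + g x)"

lemma freq_dot_0 [simp]: "freq_dot 0 x = 0"
  by (simp add: freq_dot_def)

lemma freq_dot_add_right: "freq_dot k (x + y) = freq_dot k x + freq_dot k y"
  and freq_dot_scaleR_right: "freq_dot k (a *\<^sub>R x) = a * freq_dot k x"
  by (simp_all add: freq_dot_def distrib_left sum.distrib sum_distrib_left mult_ac)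

lemma freq_dot_axis_right: "freq_dot k (axis j a) = of_int (k $ j) * a"
  by (simp add: freq_dot_def axis_def if_distrib[of "\<lambda>x. _ * x"] sum.delta cong: if_cong)

lemma freq_dot_add_axis_left: "freq_dot (k + axis j l) x = freq_dot k x + of_int l * x $ j"
proof -
  have "(\<Sum>i\<in>UNIV. of_int (axis j l $ i) * x $ i) = of_int l * x $ j"
    by (simp add: axis_def if_distrib[of "\<lambda>z. of_int z * _"] if_distrib[of of_int] sum.delta cong: if_cong)
       (simp add: if_distrib[of "\<lambda>z. z * _"] sum.delta cong: if_cong)
  thus ?thesis by (simp add: freq_dot_def distrib_right sum.distrib)
qed

lemma continuous_on_freq_dot [continuous_intros]:
  "continuous_on S f \<Longrightarrow> continuous_on S (\<lambda>x. freq_dot k (f x))"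
  unfolding freq_dot_def by (intro continuous_intros)

lemma trig_poly_0: "N > 0 \<Longrightarrow> trig_poly J N (\<lambda>_. 0)"
  using trig_poly.monomial[of "\<lambda>_. 0" J 0 N] by (simp add: independent_of_def torus_periodic_def)

lemma trig_poly_sum:
  "finite S \<Longrightarrow> N > 0 \<Longrightarrow> (\<And>s. s \<in> S \<Longrightarrow> trig_poly J N (f s)) \<Longrightarrow> trig_poly J N (\<lambda>x. \<Sum>s\<in>S. f s x)"
  by (induction S rule: finite_induct) (auto intro: trig_poly_0 trig_poly.add)

lemma trig_poly_empty:
  assumes "continuous_on UNIV f" "torus_periodic f" "N > 0"
  shows "trig_poly {} N f"
proof -
  have "independent_of {} f" unfolding independent_of_def by (metis empty_iff vec_eq_iff)
  thus ?thesis using trig_poly.monomial[of f "{}" 0 N] assms by simp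
qed

lemma trig_poly_continuous: "trig_poly J N f \<Longrightarrow> continuous_on UNIV f"
  by (induction rule: trig_poly.induct) (auto intro!: continuous_intros)

text \<open>By periodicity the integration variable may be taken to be the \<open>j\<close>-th coordinate \<open>u\<close> itself, with
the kernel evaluated at \<open>u - x\<^sub>j\<close>. Expanding the kernel into exponentials separates \<open>u\<close> from \<open>x\<^sub>j\<close>;
what remains under the integral no longer depends on \<open>x\<^sub>j\<close>.\<close>

lemma trig_poly_fejer_smooth_monomial:
  fixes c :: "real ^ 'n::{finite,linorder} \<Rightarrow> complex"
  assumes c: "continuous_on UNIV c" "independent_of J c" "torus_periodic c" and k: "\<And>i. i \<notin> J \<Longrightarrow> k $ i = 0"
    and N: "\<And>i. \<bar>k $ i\<bar> < int N" and j: "j \<notin> J"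
  shows "trig_poly (insert j J) N (fejer_smooth N j (\<lambda>x. c x * tone (freq_dot k x)))"
proof -
  have N0: "N > 0" using N[of j] k[OF j] by simp
  define c' where "c' l x = integral {0..1} (\<lambda>u. tone (of_int l * u) * c (shift x j (u - x $ j))) / N" for l :: int and x
  have c': "continuous_on UNIV (c' l)" "torus_periodic (c' l)" "independent_of (insert j J) (c' l)" for l
  proof -
    show "continuous_on UNIV (c' l)"
      unfolding c'_def cbox_interval[symmetric] using N0
      by (intro continuous_intros integral_continuous_on_param)
         (auto simp: split_beta intro!: continuous_intros continuous_on_compose2[OF c(1)])
    show "torus_periodic (c' l)" unfolding torus_periodic_def
    proof (intro allI impI)
      fix x m :: "(real, 'n) vec" assume m: "\<forall>i. m $ i \<in> \<int>"
      have "c (shift (x + m) j (u - (x + m) $ j)) = c (shift x j (u - x $ j))" for u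
      proof -
        have "shift (x + m) j (u - (x + m) $ j) = shift x j (u - x $ j) + (\<chi> i. if i = j then 0 else m $ i)"
          by (simp add: vec_eq_iff axis_def)
        also have "c \<dots> = c (shift x j (u - x $ j))"
          using c(3)[unfolded torus_periodic_def] m by (auto intro!: allE[where x = j])
        finally show ?thesis .
      qed
      thus "c' l (x + m) = c' l x" by (simp add: c'_def)
    qed
    show "independent_of (insert j J) (c' l)" unfolding independent_of_def
    proof (intro allI impI)
      fix x x' :: "(real, 'n) vec" assume x: "\<forall>i. i \<notin> insert j J \<longrightarrow> x $ i = x' $ i"
      have "c (shift x j (u - x $ j)) = c (shift x' j (u - x' $ j))" for u
        using c(2) x unfolding independent_of_def by (auto simp: axis_def)
      thus "c' l x = c' l x'" by (simp add: c'_def)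
    qed
  qed
  have "fejer_smooth N j (\<lambda>x. c x * tone (freq_dot k x)) =
     (\<lambda>x. \<Sum>a<N. \<Sum>b<N. c' (int a - int b) x * tone (freq_dot (k + axis j (int b - int a)) x))"
  proof (rule ext)
    fix x
    define h where "h u = of_real (fejer N (u - x $ j)) * c (shift x j (u - x $ j))" for u
    have per: "c (shift x j 1) = c x" for x
      using c(3) by (auto simp: torus_periodic_def axis_def)
    have "continuous_on UNIV h"
      unfolding h_def by (auto intro!: continuous_intros continuous_on_compose2[OF c(1)])
    moreover have "h (u + 1) = h u" for u
      using fejer_periodic[of N "u - x $ j"] per[of "shift x j (u - x $ j)"]
      by (simp add: h_def algebra_simps)
    ultimately have h: "integral {x $ j - 1/2..x $ j - 1/2 + 1} h = integral {0..0 + 1} h"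
      by (rule integral_periodic_shift)
    have fk: "freq_dot k (shift x j y) = freq_dot k x" for y
      using k[OF j] by (simp add: freq_dot_add_right freq_dot_scaleR_right freq_dot_axis_right)
    have "fejer_smooth N j (\<lambda>x. c x * tone (freq_dot k x)) x
        = integral {-(1/2)..1/2} (\<lambda>y. h (x $ j + y) * tone (freq_dot k x))"
      by (simp add: fejer_smooth_def h_def fk mult_ac)
    also have "\<dots> = integral {-(1/2)..1/2} (h \<circ> (+) (x $ j)) * tone (freq_dot k x)"
      by (simp add: o_def)
    also have "integral {-(1/2)..1/2} (h \<circ> (+) (x $ j)) = integral {0..1} h"
      using h by (simp add: integral_shift_Icc_real add.commute)
    also have "integral {0..1} h = (\<Sum>a<N. \<Sum>b<N. c' (int a - int b) x * tone (- (int a - int b) * x $ j))"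
    proof -
      have hu: "h u = (\<Sum>a<N. \<Sum>b<N. tone (of_int (int a - int b) * u) * c (shift x j (u - x $ j)) / N *
          tone (- (int a - int b) * x $ j))" for u
      proof -
        have "tone (of_int (int a - int b) * (u - x $ j)) =
            tone (of_int (int a - int b) * u) * tone (- (int a - int b) * x $ j)" for a b
        proof -
          have "of_int (int a - int b) * (u - x $ j) =
              of_int (int a - int b) * u + of_int (- (int a - int b)) * x $ j"
            by (simp add: algebra_simps)
          thus ?thesis by (simp add: tone_add)
        qed
        hence "tone (of_int (int a - int b) * (u - x $ j)) / N * c (shift x j (u - x $ j)) =
            tone (of_int (int a - int b) * u) * c (shift x j (u - x $ j)) / N * tone (- (int a - int b) * x $ j)" for a b
          by (simp only:) simp
        thus ?thesis unfolding h_def fejer_conv_sum sum_divide_distrib sum_distrib_right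
          by (simp only:)
      qed
      have "(h has_integral (\<Sum>a<N. \<Sum>b<N. c' (int a - int b) x * tone (- (int a - int b) * x $ j))) {0..1}"
        unfolding hu[abs_def] c'_def
        by (intro has_integral_sum has_integral_mult_left has_integral_divide integrable_integral
            integrable_continuous_real continuous_intros continuous_on_compose2[OF c(1)] finite_lessThan) auto
      thus ?thesis by (rule integral_unique)
    qed
    also have "\<dots> * tone (freq_dot k x) = (\<Sum>a<N. \<Sum>b<N. c' (int a - int b) x *
        (tone (freq_dot k x) * tone (- (int a - int b) * x $ j)))"
      by (simp add: sum_distrib_right sum_distrib_left mult_ac)
    also have "\<dots> = (\<Sum>a<N. \<Sum>b<N. c' (int a - int b) x * tone (freq_dot (k + axis j (int b - int a)) x))"
      by (simp add: freq_dot_add_axis_left flip: tone_add)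
    finally show "fejer_smooth N j (\<lambda>x. c x * tone (freq_dot k x)) x =
      (\<Sum>a<N. \<Sum>b<N. c' (int a - int b) x * tone (freq_dot (k + axis j (int b - int a)) x))" .
  qed
  moreover have "trig_poly (insert j J) N (\<lambda>x. \<Sum>a<N. \<Sum>b<N. c' (int a - int b) x * tone (freq_dot (k + axis j (int b - int a)) x))"
  proof (intro trig_poly_sum finite_lessThan N0 trig_poly.monomial c')
    fix a b i assume "a \<in> {..<N}" "b \<in> {..<N}"
    thus "\<bar>(k + axis j (int b - int a)) $ i\<bar> < int N"
      using N[of i] k[OF j] by (cases "i = j") (auto simp: axis_def)
  qed (use k in \<open>auto simp: axis_def\<close>)
  ultimately show ?thesis by simp
qed

lemma trig_poly_fejer_smooth:
  assumes "trig_poly J N f" "j \<notin> J"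
  shows "trig_poly (insert j J) N (fejer_smooth N j f)"
  using assms(1)
proof (induction rule: trig_poly.induct)
  case (monomial c k)
  thus ?case using assms(2) by (intro trig_poly_fejer_smooth_monomial)
next
  case (add f g)
  have "fejer_smooth N j (\<lambda>x. f x + g x) x = fejer_smooth N j f x + fejer_smooth N j g x" for x
    unfolding fejer_smooth_def distrib_left
    by (intro Henstock_Kurzweil_Integration.integral_add fejer_smooth_integrable trig_poly_continuous[OF add(1)]
        trig_poly_continuous[OF add(2)])
  thus ?case using trig_poly.add[OF add.IH] by simp
qed

text \<open>One angle is smoothed after the other. Each step costs \<open>D / (8 N)\<close> and keeps the bound \<open>D\<close> for the
next one.\<close>

lemma trig_poly_approximation:
  assumes "finite J" "periodic_C11 D f" "N > 0"
  shows "\<exists>p. trig_poly J N p \<and> periodic_C11 D p \<and> (\<forall>x. norm (p x - f x) \<le> card J * (D / (8 * real N)))"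
  using assms(1)
proof (induction J rule: finite_induct)
  case empty
  show ?case using assms trig_poly_empty[of f N] by (intro exI[of _ f]) (auto simp: periodic_C11_def)
next
  case (insert j J)
  then obtain p where p: "trig_poly J N p" "periodic_C11 D p"
    "\<And>x. norm (p x - f x) \<le> card J * (D / (8 * real N))" by blast
  have "norm (fejer_smooth N j p x - f x) \<le> card (insert j J) * (D / (8 * real N))" for x
  proof -
    have "norm (fejer_smooth N j p x - f x) \<le> norm (fejer_smooth N j p x - p x) + norm (p x - f x)"
      using norm_triangle_ineq[of "fejer_smooth N j p x - p x" "p x - f x"] by simp
    also have "\<dots> \<le> D / (8 * real N) + card J * (D / (8 * real N))"
      by (intro add_mono fejer_smooth_error p assms)
    also have "\<dots> = card (insert j J) * (D / (8 * real N))"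
      using insert by (simp add: distrib_right add_divide_distrib)
    finally show ?thesis .
  qed
  thus ?case using trig_poly_fejer_smooth[OF p(1) insert(2)] periodic_C11_fejer_smooth[OF p(2) assms(3)]
    by blast
qed

section \<open>Means over a subtorus and means along a line\<close>

lemma norm_integral_le_integral:
  fixes f :: "'s \<Rightarrow> 'b::{banach, second_countable_topology}"
  assumes "integrable M f" "integrable M g" "\<And>s. norm (f s) \<le> g s"
  shows "norm (integral\<^sup>L M f) \<le> integral\<^sup>L M g"
  by (rule order_trans[OF integral_norm_bound integral_mono]) (use assms in auto)

definition fill :: "'n set \<Rightarrow> real ^ 'n \<Rightarrow> ('n \<Rightarrow> real) \<Rightarrow> real ^ 'n" where
  "fill J x s = (\<chi> j. if j \<in> J then s j else x $ j)"

abbreviation unit_measure :: "real measure" where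
  "unit_measure \<equiv> restrict_space lborel {0..1}"

abbreviation torus_measure :: "'n set \<Rightarrow> ('n \<Rightarrow> real) measure" where
  "torus_measure J \<equiv> Pi\<^sub>M J (\<lambda>_. unit_measure)"

definition torus_mean :: "'n set \<Rightarrow> (real ^ 'n \<Rightarrow> 'b::{banach, second_countable_topology}) \<Rightarrow> real ^ 'n \<Rightarrow> 'b" where
  "torus_mean J f x = (LINT s|torus_measure J. f (fill J x s))"

lemma averaged_eq_torus_mean:
  fixes A :: "(real, 'n::{finite,linorder}) vec \<Rightarrow> ((real, 'n) vec, 'n) vec"
  shows "averaged d A = torus_mean (last_indices d) A"
proof -
  have "(\<chi> j. if j \<in> first_indices d then \<theta> $ j else s j) = fill (last_indices d) \<theta> s"
    for \<theta> :: "(real, 'n) vec" and s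
    by (simp add: fill_def vec_eq_iff)
  thus ?thesis by (simp add: averaged_def torus_mean_def fun_eq_iff)
qed

lemma prob_space_unit: "prob_space unit_measure"
  by (rule prob_spaceI) (simp add: space_restrict_space emeasure_restrict_space)

lemma product_prob_space_unit: "product_prob_space (\<lambda>_. unit_measure)"
  using prob_space_unit by (auto simp: product_prob_space_def product_prob_space_axioms_def
      product_sigma_finite_def intro: prob_space_imp_sigma_finite)

lemma prob_space_torus: "prob_space (torus_measure J)"
  by (intro prob_space_PiM prob_space_unit)

lemma integral_unit:
  fixes g :: "real \<Rightarrow> 'b::euclidean_space"
  assumes "continuous_on UNIV g"
  shows "integrable unit_measure g" "integral\<^sup>L unit_measure g = integral {0..1} g"
proof -
  have int: "set_integrable lborel {0..1} g"
    by (intro borel_integrable_atLeastAtMost' continuous_on_subset[OF assms]) auto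
  thus "integrable unit_measure g" by (simp add: integrable_restrict_space set_integrable_def)
  show "integral\<^sup>L unit_measure g = integral {0..1} g"
    using set_borel_integral_eq_integral(2)[OF int]
    by (simp add: integral_restrict_space set_lebesgue_integral_def)
qed

lemma measurable_fill [measurable]:
  fixes x :: "real ^ 'n"
  shows "fill J x \<in> borel_measurable (torus_measure J)"
proof -
  have id: "(\<lambda>y. y) \<in> borel_measurable unit_measure"
    by (intro measurable_restrict_space1) auto
  have *: "(\<lambda>s. fill J x s $ j) \<in> borel_measurable (torus_measure J)" for j
  proof (cases "j \<in> J")
    case True
    from measurable_compose[OF measurable_component_singleton[OF True] id]
    have "(\<lambda>s. s j) \<in> borel_measurable (torus_measure J)" .
    thus ?thesis using True by (simp add: fill_def)
  qed (simp add: fill_def)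
  show ?thesis
    by (subst borel_measurable_euclidean_space) (auto simp: Basis_vec_def inner_axis *)
qed

lemma integrable_fill:
  fixes f :: "real ^ 'n \<Rightarrow> 'b::{banach, second_countable_topology}"
  assumes "continuous_on UNIV f" "\<And>x. norm (f x) \<le> K"
  shows "integrable (torus_measure J) (\<lambda>s. f (fill J x s))"
proof -
  interpret prob_space "torus_measure J" by (rule prob_space_torus)
  have "(\<lambda>s. f (fill J x s)) \<in> borel_measurable (torus_measure J)"
    by (rule measurable_compose[OF measurable_fill borel_measurable_continuous_onI[OF assms(1)]])
  thus ?thesis using assms(2) by (intro integrable_const_bound[of _ K]) auto
qed

lemma tone_sum: "finite S \<Longrightarrow> tone (\<Sum>j\<in>S. f j) = (\<Prod>j\<in>S. tone (f j))"
  by (induction S rule: finite_induct) (auto simp: tone_add)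

lemma freq_dot_fill:
  assumes "\<And>j. j \<notin> J \<Longrightarrow> k $ j = 0"
  shows "freq_dot k (fill J x s) = (\<Sum>j\<in>J. of_int (k $ j) * s j)"
  unfolding freq_dot_def fill_def using assms by (intro sum.mono_neutral_cong_right) auto

lemma torus_mean_monomial:
  fixes c :: "real ^ 'n::{finite,linorder} \<Rightarrow> complex"
  assumes "independent_of J c" and k: "\<And>j. j \<notin> J \<Longrightarrow> k $ j = 0"
  shows "torus_mean J (\<lambda>x. c x * tone (freq_dot k x)) x = (if k = 0 then c x else 0)"
proof -
  interpret product_prob_space "\<lambda>_::'n. unit_measure" by (rule product_prob_space_unit)
  have c: "c (fill J x s) = c x" for s
    using assms(1) by (auto simp: independent_of_def fill_def)
  have tone_meas: "continuous_on UNIV (\<lambda>y. tone (a * y))" for a by (intro continuous_intros)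
  have "torus_mean J (\<lambda>x. c x * tone (freq_dot k x)) x =
      (LINT s|torus_measure J. c x * (\<Prod>j\<in>J. tone (of_int (k $ j) * s j)))"
    unfolding torus_mean_def by (simp add: c freq_dot_fill[OF k] tone_sum)
  also have "\<dots> = c x * (LINT s|torus_measure J. (\<Prod>j\<in>J. tone (of_int (k $ j) * s j)))"
    by (rule Bochner_Integration.integral_mult_right_zero)
  also have "(LINT s|torus_measure J. (\<Prod>j\<in>J. tone (of_int (k $ j) * s j))) =
      (\<Prod>j\<in>J. integral\<^sup>L unit_measure (\<lambda>y. tone (of_int (k $ j) * y)))"
    by (rule product_integral_prod) (auto intro: integral_unit(1)[OF tone_meas])
  also have "\<dots> = (\<Prod>j\<in>J. if k $ j = 0 then 1 else 0)"
    using integral_tone[of 0] by (intro prod.cong refl) (simp only: integral_unit(2)[OF tone_meas] add_0)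
  also have "c x * \<dots> = (if k = 0 then c x else 0)"
  proof (cases "k = 0")
    case False
    then obtain j where "k $ j \<noteq> 0" by (auto simp: vec_eq_iff)
    hence "(\<Prod>j\<in>J. if k $ j = 0 then 1 else 0 :: complex) = 0"
      using k[of j] by (intro prod_zero) auto
    thus ?thesis using False by simp
  qed simp
  finally show ?thesis .
qed

lemma integrable_along_line:
  fixes f :: "real ^ 'n \<Rightarrow> 'b::{banach, second_countable_topology}"
  assumes "prob_space M" "sets M = sets borel" "continuous_on UNIV f" "\<And>x. norm (f x) \<le> K"
    and g: "continuous_on UNIV g"
  shows "integrable M (\<lambda>s::real. f (g s))"
proof -
  interpret prob_space M by fact
  have "(\<lambda>s. f (g s)) \<in> borel_measurable borel"
    by (intro borel_measurable_continuous_onI continuous_on_compose2[OF assms(3) g]) auto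
  hence "(\<lambda>s. f (g s)) \<in> borel_measurable M" by (simp add: measurable_cong_sets[OF assms(2) refl])
  thus ?thesis using assms(4) by (intro integrable_const_bound[of _ K]) auto
qed

text \<open>In both means only the constant mode survives: on the torus by orthogonality, on the line because
the monomial \<open>k\<close> oscillates in \<open>s\<close> with the frequency \<open>2 \<pi> T k \<cdot> \<omega>\<close>, of modulus at least
\<open>2 \<pi> > 4\<close>.\<close>

lemma line_mean_trig_poly:
  fixes \<omega> :: "(real, 'n::{finite,linorder}) vec"
  assumes M: "prob_space M" "sets M = sets borel" "\<And>\<xi>. \<bar>\<xi>\<bar> \<ge> 4 \<Longrightarrow> char M \<xi> = 0"
    and \<omega>: "\<And>j. j \<notin> J \<Longrightarrow> \<omega> $ j = 0"
    and small: "\<And>k. (\<And>j. j \<notin> J \<Longrightarrow> k $ j = 0) \<Longrightarrow> (\<And>j. \<bar>k $ j\<bar> < int N) \<Longrightarrow> k \<noteq> 0 \<Longrightarrow>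
        \<bar>T * freq_dot k \<omega>\<bar> \<ge> 1"
    and p: "trig_poly J N p"
  shows "integrable M (\<lambda>s. p (x + (T * s) *\<^sub>R \<omega>)) \<and> integrable (torus_measure J) (\<lambda>s. p (fill J x s)) \<and>
    (LINT s|M. p (x + (T * s) *\<^sub>R \<omega>)) = torus_mean J p x"
  using p
proof (induction rule: trig_poly.induct)
  case (monomial c k)
  interpret prob_space M by fact
  have c: "c (x + (T * s) *\<^sub>R \<omega>) = c x" "c (fill J x u) = c x" for s u
    using monomial(3) \<omega> by (auto simp: independent_of_def fill_def)
  have eq: "tone (freq_dot k (x + (T * s) *\<^sub>R \<omega>)) = tone (freq_dot k x) * iexp ((2 * pi * (T * freq_dot k \<omega>)) * s)" for s
    by (simp add: freq_dot_add_right freq_dot_scaleR_right tone_add)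
       (simp add: tone_def cis_conv_exp mult_ac)
  have "(LINT s|M. c x * (tone (freq_dot k x) * iexp ((2 * pi * (T * freq_dot k \<omega>)) * s)))
      = c x * (tone (freq_dot k x) * char M (2 * pi * (T * freq_dot k \<omega>)))"
    by (simp add: char_def)
  also have "\<dots> = (if k = 0 then c x else 0)"
  proof (cases "k = 0")
    case True thus ?thesis by (simp add: char_def prob_space)
  next
    case False
    have "1 \<le> \<bar>T * freq_dot k \<omega>\<bar>" using small[of k] monomial False by auto
    hence "2 * 2 * 1 \<le> 2 * pi * \<bar>T * freq_dot k \<omega>\<bar>" using pi_gt3 by (intro mult_mono) auto
    hence "\<bar>2 * pi * (T * freq_dot k \<omega>)\<bar> \<ge> 4" by (simp add: abs_mult)
    from M(3)[OF this] show ?thesis using False by simp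
  qed
  finally have "(LINT s|M. c x * tone (freq_dot k (x + (T * s) *\<^sub>R \<omega>))) = (if k = 0 then c x else 0)"
    by (simp only: eq)
  moreover have "integrable M (\<lambda>s. c x * tone (freq_dot k (x + (T * s) *\<^sub>R \<omega>)))"
    by (intro integrable_mult_right integrable_along_line[OF M(1,2), where K = 1] continuous_intros) auto
  moreover have "integrable (torus_measure J) (\<lambda>s. c x * tone (freq_dot k (fill J x s)))"
    by (intro integrable_mult_right integrable_fill[where K = 1] continuous_intros) auto
  ultimately show ?case using torus_mean_monomial[OF monomial(3) monomial(4), of x] by (simp add: c)
next
  case (add f g)
  thus ?case by (simp add: torus_mean_def)
qed

text \<open>The two means agree on a trigonometric polynomial close to \<open>f\<close>, so they differ by at most twice the
approximation error.\<close>

lemma line_mean_close_to_torus_mean: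
  fixes \<omega> :: "(real, 'n::{finite,linorder}) vec" and f :: "(real, 'n) vec \<Rightarrow> real"
  assumes M: "prob_space M" "sets M = sets borel" "\<And>\<xi>. \<bar>\<xi>\<bar> \<ge> 4 \<Longrightarrow> char M \<xi> = 0"
    and \<omega>: "\<And>j. j \<notin> J \<Longrightarrow> \<omega> $ j = 0"
    and small: "\<And>k. (\<And>j. j \<notin> J \<Longrightarrow> k $ j = 0) \<Longrightarrow> (\<And>j. \<bar>k $ j\<bar> < int N) \<Longrightarrow> k \<noteq> 0 \<Longrightarrow>
        \<bar>T * freq_dot k \<omega>\<bar> \<ge> 1"
    and f: "periodic_C11 D (\<lambda>x. of_real (f x))" and bd: "\<And>x. \<bar>f x\<bar> \<le> K" and N: "N > 0"
  shows "\<bar>(LINT s|M. f (x + (T * s) *\<^sub>R \<omega>)) - torus_mean J f x\<bar> \<le> card J * (D / (4 * real N))"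
proof -
  interpret M: prob_space M by fact
  interpret P: prob_space "torus_measure J" by (rule prob_space_torus)
  let ?f = "\<lambda>x. complex_of_real (f x)"
  have cont: "continuous_on UNIV ?f" using f by (simp add: periodic_C11_def)
  have nb: "norm (?f x) \<le> K" for x using bd by simp
  obtain p where p: "trig_poly J N p" "\<And>x. norm (p x - ?f x) \<le> card J * (D / (8 * real N))"
    using trig_poly_approximation[OF _ f N, of J] by auto
  have line: "integrable M (\<lambda>s. ?f (x + (T * s) *\<^sub>R \<omega>))"
    by (intro integrable_along_line[OF M(1,2) cont nb] continuous_intros)
  have fill: "integrable (torus_measure J) (\<lambda>s. ?f (fill J x s))"
    by (rule integrable_fill[OF cont nb])
  let ?a = "LINT s|M. ?f (x + (T * s) *\<^sub>R \<omega>)" and ?b = "LINT s|torus_measure J. ?f (fill J x s)"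
  let ?c = "LINT s|M. p (x + (T * s) *\<^sub>R \<omega>)"
  note P = line_mean_trig_poly[OF M \<omega> small p(1), of x]
  have lp: "integrable M (\<lambda>s. p (x + (T * s) *\<^sub>R \<omega>))" using P by blast
  have fp: "integrable (torus_measure J) (\<lambda>s. p (fill J x s))" using P by blast
  have c: "?c = (LINT s|torus_measure J. p (fill J x s))" using P unfolding torus_mean_def by blast
  have "norm (?c - ?a) \<le> card J * (D / (8 * real N))"
  proof -
    have "norm (LINT s|M. p (x + (T * s) *\<^sub>R \<omega>) - ?f (x + (T * s) *\<^sub>R \<omega>)) \<le> (LINT s|M. card J * (D / (8 * real N)))"
      by (intro norm_integral_le_integral Bochner_Integration.integrable_diff line lp p(2)) simp
    thus ?thesis using Bochner_Integration.integral_diff[OF lp line] by (simp only: M.prob_space lebesgue_integral_const) simp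
  qed
  moreover have "norm (?c - ?b) \<le> card J * (D / (8 * real N))"
  proof -
    have "norm (LINT s|torus_measure J. p (fill J x s) - ?f (fill J x s)) \<le> (LINT s|torus_measure J. card J * (D / (8 * real N)))"
      by (intro norm_integral_le_integral Bochner_Integration.integrable_diff fill fp p(2)) simp
    thus ?thesis using Bochner_Integration.integral_diff[OF fp fill] unfolding c
      by (simp only: P.prob_space lebesgue_integral_const) simp
  qed
  ultimately have "norm (?a - ?b) \<le> card J * (D / (8 * real N)) + card J * (D / (8 * real N))"
    using dist_triangle3[of ?a ?b ?c] unfolding dist_norm by linarith
  also have "\<dots> = card J * (D / (4 * real N))" by simp
  also have "?a - ?b = of_real ((LINT s|M. f (x + (T * s) *\<^sub>R \<omega>)) - torus_mean J f x)"
    unfolding torus_mean_def of_real_diff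
    by (simp only: Bochner_Integration.integral_complex_of_real)
  finally show ?thesis by (simp only: norm_of_real)
qed

text \<open>Integrating over the \<open>j\<close>-th angle first gives the increment of \<open>f\<close> over one period.\<close>

lemma torus_mean_partial_derivative:
  fixes f :: "real ^ 'n \<Rightarrow> 'b::euclidean_space"
  assumes j: "j \<in> J" and per: "\<And>x. f (shift x j 1) = f x"
    and der: "\<And>x y. ((\<lambda>y. f (shift x j y)) has_vector_derivative f' (shift x j y)) (at y)"
    and cont: "continuous_on UNIV f'" and bd: "\<And>x. norm (f' x) \<le> K"
  shows "torus_mean J f' x = 0"
proof -
  interpret product_prob_space "\<lambda>_::'n. unit_measure" by (rule product_prob_space_unit)
  obtain J' where J: "J = insert j J'" "j \<notin> J'" using j by (metis Set.set_insert)
  have "torus_mean J f' x = (LINT s|torus_measure J'. LINT y|unit_measure. f' (fill J x (s(j := y))))"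
    using product_integral_insert[OF _ J(2) integrable_fill[OF cont bd, of "insert j J'" x]]
    by (simp add: torus_mean_def J(1))
  also have "\<dots> = (LINT s|torus_measure J'. 0)"
  proof (rule Bochner_Integration.integral_cong[OF refl])
    fix s
    define z where "z = fill J x (s(j := 0))"
    have z: "fill J x (s(j := y)) = shift z j y" for y
      using j by (auto simp: z_def fill_def vec_eq_iff axis_def)
    have "(LINT y|unit_measure. f' (shift z j y)) = integral {0..1} (\<lambda>y. f' (shift z j y))"
      by (intro integral_unit continuous_on_compose2[OF cont] continuous_intros) auto
    also have "\<dots> = f (shift z j 1) - f (shift z j 0)"
      by (intro integral_unique fundamental_theorem_of_calculus)
         (auto intro: has_vector_derivative_at_within der)
    also have "\<dots> = 0" using per[of z] by simp
    finally show "(LINT y|unit_measure. f' (fill J x (s(j := y)))) = 0" by (simp add: z)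
  qed
  finally show ?thesis by simp
qed

text \<open>A quadratic Taylor remainder that is uniform in the parameter can be integrated. It serves for the
averaged matrix and for the actions averaged over random times.\<close>

lemma has_derivative_expectation:
  fixes f :: "'a::euclidean_space \<Rightarrow> 's \<Rightarrow> 'b::{banach, second_countable_topology}"
  assumes "prob_space M" and int: "\<And>y. integrable M (f y)" "\<And>h. integrable M (f' h)"
    and lin: "\<And>s. linear (\<lambda>h. f' h s)"
    and K: "\<And>y s. norm (f y s - f x s - f' (y - x) s) \<le> K * (norm (y - x))\<^sup>2"
  shows "((\<lambda>y. LINT s|M. f y s) has_derivative (\<lambda>h. LINT s|M. f' h s)) (at x)"
proof (rule has_derivativeI_sandwich[where e = 1 and H = "\<lambda>y. K * norm (y - x)"])
  interpret prob_space M by fact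
  have "linear (\<lambda>h. LINT s|M. f' h s)"
    by (rule linearI) (simp_all add: linear_add[OF lin] linear_scale[OF lin] int)
  thus "bounded_linear (\<lambda>h. LINT s|M. f' h s)" by (simp add: linear_conv_bounded_linear)
  fix y assume "y \<noteq> x"
  have "norm (LINT s|M. f y s - f x s - f' (y - x) s) \<le> (LINT s|M. K * (norm (y - x))\<^sup>2)"
    by (rule norm_integral_le_integral) (auto intro!: int K)
  hence "norm ((LINT s|M. f y s) - (LINT s|M. f x s) - (LINT s|M. f' (y - x) s)) \<le> K * (norm (y - x))\<^sup>2"
    by (simp add: int prob_space)
  thus "norm ((LINT s|M. f y s) - (LINT s|M. f x s) - (LINT s|M. f' (y - x) s)) / norm (y - x) \<le> K * norm (y - x)"
    using \<open>y \<noteq> x\<close> by (simp add: divide_le_eq power2_eq_square mult_ac)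
next
  have "((\<lambda>y. K * norm (y - x)) \<longlongrightarrow> K * norm (x - x)) (at x)" by (intro tendsto_intros)
  thus "((\<lambda>y. K * norm (y - x)) \<longlongrightarrow> 0) (at x)" by simp
qed simp

section \<open>The cutoff provided by the small divisors\<close>

lemma last_indices_nonempty:
  assumes "d \<le> CARD('n) - 1"
  obtains j where "j \<in> (last_indices d :: 'n::{finite,linorder} set)"
proof -
  define m where "m = Max (UNIV :: 'n set)"
  have "{j. j < m} = UNIV - {m}"
    using Max_ge[of "UNIV :: 'n set"] by (auto simp: m_def less_le)
  hence "card {j. j < m} = CARD('n) - 1" by (simp add: card_Diff_singleton)
  hence "m \<in> last_indices d" using assms by (simp add: first_indices_def)
  thus ?thesis by (rule that)
qed

definition Psi_range :: "nat \<Rightarrow> real \<Rightarrow> (int ^ 'n::{finite,linorder}) set" where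
  "Psi_range d Q = {k \<in> last_int_vectors d.
     0 < (\<Sum>j\<in>UNIV. \<bar>k $ j\<bar>) \<and> of_int (\<Sum>j\<in>UNIV. \<bar>k $ j\<bar>) \<le> Q}"

lemma finite_Psi_range: "finite (Psi_range d Q :: (int ^ 'n::{finite,linorder}) set)"
proof -
  let ?B = "PiE UNIV (\<lambda>_. {-\<lfloor>Q\<rfloor>..\<lfloor>Q\<rfloor>}) :: ('n \<Rightarrow> int) set"
  have "vec_nth ` Psi_range d Q \<subseteq> ?B"
  proof (intro image_subsetI PiE_I)
    fix k :: "(int, 'n) vec" and j assume "k \<in> Psi_range d Q"
    hence "(\<Sum>j\<in>UNIV. \<bar>k $ j\<bar>) \<le> \<lfloor>Q\<rfloor>" by (simp add: Psi_range_def le_floor_iff)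
    moreover have "\<bar>k $ j\<bar> \<le> (\<Sum>j\<in>UNIV. \<bar>k $ j\<bar>)" by (rule member_le_sum) auto
    ultimately show "k $ j \<in> {-\<lfloor>Q\<rfloor>..\<lfloor>Q\<rfloor>}" by auto
  qed auto
  moreover have "finite ?B" by (intro finite_PiE) auto
  ultimately show ?thesis
    by (metis finite_imageD finite_subset inj_onI vec_nth_inject)
qed

lemma Psi_ge:
  assumes "k \<in> Psi_range d Q"
  shows "1 / \<bar>freq_dot k \<omega>\<bar> \<le> Psi d \<omega> Q"
  unfolding Psi_def Psi_range_def[symmetric] using assms finite_Psi_range by (intro Max_ge) auto

lemma Psi_times_divisor:
  assumes "nonresonant d \<omega>" "k \<in> last_int_vectors d" "k \<noteq> 0" "of_int (\<Sum>j\<in>UNIV. \<bar>k $ j\<bar>) \<le> Q"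
  shows "\<bar>Psi d \<omega> Q * freq_dot k \<omega>\<bar> \<ge> 1"
proof -
  obtain j where "k $ j \<noteq> 0" using assms(3) by (auto simp: vec_eq_iff)
  moreover have "\<bar>k $ j\<bar> \<le> (\<Sum>j\<in>UNIV. \<bar>k $ j\<bar>)" by (rule member_le_sum) auto
  ultimately have "k \<in> Psi_range d Q" using assms by (auto simp: Psi_range_def)
  from Psi_ge[OF this, of \<omega>] have "1 / \<bar>freq_dot k \<omega>\<bar> \<le> \<bar>Psi d \<omega> Q\<bar>" by linarith
  moreover have "freq_dot k \<omega> \<noteq> 0" using assms by (auto simp: nonresonant_def)
  ultimately show ?thesis by (simp add: abs_mult field_simps)
qed

text \<open>A unit vector is admissible from \<open>Q = 1\<close> on, and its divisor is a component of \<open>\<omega>\<close>.\<close>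

lemma Psi_ge_1:
  fixes \<omega> :: "real ^ 'n::{finite,linorder}"
  assumes "nonresonant d \<omega>" "infnorm \<omega> = 1" "d \<le> CARD('n) - 1" "Q \<ge> 1"
  shows "Psi d \<omega> Q \<ge> 1"
proof -
  obtain j :: 'n where j: "j \<in> last_indices d" using last_indices_nonempty assms(3) by blast
  let ?k = "axis j 1 :: (int, 'n) vec"
  have s: "(\<Sum>i\<in>UNIV. \<bar>?k $ i\<bar>) = 1"
    by (simp add: axis_def if_distrib[of abs] cong: if_cong)
  have w: "freq_dot ?k \<omega> = \<omega> $ j"
    by (simp add: freq_dot_def axis_def if_distrib[of of_int] if_distrib[of "\<lambda>z. z * _"] cong: if_cong)
  have kl: "?k \<in> last_int_vectors d" using j by (auto simp: last_int_vectors_def axis_def)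
  moreover have "?k \<noteq> 0" by (simp add: axis_eq_0_iff)
  ultimately have "\<omega> $ j \<noteq> 0" using assms(1) w unfolding nonresonant_def by metis
  moreover have "\<bar>\<omega> $ j\<bar> \<le> 1" using component_le_infnorm_cart[of \<omega> j] assms(2) by simp
  ultimately have "1 \<le> 1 / \<bar>freq_dot ?k \<omega>\<bar>" by (simp add: w)
  moreover have "?k \<in> Psi_range d Q"
    unfolding Psi_range_def mem_Collect_eq s using kl assms(4) by simp
  ultimately show ?thesis using Psi_ge order_trans by blast
qed

text \<open>The supremum in \<open>\<Delta>\<close> need not be attained, but some \<open>Q\<close> in the set exceeds half of it, which costs
the factor 2. The condition \<open>Q \<Psi>(Q) \<le> 1/\<epsilon>\<close> together with \<open>\<Psi>(Q) \<ge> 1\<close> gives the other bounds.\<close>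

lemma cutoff_exists:
  fixes \<omega> :: "real ^ 'n::{finite,linorder}"
  assumes \<omega>: "nonresonant d \<omega>" "infnorm \<omega> = 1" and d: "d \<le> CARD('n) - 1"
    and \<epsilon>: "\<epsilon> > 0" "Psi d \<omega> 1 \<le> 1 / \<epsilon>"
  obtains Q where "Q \<ge> 1" "\<epsilon> \<le> 1 / Q" "\<epsilon> * Psi d \<omega> Q \<le> 1 / Q" "1 / Q \<le> 2 * mu 1 d \<omega> \<epsilon>" "Psi d \<omega> Q \<ge> 1"
proof -
  define S where "S = {Q. 1 \<le> Q \<and> Q * Psi d \<omega> Q \<le> 1 / \<epsilon>}"
  have P1: "Psi d \<omega> Q \<ge> 1" if "Q \<ge> 1" for Q using Psi_ge_1[OF \<omega> d that] .
  have "1 \<in> S" using \<epsilon> by (simp add: S_def)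
  have "Q \<le> 1 / \<epsilon>" if "Q \<in> S" for Q
  proof -
    have "Q * 1 \<le> Q * Psi d \<omega> Q" using that P1[of Q] by (intro mult_left_mono) (auto simp: S_def)
    also have "\<dots> \<le> 1 / \<epsilon>" using that by (simp add: S_def)
    finally show ?thesis by simp
  qed
  hence bdd: "bdd_above S" by (auto simp: bdd_above_def)
  have "Sup S \<ge> 1" using cSup_upper[OF \<open>1 \<in> S\<close> bdd] .
  moreover from this have "Sup S / 2 < Sup S" by simp
  ultimately obtain Q where Q: "Q \<in> S" "Sup S / 2 < Q"
    using less_cSup_iff[of S "Sup S / 2"] bdd \<open>1 \<in> S\<close> by auto
  have "Q \<ge> 1" "Q * Psi d \<omega> Q \<le> 1 / \<epsilon>" using Q by (auto simp: S_def)
  hence a: "\<epsilon> * Psi d \<omega> Q \<le> 1 / Q" using \<epsilon> by (simp add: field_simps)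
  show thesis
  proof (rule that[of Q])
    have "\<epsilon> * 1 \<le> \<epsilon> * Psi d \<omega> Q" using \<epsilon> P1[OF \<open>Q \<ge> 1\<close>] by (intro mult_left_mono) auto
    thus "\<epsilon> \<le> 1 / Q" using a by simp
    have "mu 1 d \<omega> \<epsilon> = 1 / Sup S" by (simp add: mu_def Delta_def S_def)
    moreover have "1 / Q \<le> 2 * (1 / Sup S)" using Q(2) \<open>Q \<ge> 1\<close> \<open>Sup S \<ge> 1\<close> by (simp add: field_simps)
    ultimately show "1 / Q \<le> 2 * mu 1 d \<omega> \<epsilon>" by simp
  qed (use a P1 \<open>Q \<ge> 1\<close> in auto)
qed

section \<open>Averaging along a trajectory\<close>

lemma lipschitz_derivative_remainder:
  fixes u :: "real \<Rightarrow> real"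
  assumes der: "\<And>t. (u has_real_derivative u' t) (at t)"
    and lip: "\<And>s t. \<bar>u' t - u' s\<bar> \<le> K * \<bar>t - s\<bar>"
  shows "\<bar>u y - u x - (y - x) * u' x\<bar> \<le> K * \<bar>y - x\<bar>\<^sup>2"
proof -
  have "K * \<bar>1 - 0\<bar> \<ge> 0" using lip[of 1 0] abs_ge_zero order_trans by blast
  hence K: "K \<ge> 0" by simp
  have "norm ((u y - y * u' x) - (u x - x * u' x)) \<le> (K * \<bar>y - x\<bar>) * norm (y - x)"
  proof (rule field_differentiable_bound)
    show "convex (closed_segment x y)" by simp
    show "((\<lambda>z. u z - z * u' x) has_field_derivative u' z - u' x) (at z within closed_segment x y)" for z
      using has_field_derivative_at_within[OF der] by (auto intro!: derivative_eq_intros)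
    fix z assume "z \<in> closed_segment x y"
    hence "\<bar>z - x\<bar> \<le> \<bar>y - x\<bar>" by (auto simp: closed_segment_eq_real_ivl split: if_splits)
    thus "norm (u' z - u' x) \<le> K * \<bar>y - x\<bar>" using lip[of z x] mult_left_mono[OF _ K] by fastforce
  qed auto
  thus ?thesis by (simp add: algebra_simps power2_eq_square)
qed

text \<open>The function \<open>u\<close> is compared with \<open>U(t) = E u(t + T s)\<close>. They differ by at most \<open>B \<epsilon> T m\<close>, once at
each end of the interval. In \<open>U'(t) = E u'(t + T s)\<close> the trajectory at the time \<open>t + T s\<close> is replaced
by the straight line \<open>\<theta>(t) + T s \<omega>\<close> with frozen \<open>I(t)\<close>, at the cost \<open>2 L B \<epsilon>\<^sup>2 T m\<close>, and the mean of
\<open>g\<close> along this line is close to its torus mean. A lower bound is enough: applied to \<open>u\<close> and \<open>- u\<close> it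
is two-sided.\<close>

lemma averaging_lower_bound:
  fixes \<theta> I :: "real \<Rightarrow> (real, 'n::{finite,linorder}) vec" and g :: "(real, 'n) vec \<Rightarrow> (real, 'n) vec \<Rightarrow> real"
  assumes M: "prob_space M" "sets M = sets borel" "integrable M (\<lambda>s. \<bar>s\<bar>)"
      "\<And>\<xi>. \<bar>\<xi>\<bar> \<ge> 4 \<Longrightarrow> char M \<xi> = 0"
    and \<omega>: "\<And>j. j \<notin> J \<Longrightarrow> \<omega> $ j = 0"
    and small: "\<And>k. (\<And>j. j \<notin> J \<Longrightarrow> k $ j = 0) \<Longrightarrow> (\<And>j. \<bar>k $ j\<bar> < int N) \<Longrightarrow> k \<noteq> 0 \<Longrightarrow>
        \<bar>T * freq_dot k \<omega>\<bar> \<ge> 1"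
    and N: "N > 0" and T: "T \<ge> 0" and \<epsilon>: "\<epsilon> \<ge> 0"
    and g: "\<And>y. periodic_C11 D (\<lambda>x. of_real (g x y))" "\<And>x y. \<bar>g x y\<bar> \<le> K"
      "\<And>x y x' y'. \<bar>g x y - g x' y'\<bar> \<le> L * (norm (x - x') + norm (y - y'))" "L \<ge> 0"
    and \<theta>: "\<And>t s. norm (\<theta> (t + s) - \<theta> t - s *\<^sub>R \<omega>) \<le> B * \<epsilon> * \<bar>s\<bar>"
    and I: "\<And>t s. norm (I (t + s) - I t) \<le> B * \<epsilon> * \<bar>s\<bar>"
    and u: "\<And>t. (u has_real_derivative u' t) (at t)" "\<And>t. \<bar>u' t\<bar> \<le> B * \<epsilon>"
      "\<And>s t. \<bar>u' t - u' s\<bar> \<le> K' * \<bar>t - s\<bar>"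
      "\<And>t. \<bar>u' t - \<epsilon> * g (\<theta> t) (I t)\<bar> \<le> r * \<epsilon>\<^sup>2"
    and mean: "\<And>t. 0 \<le> t \<Longrightarrow> t \<le> \<tau> \<Longrightarrow> a \<le> torus_mean J (\<lambda>x. g x (I t)) (\<theta> t)" and \<tau>: "\<tau> > 0"
  defines "m \<equiv> (LINT s|M. \<bar>s\<bar>)"
  shows "u \<tau> - u 0 \<ge> \<tau> * (\<epsilon> * (a - card J * (D / (4 * real N))) - r * \<epsilon>\<^sup>2 - 2 * L * B * \<epsilon>\<^sup>2 * T * m)
    - 2 * B * \<epsilon> * T * m"
proof -
  interpret prob_space M by fact
  have meas: "f \<in> borel_measurable M" if "continuous_on UNIV f" for f :: "real \<Rightarrow> real"
    using borel_measurable_continuous_onI[OF that] by (simp add: measurable_cong_sets[OF M(2) refl])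
  have contu: "continuous_on UNIV u" by (meson u(1) DERIV_isCont continuous_at_imp_continuous_on)
  have "continuous_on UNIV u'"
    by (rule lipschitz_on_continuous_on[of "\<bar>K'\<bar>"], rule lipschitz_onI)
      (use u(3) in \<open>auto simp: dist_real_def intro: order_trans[OF _ mult_right_mono[OF abs_ge_self]]\<close>)
  note contu' = this
  have du: "\<bar>u (t + s) - u t\<bar> \<le> B * \<epsilon> * \<bar>s\<bar>" for t s
    using field_differentiable_bound[of UNIV u u' "B * \<epsilon>" "t + s" t] u by simp
  have intu: "integrable M (\<lambda>s. u (t + T * s))" for t
  proof (rule Bochner_Integration.integrable_bound)
    show "integrable M (\<lambda>s. \<bar>u t\<bar> + B * \<epsilon> * T * \<bar>s\<bar>)" using M(3) by auto
    show "(\<lambda>s. u (t + T * s)) \<in> borel_measurable M"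
      by (intro meas continuous_on_compose2[OF contu] continuous_intros) auto
    show "AE s in M. norm (u (t + T * s)) \<le> norm (\<bar>u t\<bar> + B * \<epsilon> * T * \<bar>s\<bar>)"
    proof (rule AE_I2)
      fix s
      have "\<bar>u (t + T * s) - u t\<bar> \<le> B * \<epsilon> * T * \<bar>s\<bar>" using du[of t "T * s"] T by (simp add: abs_mult mult_ac)
      thus "norm (u (t + T * s)) \<le> norm (\<bar>u t\<bar> + B * \<epsilon> * T * \<bar>s\<bar>)" unfolding real_norm_def by linarith
    qed
  qed
  have intu': "integrable M (\<lambda>s. u' (t + T * s))" for t
    by (rule integrable_const_bound[of _ "B * \<epsilon>"])
      (use u(2) in \<open>auto intro!: meas continuous_on_compose2[OF contu'] continuous_intros\<close>)
  define U where "U t = (LINT s|M. u (t + T * s))" for t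
  define V where "V t = (LINT s|M. u' (t + T * s))" for t
  \<comment> \<open>\<open>u'\<close> is Lipschitz, so the Taylor remainder of \<open>u\<close> is uniformly quadratic\<close>
  have UV: "(U has_real_derivative V t) (at t)" for t
  proof -
    have "((\<lambda>y. LINT s|M. u (y + T * s)) has_derivative (\<lambda>h. LINT s|M. h * u' (t + T * s))) (at t)"
    proof (rule has_derivative_expectation[OF M(1) intu, where K = K'])
      show "norm (u (y + T * s) - u (t + T * s) - (y - t) * u' (t + T * s)) \<le> K' * (norm (y - t))\<^sup>2" for y s
        using lipschitz_derivative_remainder[OF u(1,3), of "y + T * s" "t + T * s"] by simp
      show "integrable M (\<lambda>s. h * u' (t + T * s))" for h by (intro integrable_mult_right intu')
    qed (auto simp: linear_iff algebra_simps)
    moreover have "(\<lambda>h. LINT s|M. h * u' (t + T * s)) = (\<lambda>h. V t * h)"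
      by (simp add: V_def mult.commute)
    ultimately show ?thesis by (simp add: has_field_derivative_def U_def[abs_def])
  qed
  have Uu: "\<bar>U t - u t\<bar> \<le> B * \<epsilon> * T * m" for t
  proof -
    have "norm (LINT s|M. u (t + T * s) - u t) \<le> (LINT s|M. B * \<epsilon> * T * \<bar>s\<bar>)"
    proof (rule norm_integral_le_integral)
      show "norm (u (t + T * s) - u t) \<le> B * \<epsilon> * T * \<bar>s\<bar>" for s
        using du[of t "T * s"] T by (simp add: abs_mult mult_ac)
    qed (use M(3) intu in auto)
    thus ?thesis using intu by (simp add: U_def m_def prob_space)
  qed
  have V: "V t \<ge> \<epsilon> * (a - card J * (D / (4 * real N))) - r * \<epsilon>\<^sup>2 - 2 * L * B * \<epsilon>\<^sup>2 * T * m"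
    if t: "0 \<le> t" "t \<le> \<tau>" for t
  proof -
    let ?g = "\<lambda>s. g (\<theta> t + (T * s) *\<^sub>R \<omega>) (I t)"
    have contg: "continuous_on UNIV (\<lambda>x. g x (I t))"
      using g(1)[of "I t"] unfolding periodic_C11_def by (metis Re_complex_of_real continuous_on_Re continuous_on_cong)
    have intg: "integrable M ?g"
      by (rule integrable_along_line[OF M(1,2) contg, where K = K]) (use g(2) in \<open>auto intro!: continuous_intros\<close>)
    have "\<bar>(LINT s|M. ?g s) - torus_mean J (\<lambda>x. g x (I t)) (\<theta> t)\<bar> \<le> card J * (D / (4 * real N))"
      by (rule line_mean_close_to_torus_mean[OF M(1,2,4) \<omega> small g(1) g(2) N])
    hence "(LINT s|M. ?g s) \<ge> a - card J * (D / (4 * real N))" using mean[OF t] by linarith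
    hence "\<epsilon> * (a - card J * (D / (4 * real N))) \<le> \<epsilon> * (LINT s|M. ?g s)" using \<epsilon> by (rule mult_left_mono)
    moreover have "(LINT s|M. \<epsilon> * ?g s - r * \<epsilon>\<^sup>2 - 2 * L * B * \<epsilon>\<^sup>2 * T * \<bar>s\<bar>) \<le> V t"
      unfolding V_def
    proof (rule integral_mono)
      show "integrable M (\<lambda>s. \<epsilon> * ?g s - r * \<epsilon>\<^sup>2 - 2 * L * B * \<epsilon>\<^sup>2 * T * \<bar>s\<bar>)"
        using M(3) intg by auto
      fix s
      have "\<bar>?g s - g (\<theta> (t + T * s)) (I (t + T * s))\<bar> \<le>
          L * (norm (\<theta> t + (T * s) *\<^sub>R \<omega> - \<theta> (t + T * s)) + norm (I t - I (t + T * s)))" by (rule g)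
      also have "\<dots> \<le> L * (B * \<epsilon> * \<bar>T * s\<bar> + B * \<epsilon> * \<bar>T * s\<bar>)"
        using \<theta>[of t "T * s"] I[of t "T * s"] g(4)
        by (intro mult_left_mono add_mono) (auto simp: norm_minus_commute algebra_simps)
      also have "\<dots> = 2 * L * B * \<epsilon> * T * \<bar>s\<bar>" using T by (simp add: abs_mult)
      finally have "?g s - 2 * L * B * \<epsilon> * T * \<bar>s\<bar> \<le> g (\<theta> (t + T * s)) (I (t + T * s))" by linarith
      from mult_left_mono[OF this \<epsilon>]
      have "\<epsilon> * ?g s - 2 * L * B * \<epsilon>\<^sup>2 * T * \<bar>s\<bar> \<le> \<epsilon> * g (\<theta> (t + T * s)) (I (t + T * s))"
        by (simp add: algebra_simps power2_eq_square)
      thus "\<epsilon> * ?g s - r * \<epsilon>\<^sup>2 - 2 * L * B * \<epsilon>\<^sup>2 * T * \<bar>s\<bar> \<le> u' (t + T * s)"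
        using u(4)[of "t + T * s"] by linarith
    qed (rule intu')
    moreover have "(LINT s|M. \<epsilon> * ?g s - r * \<epsilon>\<^sup>2 - 2 * L * B * \<epsilon>\<^sup>2 * T * \<bar>s\<bar>) =
        \<epsilon> * (LINT s|M. ?g s) - r * \<epsilon>\<^sup>2 - 2 * L * B * \<epsilon>\<^sup>2 * T * m"
      using M(3) intg by (simp add: m_def prob_space)
    ultimately show ?thesis by linarith
  qed
  obtain z where z: "0 < z" "z < \<tau>" "U \<tau> - U 0 = (\<tau> - 0) * V z"
    using MVT2[OF \<tau>, of U V] UV by auto
  have "U \<tau> - U 0 \<ge> \<tau> * (\<epsilon> * (a - card J * (D / (4 * real N))) - r * \<epsilon>\<^sup>2 - 2 * L * B * \<epsilon>\<^sup>2 * T * m)"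
    using z V[of z] \<tau> by (simp add: mult_left_mono)
  thus ?thesis using Uu[of 0] Uu[of \<tau>] by linarith
qed

section \<open>Taylor estimates, quadratic forms and truncation\<close>

lemma lipschitz_from_partials:
  fixes f :: "'a::euclidean_space \<Rightarrow> 'b::real_normed_vector" and C :: real
  assumes S: "convex S" "x \<in> S" "y \<in> S"
    and der: "\<And>z. z \<in> S \<Longrightarrow> (f has_derivative f' z) (at z)"
    and bd: "\<And>z b. z \<in> S \<Longrightarrow> b \<in> Basis \<Longrightarrow> norm (f' z b) \<le> C"
  shows "norm (f x - f y) \<le> DIM('a) * C * norm (x - y)"
proof (rule differentiable_bound[OF S(1) _ _ S(2,3)])
  fix z assume z: "z \<in> S"
  show "(f has_derivative f' z) (at z within S)" by (rule has_derivative_at_withinI[OF der[OF z]])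
  interpret bounded_linear "f' z" by (rule has_derivative_bounded_linear[OF der[OF z]])
  show "onorm (f' z) \<le> DIM('a) * C"
  proof (rule onorm_le)
    fix h
    have "norm (f' z h) = norm (\<Sum>b\<in>Basis. (h \<bullet> b) *\<^sub>R f' z b)"
      by (metis (no_types, lifting) euclidean_representation scaleR sum sum.cong)
    also have "\<dots> \<le> (\<Sum>b\<in>(Basis :: 'a set). norm h * C)"
      using z bd Basis_le_norm by (intro sum_norm_le) (auto intro!: mult_mono)
    finally show "norm (f' z h) \<le> DIM('a) * C * norm h" by (simp add: mult_ac)
  qed
qed

lemma taylor_from_partials:
  fixes f :: "'a::euclidean_space \<Rightarrow> 'b::real_normed_vector" and L :: real
  assumes der: "\<And>z. (f has_derivative f' z) (at z)"
    and lip: "\<And>z w b. b \<in> Basis \<Longrightarrow> norm (f' z b - f' w b) \<le> L * norm (z - w)"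
  shows "norm (f y - f x - f' x (y - x)) \<le> DIM('a) * L * (norm (y - x))\<^sup>2"
proof -
  interpret bounded_linear "f' x" by (rule has_derivative_bounded_linear[OF der])
  obtain b :: 'a where b: "b \<in> Basis" using nonempty_Basis by blast
  have "L * norm (b - 0) \<ge> 0" using lip[OF b, of b 0] norm_ge_zero order_trans by blast
  hence L: "L \<ge> 0" using b by simp
  have "norm ((f y - f' x y) - (f x - f' x x)) \<le> DIM('a) * (L * norm (y - x)) * norm (y - x)"
  proof (rule lipschitz_from_partials[where S = "closed_segment x y"
        and f = "\<lambda>z. f z - f' x z" and f' = "\<lambda>z h. f' z h - f' x h"])
    show "((\<lambda>z. f z - f' x z) has_derivative (\<lambda>h. f' z h - f' x h)) (at z)" for z
      by (intro derivative_intros der has_derivative_bounded_linear[OF der] bounded_linear_imp_has_derivative)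
    fix z b :: 'a assume z: "z \<in> closed_segment x y" and b: "b \<in> Basis"
    have "norm (z - x) \<le> norm (y - x)"
      using segment_bound(1)[OF z] by (simp add: norm_minus_commute)
    thus "norm (f' z b - f' x b) \<le> L * norm (y - x)"
      using lip[OF b, of z x] mult_left_mono[OF _ L] by (metis order_trans)
  qed auto
  thus ?thesis by (simp add: diff power2_eq_square algebra_simps)
qed

text \<open>The function \<open>t \<mapsto> f(x + t e) + f(x - t e)\<close> has the derivative \<open>f'(x + t e) - f'(x - t e)\<close>, of norm at
most \<open>2 L |t|\<close>.\<close>

lemma second_difference_bound:
  fixes f :: "real ^ 'n \<Rightarrow> 'b::real_normed_vector"
  assumes der: "\<And>x y. ((\<lambda>y. f (shift x k y)) has_vector_derivative f' (shift x k y)) (at y)"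
    and lip: "\<And>x y. norm (f' x - f' y) \<le> L * norm (x - y)"
  shows "norm (f (shift x k y) + f (shift x k (- y)) - 2 *\<^sub>R f x) \<le> 2 * L * y\<^sup>2"
proof -
  define h where "h t = f (shift x k t) + f (shift x k (- t))" for t
  have "L * norm (axis k 1 - 0 :: real ^ 'n) \<ge> 0" using lip[of "axis k 1" 0] norm_ge_zero order_trans by blast
  hence L: "L \<ge> 0" by simp
  have der': "((\<lambda>t. f (shift x k (- t))) has_vector_derivative - f' (shift x k (- t))) (at t)" for t
  proof -
    have "(uminus has_vector_derivative - 1) (at t)" for t :: real
      by (auto intro!: derivative_eq_intros)
    from vector_diff_chain_at[OF this der[of x "- t"]] show ?thesis by (simp add: o_def)
  qed
  have dh: "(h has_vector_derivative (f' (shift x k t) - f' (shift x k (- t)))) (at t)" for t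
    unfolding h_def[abs_def] using has_vector_derivative_add[OF der der'] by simp
  have "norm (h y - h 0) \<le> (2 * L * \<bar>y\<bar>) * norm (y - 0)"
  proof (rule differentiable_bound[where S = "closed_segment 0 y"])
    fix t assume t: "t \<in> closed_segment 0 y"
    show "(h has_derivative (\<lambda>s. s *\<^sub>R (f' (shift x k t) - f' (shift x k (- t))))) (at t within closed_segment 0 y)"
      using dh[of t] unfolding has_vector_derivative_def by (rule has_derivative_at_withinI)
    have "norm (f' (shift x k t) - f' (shift x k (- t))) \<le> L * norm ((2 * t) *\<^sub>R (axis k 1 :: real ^ 'n))"
      using lip[of "shift x k t" "shift x k (- t)"] by (simp flip: scaleR_add_left)
    also have "\<dots> \<le> 2 * L * \<bar>y\<bar>"
      using segment_bound(1)[OF t] L by (auto simp: abs_mult intro!: mult_left_mono)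
    finally show "onorm (\<lambda>s. s *\<^sub>R (f' (shift x k t) - f' (shift x k (- t)))) \<le> 2 * L * \<bar>y\<bar>"
      by (intro onorm_le) (simp add: mult.commute mult_left_mono)
  qed auto
  thus ?thesis by (simp add: h_def power2_eq_square scaleR_2 mult.assoc)
qed

lemma norm_matrix_vector_le: "norm (M *v x) \<le> norm M * norm x" for M :: "real ^ 'n ^ 'm"
proof -
  have "norm (M *v x) = L2_set (\<lambda>i. norm (M $ i \<bullet> x)) UNIV"
    by (simp add: norm_vec_def matrix_vector_mul_component)
  also have "\<dots> \<le> L2_set (\<lambda>i. norm (M $ i) * norm x) UNIV"
    by (intro L2_set_mono) (auto simp: Cauchy_Schwarz_ineq2)
  also have "\<dots> = norm M * norm x"
    unfolding norm_vec_def[of M] by (rule L2_set_left_distrib[symmetric]) simp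
  finally show ?thesis .
qed

lemma bounded_bilinear_matrix_vector: "bounded_bilinear ((*v) :: real ^ 'n ^ 'm \<Rightarrow> _)"
  by (rule bounded_bilinear.intro)
    (auto simp: matrix_vector_mult_add_rdistrib matrix_vector_right_distrib scaleR_matrix_vector_assoc
      matrix_vector_mult_scaleR vector_scaleR_matrix_ac intro!: exI[of _ 1] norm_matrix_vector_le)

lemma matrix_form_le:
  fixes M :: "real ^ 'n ^ 'n"
  assumes "norm v \<le> R" "norm w \<le> R"
  shows "\<bar>(M *v v) \<bullet> w\<bar> \<le> norm M * R\<^sup>2"
proof -
  have "\<bar>(M *v v) \<bullet> w\<bar> \<le> norm (M *v v) * norm w" by (rule Cauchy_Schwarz_ineq2)
  also have "\<dots> \<le> (norm M * norm v) * norm w" by (intro mult_right_mono norm_matrix_vector_le) auto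
  also have "\<dots> \<le> (norm M * R) * R" using assms norm_ge_zero[of v] order_trans[OF norm_ge_zero assms(1)] by (intro mult_mono) auto
  finally show ?thesis by (simp add: power2_eq_square mult_ac)
qed

lemma matrix_form_lipschitz:
  fixes M M' :: "real ^ 'n ^ 'n"
  assumes "norm v \<le> R" "norm w \<le> R" "norm v' \<le> R" "norm w' \<le> R" "norm M' \<le> K"
  shows "\<bar>(M *v v) \<bullet> w - (M' *v v') \<bullet> w'\<bar> \<le> R\<^sup>2 * norm (M - M') + K * R * (norm (v - v') + norm (w - w'))"
proof -
  have R: "R \<ge> 0" using assms(1) norm_ge_zero order_trans by blast
  have "(M *v v) \<bullet> w - (M' *v v') \<bullet> w' = ((M - M') *v v) \<bullet> w + (M' *v (v - v')) \<bullet> w + (M' *v v') \<bullet> (w - w')"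
    by (simp add: matrix_vector_mult_diff_rdistrib matrix_vector_mult_diff_distrib inner_diff_left inner_diff_right)
  moreover have "\<bar>((M - M') *v v) \<bullet> w\<bar> \<le> norm (M - M') * R\<^sup>2" by (intro matrix_form_le assms)
  moreover have "\<bar>(M' *v (v - v')) \<bullet> w\<bar> \<le> K * R * norm (v - v')"
  proof -
    have "\<bar>(M' *v (v - v')) \<bullet> w\<bar> \<le> norm (M' *v (v - v')) * norm w" by (rule Cauchy_Schwarz_ineq2)
    also have "\<dots> \<le> (K * norm (v - v')) * R"
      using assms R by (intro mult_mono order_trans[OF norm_matrix_vector_le] mult_right_mono) (auto simp: order_trans[OF norm_ge_zero])
    finally show ?thesis by (simp add: mult_ac)
  qed
  moreover have "\<bar>(M' *v v') \<bullet> (w - w')\<bar> \<le> K * R * norm (w - w')"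
  proof -
    have "\<bar>(M' *v v') \<bullet> (w - w')\<bar> \<le> norm (M' *v v') * norm (w - w')" by (rule Cauchy_Schwarz_ineq2)
    also have "\<dots> \<le> (K * R) * norm (w - w')"
      using assms R by (intro mult_mono order_trans[OF norm_matrix_vector_le]) (auto simp: order_trans[OF norm_ge_zero])
    finally show ?thesis .
  qed
  ultimately show ?thesis by (simp add: distrib_left mult.commute)
qed

lemma norm_le_card_times_bound:
  fixes x :: "real ^ 'n" and c :: real
  assumes "\<And>i. \<bar>x $ i\<bar> \<le> c"
  shows "norm x \<le> CARD('n) * c"
  using norm_le_l1_cart[of x] sum_bounded_above[of UNIV "\<lambda>i. \<bar>x $ i\<bar>" c] assms by auto

text \<open>Truncation of the actions. It is 1-Lipschitz, it is the identity on the box of radius 2, and its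
values lie well inside the domain \<open>|I| < 3\<close> on which the remainder is bounded.\<close>

definition cut :: "real ^ 'n \<Rightarrow> real ^ 'n" where
  "cut x = (\<chi> i. max (-2) (min 2 (x $ i)))"

lemma norm_cut: "norm (cut x :: real ^ 'n) \<le> 2 * CARD('n)"
  using norm_le_card_times_bound[of "cut x" 2] by (auto simp: cut_def mult.commute)

lemma norm_cut_diff: "norm (cut x - cut y) \<le> norm (x - y)"
  by (rule norm_le_componentwise_cart) (auto simp: cut_def)

lemma infnorm_cut: "infnorm (cut x) \<le> 2"
  unfolding infnorm_cart by (rule cSup_least) (auto simp: cut_def)

lemma cut_eq: "infnorm x \<le> 2 \<Longrightarrow> cut x = x"
  using component_le_infnorm_cart[of x] by (auto simp: cut_def vec_eq_iff max_def min_def abs_le_iff) (smt (verit))+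

lemma convex_infnorm_less: "convex {x. infnorm x < r}"
proof (rule convexI)
  fix x y :: 'a and u v :: real
  assume xy: "x \<in> {x. infnorm x < r}" "y \<in> {x. infnorm x < r}" and u: "0 \<le> u" "0 \<le> v" "u + v = 1"
  have "infnorm (u *\<^sub>R x + v *\<^sub>R y) \<le> u * infnorm x + v * infnorm y"
    using infnorm_triangle[of "u *\<^sub>R x" "v *\<^sub>R y"] u by (simp add: infnorm_mul)
  also have "\<dots> < r" using convex_bound_lt[of "infnorm x" r "infnorm y" u v] xy u by simp
  finally show "u *\<^sub>R x + v *\<^sub>R y \<in> {x. infnorm x < r}" by simp
qed

abbreviation (input) partial :: "'a::euclidean_space \<Rightarrow> ('a \<Rightarrow> 'b::euclidean_space) \<Rightarrow> 'a \<Rightarrow> 'b" where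
  "partial b f \<equiv> \<lambda>x. frechet_derivative f (at x) b"

lemma Ck_has_derivative:
  assumes "Ck l f" "l \<ge> 1"
  shows "(f has_derivative frechet_derivative f (at x)) (at x)"
  using assms by (cases l) (auto simp: frechet_derivative_works)

lemma Ck_partial:
  assumes "Ck l f" "l \<ge> 1" "b \<in> Basis"
  shows "Ck (l - 1) (partial b f)"
  using assms by (cases l) auto

lemma Ck_norm_le_imp:
  assumes "Ck_norm l S f \<le> ereal C" "set bs \<subseteq> Basis" "length bs \<le> l" "x \<in> S"
  shows "infnorm (iterated_deriv bs f x) \<le> C"
proof -
  have "ereal (infnorm (iterated_deriv bs f x)) \<le> Ck_norm l S f"
    unfolding Ck_norm_def using assms(2-4) by (intro SUP_upper2[of bs] SUP_upper2[of x]) auto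
  thus ?thesis using assms(1) by (metis ereal_less_eq(3) order_trans)
qed

section \<open>The quadratic part of the Hamiltonian\<close>

lemma iterated_deriv_snoc:
  "iterated_deriv (bs @ [b]) f = (\<lambda>x. frechet_derivative (iterated_deriv bs f) (at x) b)"
  by (induction bs arbitrary: f) auto

lemma iterated_deriv_has_derivative:
  assumes "Ck l f" "set bs \<subseteq> Basis" "length bs < l"
  shows "(iterated_deriv bs f has_derivative frechet_derivative (iterated_deriv bs f) (at x)) (at x)"
  using assms
proof (induction bs arbitrary: f l)
  case Nil
  thus ?case using Ck_has_derivative[of l f] by simp
next
  case (Cons b bs)
  thus ?case using Cons.IH[of "l - 1" "partial b f"] Ck_partial[of l f b] by simp
qed

lemma norm_iterated_deriv_le:
  fixes f :: "'a::euclidean_space \<Rightarrow> 'b::euclidean_space"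
  assumes "Ck_norm l S f \<le> ereal C" "set bs \<subseteq> Basis" "length bs \<le> l" "x \<in> S"
  shows "norm (iterated_deriv bs f x) \<le> sqrt DIM('b) * C"
  using norm_le_infnorm[of "iterated_deriv bs f x"] Ck_norm_le_imp[OF assms]
  by (meson mult_left_mono order_trans real_sqrt_ge_zero of_nat_0_le_iff)

lemma lipschitz_iterated_deriv:
  fixes f :: "'a::euclidean_space \<Rightarrow> 'b::euclidean_space"
  assumes C: "Ck_norm l S f \<le> ereal C" and bs: "set bs \<subseteq> Basis" "length bs < l"
    and S: "convex S" "x \<in> S" "y \<in> S"
    and diff: "\<And>z. z \<in> S \<Longrightarrow> iterated_deriv bs f differentiable (at z)"
  shows "norm (iterated_deriv bs f x - iterated_deriv bs f y) \<le> DIM('a) * (sqrt DIM('b) * C) * norm (x - y)"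
proof (rule lipschitz_from_partials[OF S, where f' = "\<lambda>z. frechet_derivative (iterated_deriv bs f) (at z)"])
  fix z and b :: 'a assume "z \<in> S" "b \<in> Basis"
  thus "norm (frechet_derivative (iterated_deriv bs f) (at z) b) \<le> sqrt DIM('b) * C"
    using norm_iterated_deriv_le[OF C, of "bs @ [b]" z] bs by (simp add: iterated_deriv_snoc)
qed (use diff frechet_derivative_works in blast)

lemma has_vector_derivative_shift:
  fixes f :: "real ^ 'n \<Rightarrow> 'b::real_normed_vector"
  assumes "(f has_derivative f') (at (shift x k y))"
  shows "((\<lambda>y. f (shift x k y)) has_vector_derivative f' (axis k 1)) (at y)"
proof -
  interpret bounded_linear f' by (rule has_derivative_bounded_linear[OF assms])
  have "((\<lambda>y. f (shift x k y)) has_derivative (\<lambda>h. f' (h *\<^sub>R axis k 1))) (at y)"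
    by (rule has_derivative_compose[where f = "shift x k" and g = f and f' = "\<lambda>h. h *\<^sub>R axis k 1" and g' = f'])
      (auto intro!: derivative_eq_intros assms)
  thus ?thesis by (simp add: has_vector_derivative_def scaleR)
qed

text \<open>The number \<open>L\<close> bounds \<open>A\<close> and its first partial derivatives and is a Lipschitz constant for both.
The number \<open>Lg\<close> does the same for the forms \<open>(\<partial>\<^sub>j A(\<theta>) I) \<cdot> I\<close> on truncated actions, whose Euclidean
norm is at most \<open>2 n\<close>. They are parameters fixed by equations because \<open>n\<close> depends on nothing but
the index type.\<close>

locale C3_matrix_field =
  fixes A :: "(real, 'n::{finite,linorder}) vec \<Rightarrow> ((real, 'n) vec, 'n) vec" and l :: nat and C n L Lg :: real
  assumes n_def: "n = real CARD('n)" and L_def: "L = n\<^sup>2 * C" and Lg_def: "Lg = 4 * n\<^sup>2 * L"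
    and l: "3 \<le> l" and periodic: "torus_periodic A" and smooth: "Ck l A"
    and bound: "Ck_norm l UNIV A \<le> ereal C" and C: "C > 0"
begin

definition DA :: "'n \<Rightarrow> (real, 'n) vec \<Rightarrow> ((real, 'n) vec, 'n) vec" where
  "DA j = partial (axis j 1) A"

text \<open>For \<open>\<sigma> = - 1\<close> this is the leading force on the \<open>j\<close>-th action. Both signs occur, since a two-sided
bound on an action comes from two lower bounds.\<close>

definition signed_form :: "real \<Rightarrow> 'n \<Rightarrow> (real, 'n) vec \<Rightarrow> (real, 'n) vec \<Rightarrow> real" where
  "signed_form \<sigma> j x y = \<sigma> * ((DA j x *v cut y) \<bullet> cut y)"

lemma n_ge_1: "n \<ge> 1" by (simp add: n_def Suc_leI)

lemma L_pos: "L > 0" using C n_ge_1 by (simp add: L_def)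

lemma axis_Basis: "axis j 1 \<in> (Basis :: (real, 'n) vec set)"
  by (simp add: axis_in_Basis_iff)

lemma norm_iterated_A:
  assumes "set bs \<subseteq> Basis" "length bs \<le> 3"
  shows "norm (iterated_deriv bs A x) \<le> L"
proof -
  have "norm (iterated_deriv bs A x) \<le> sqrt DIM(((real, 'n) vec, 'n) vec) * C"
    by (rule norm_iterated_deriv_le[OF bound]) (use assms l in auto)
  also have "\<dots> = 1 * n * C" by (simp add: n_def)
  also have "\<dots> \<le> n * n * C" using C n_ge_1 by (intro mult_right_mono) auto
  finally show ?thesis by (simp add: L_def power2_eq_square)
qed

lemma lipschitz_iterated_A:
  assumes "set bs \<subseteq> Basis" "length bs \<le> 2"
  shows "norm (iterated_deriv bs A x - iterated_deriv bs A y) \<le> L * norm (x - y)"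
proof -
  have "norm (iterated_deriv bs A x - iterated_deriv bs A y)
      \<le> DIM((real, 'n) vec) * (sqrt DIM(((real, 'n) vec, 'n) vec) * C) * norm (x - y)"
    by (rule lipschitz_iterated_deriv[OF bound])
      (use assms l in \<open>auto intro!: differentiableI[OF iterated_deriv_has_derivative[OF smooth]]\<close>)
  thus ?thesis by (simp add: L_def n_def power2_eq_square mult_ac)
qed

lemma norm_A: "norm (A x) \<le> L"
  and norm_DA: "norm (DA j x) \<le> L"
  and lipschitz_A: "norm (A x - A y) \<le> L * norm (x - y)"
  and lipschitz_DA: "norm (DA j x - DA j y) \<le> L * norm (x - y)"
  using norm_iterated_A[of "[]" x] norm_iterated_A[of "[axis j 1]" x]
    lipschitz_iterated_A[of "[]" x y] lipschitz_iterated_A[of "[axis j 1]" x y] axis_Basis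
  by (auto simp: DA_def)

lemma has_derivative_A: "(A has_derivative frechet_derivative A (at x)) (at x)"
  using Ck_has_derivative[OF smooth] l by simp

lemma differentiable_DA: "DA j differentiable (at x)"
  using iterated_deriv_has_derivative[OF smooth, of "[axis j 1]" x] axis_Basis[of j] l
  by (auto simp: DA_def differentiable_def)

lemma continuous_A: "continuous_on UNIV A"
  and continuous_DA: "continuous_on UNIV (DA j)"
  using differentiableI[OF has_derivative_A] differentiable_DA
  by (auto intro!: continuous_at_imp_continuous_on differentiable_imp_continuous_within)

lemma periodic_DA: "torus_periodic (DA j)"
  unfolding torus_periodic_def
proof (intro allI impI)
  fix k x :: "(real, 'n) vec" assume "\<forall>j. k $ j \<in> \<int>"
  hence "A = (\<lambda>x. A (x + k))" using periodic by (auto simp: torus_periodic_def)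
  moreover have "((\<lambda>x. A (x + k)) has_derivative frechet_derivative A (at (x + k))) (at x)"
    by (rule has_derivative_compose[OF _ has_derivative_A, of "\<lambda>x. x + k" "\<lambda>h. h", simplified])
      (auto intro!: derivative_eq_intros)
  ultimately have "frechet_derivative A (at x) = frechet_derivative A (at (x + k))"
    using frechet_derivative_at by metis
  thus "DA j (x + k) = DA j x" by (simp add: DA_def)
qed

lemma DA_second_difference:
  "norm (DA j (shift x k y) + DA j (shift x k (- y)) - 2 *\<^sub>R DA j x) \<le> 2 * L * y\<^sup>2"
proof (rule second_difference_bound[where f' = "iterated_deriv [axis j 1, axis k 1] A"])
  show "((\<lambda>y. DA j (shift x k y)) has_vector_derivative
      iterated_deriv [axis j 1, axis k 1] A (shift x k y)) (at y)" for x y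
    using has_vector_derivative_shift[OF iterated_deriv_has_derivative[OF smooth, of "[axis j 1]"], of x k y]
      axis_Basis l by (simp add: DA_def)
qed (use lipschitz_iterated_A[of "[axis j 1, axis k 1]"] axis_Basis in simp)

text \<open>Differentiation under the integral sign. Only the slow part of an increment acts on the averaged
matrix, and the Taylor remainder of \<open>A\<close> is uniform in the fast angles.\<close>

lemma averaged_partial:
  assumes "i \<in> first_indices d"
  shows "frechet_derivative (averaged d A) (at \<theta>) (axis i 1) = torus_mean (last_indices d) (DA i) \<theta>"
proof -
  let ?J = "last_indices d"
  let ?D = "\<lambda>h s. \<Sum>j\<in>first_indices d. h $ j *\<^sub>R DA j (fill ?J \<theta> s)"
  have int: "integrable (torus_measure ?J) (\<lambda>s. DA j (fill ?J \<theta> s))" for j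
    by (rule integrable_fill[OF continuous_DA norm_DA])
  have deriv_sum: "frechet_derivative A (at x) h = (\<Sum>j\<in>UNIV. h $ j *\<^sub>R DA j x)" for x h
  proof -
    interpret bounded_linear "frechet_derivative A (at x)"
      by (rule has_derivative_bounded_linear[OF has_derivative_A])
    have "frechet_derivative A (at x) (\<Sum>j\<in>UNIV. h $ j *\<^sub>R axis j 1) = (\<Sum>j\<in>UNIV. h $ j *\<^sub>R DA j x)"
      by (simp add: sum scaleR DA_def)
    moreover have "(\<Sum>j\<in>UNIV. h $ j *\<^sub>R axis j 1) = h"
      using basis_expansion[of h] by (simp add: scalar_mult_eq_scaleR)
    ultimately show ?thesis by simp
  qed
  have "((\<lambda>y. LINT s|torus_measure ?J. A (fill ?J y s)) has_derivative
      (\<lambda>h. LINT s|torus_measure ?J. ?D h s)) (at \<theta>)"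
  proof (rule has_derivative_expectation[OF prob_space_torus])
    show "integrable (torus_measure ?J) (\<lambda>s. A (fill ?J y s))" for y
      by (rule integrable_fill[OF continuous_A norm_A])
    show "integrable (torus_measure ?J) (?D h)" for h
      by (intro Bochner_Integration.integrable_sum integrable_scaleR_right int)
    show "linear (\<lambda>h. ?D h s)" for s
      by (rule linearI) (simp_all add: scaleR_add_left sum.distrib scaleR_sum_right)
    fix y s
    let ?x = "fill ?J \<theta> s" and ?y = "fill ?J y s"
    have "norm (A ?y - A ?x - frechet_derivative A (at ?x) (?y - ?x))
        \<le> DIM((real, 'n) vec) * L * (norm (?y - ?x))\<^sup>2"
    proof (rule taylor_from_partials[OF has_derivative_A])
      fix z w b :: "(real, 'n) vec" assume "b \<in> Basis"
      then obtain j where "b = axis j 1" by (auto simp: Basis_vec_def)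
      thus "norm (frechet_derivative A (at z) b - frechet_derivative A (at w) b) \<le> L * norm (z - w)"
        using lipschitz_DA[of j z w] by (simp add: DA_def)
    qed
    also have "frechet_derivative A (at ?x) (?y - ?x) = ?D (y - \<theta>) s"
      unfolding deriv_sum by (rule sum.mono_neutral_cong_right) (auto simp: fill_def)
    also have "DIM((real, 'n) vec) * L * (norm (?y - ?x))\<^sup>2 \<le> DIM((real, 'n) vec) * L * (norm (y - \<theta>))\<^sup>2"
      using L_pos by (intro mult_left_mono power_mono norm_le_componentwise_cart) (auto simp: fill_def)
    finally show "norm (A ?y - A ?x - ?D (y - \<theta>) s) \<le> DIM((real, 'n) vec) * L * (norm (y - \<theta>))\<^sup>2" .
  qed
  hence "frechet_derivative (averaged d A) (at \<theta>) = (\<lambda>h. LINT s|torus_measure ?J. ?D h s)"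
    unfolding averaged_eq_torus_mean torus_mean_def[abs_def] by (rule frechet_derivative_at[symmetric])
  moreover have "?D (axis i 1) s = DA i (fill ?J \<theta> s)" for s
  proof -
    have "?D (axis i 1) s = (\<Sum>j\<in>first_indices d. if j = i then DA i (fill ?J \<theta> s) else 0)"
      by (intro sum.cong) (auto simp: axis_def)
    thus ?thesis using assms by simp
  qed
  ultimately show ?thesis by (simp add: torus_mean_def)
qed

text \<open>This is why the fast actions do not drift.\<close>

lemma mean_DA_eq_0:
  assumes "j \<in> J"
  shows "torus_mean J (DA j) \<theta> = 0"
proof (rule torus_mean_partial_derivative[OF assms, of A])
  show "A (shift x j 1) = A x" for x
    using periodic by (auto simp: torus_periodic_def axis_def)
  show "((\<lambda>y. A (shift x j y)) has_vector_derivative DA j (shift x j y)) (at y)" for x y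
    unfolding DA_def by (rule has_vector_derivative_shift[OF has_derivative_A])
qed (rule continuous_DA norm_DA)+

lemma norm_cut_le: "norm (cut x :: (real, 'n) vec) \<le> 2 * n"
  using norm_cut[of x] by (simp add: n_def)

lemma abs_signed_form_le:
  assumes "\<bar>\<sigma>\<bar> \<le> 1"
  shows "\<bar>signed_form \<sigma> j x y\<bar> \<le> Lg"
proof -
  have "\<bar>signed_form \<sigma> j x y\<bar> \<le> 1 * (norm (DA j x) * (2 * n)\<^sup>2)"
    unfolding signed_form_def abs_mult by (intro mult_mono matrix_form_le norm_cut_le assms) auto
  also have "\<dots> \<le> 1 * (L * (2 * n)\<^sup>2)" by (intro mult_left_mono mult_right_mono norm_DA) auto
  finally show ?thesis by (simp add: Lg_def power2_eq_square mult_ac)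
qed

lemma lipschitz_signed_form:
  assumes "\<bar>\<sigma>\<bar> \<le> 1"
  shows "\<bar>signed_form \<sigma> j x y - signed_form \<sigma> j x' y'\<bar> \<le> Lg * (norm (x - x') + norm (y - y'))"
proof -
  have "\<bar>signed_form \<sigma> j x y - signed_form \<sigma> j x' y'\<bar> = \<bar>\<sigma>\<bar> * \<bar>(DA j x *v cut y) \<bullet> cut y - (DA j x' *v cut y') \<bullet> cut y'\<bar>"
    by (simp add: signed_form_def flip: abs_mult right_diff_distrib)
  also have "\<dots> \<le> 1 * ((2 * n)\<^sup>2 * norm (DA j x - DA j x')
      + L * (2 * n) * (norm (cut y - cut y') + norm (cut y - cut y')))"
    by (intro mult_mono matrix_form_lipschitz norm_cut_le norm_DA assms) auto
  also have "\<dots> \<le> 1 * ((2 * n)\<^sup>2 * (L * norm (x - x')) + L * (2 * n) * (norm (y - y') + norm (y - y')))"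
    using L_pos n_ge_1 by (intro mult_left_mono add_mono lipschitz_DA norm_cut_diff) auto
  also have "\<dots> = Lg * norm (x - x') + (4 * n * L) * norm (y - y')"
    by (simp add: Lg_def power2_eq_square algebra_simps)
  also have "\<dots> \<le> Lg * norm (x - x') + Lg * norm (y - y')"
    using L_pos n_ge_1 by (intro add_left_mono mult_right_mono) (auto simp: Lg_def power2_eq_square)
  finally show ?thesis by (simp add: distrib_left)
qed

lemma periodic_C11_signed_form:
  assumes "\<bar>\<sigma>\<bar> \<le> 1"
  shows "periodic_C11 (2 * Lg) (\<lambda>x. of_real (signed_form \<sigma> j x y))"
  unfolding periodic_C11_def
proof (intro conjI allI)
  show "continuous_on UNIV (\<lambda>x. complex_of_real (signed_form \<sigma> j x y))"
    unfolding signed_form_def using bounded_bilinear.continuous_on[OF bounded_bilinear_matrix_vector continuous_DA continuous_on_const]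
    by (intro continuous_intros) auto
  show "torus_periodic (\<lambda>x. complex_of_real (signed_form \<sigma> j x y))"
    using periodic_DA[of j] by (simp add: torus_periodic_def signed_form_def)
  fix x k t
  let ?M = "DA j (shift x k t) + DA j (shift x k (- t)) - 2 *\<^sub>R DA j x"
  have "signed_form \<sigma> j (shift x k t) y + signed_form \<sigma> j (shift x k (- t)) y - 2 * signed_form \<sigma> j x y = \<sigma> * ((?M *v cut y) \<bullet> cut y)"
    by (simp add: signed_form_def matrix_vector_mult_diff_rdistrib matrix_vector_mult_add_rdistrib
        scaleR_matrix_vector_assoc[symmetric] inner_diff_left inner_add_left algebra_simps)
  hence "\<bar>signed_form \<sigma> j (shift x k t) y + signed_form \<sigma> j (shift x k (- t)) y - 2 * signed_form \<sigma> j x y\<bar> = \<bar>\<sigma>\<bar> * \<bar>(?M *v cut y) \<bullet> cut y\<bar>"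
    by (simp only: abs_mult)
  moreover have "complex_of_real (signed_form \<sigma> j (shift x k t) y) + of_real (signed_form \<sigma> j (shift x k (- t)) y) - 2 * of_real (signed_form \<sigma> j x y)
      = of_real (signed_form \<sigma> j (shift x k t) y + signed_form \<sigma> j (shift x k (- t)) y - 2 * signed_form \<sigma> j x y)" by simp
  ultimately have "norm (complex_of_real (signed_form \<sigma> j (shift x k t) y) + of_real (signed_form \<sigma> j (shift x k (- t)) y) - 2 * of_real (signed_form \<sigma> j x y))
      = \<bar>\<sigma>\<bar> * \<bar>(?M *v cut y) \<bullet> cut y\<bar>" by (simp only: norm_of_real)
  also have "\<dots> \<le> 1 * ((2 * L * t\<^sup>2) * (2 * n)\<^sup>2)"
    using DA_second_difference[of j x t k] assms
    by (intro mult_mono order_trans[OF matrix_form_le[OF norm_cut_le norm_cut_le]] mult_right_mono) auto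
  also have "\<dots> = 2 * Lg * t\<^sup>2" by (simp add: Lg_def power2_eq_square)
  finally show "norm (complex_of_real (signed_form \<sigma> j (shift x k t) y) + of_real (signed_form \<sigma> j (shift x k (- t)) y) - 2 * of_real (signed_form \<sigma> j x y)) \<le> 2 * Lg * t\<^sup>2" .
qed

lemma torus_mean_signed_form:
  "torus_mean J (\<lambda>x. signed_form \<sigma> j x y) \<theta> = \<sigma> * ((torus_mean J (DA j) \<theta> *v cut y) \<bullet> cut y)"
proof -
  have "bounded_linear (\<lambda>M. \<sigma> * ((M *v cut y) \<bullet> cut y))"
    by (rule bounded_linear_compose[OF bounded_linear_mult_right bounded_linear_compose[OF bounded_linear_inner_left
          bounded_bilinear.bounded_linear_left[OF bounded_bilinear_matrix_vector]]])
  from integral_bounded_linear[OF this integrable_fill[OF continuous_DA norm_DA]]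
  show ?thesis by (simp add: torus_mean_def signed_form_def)
qed

text \<open>Only the angles outside \<open>J\<close> matter, and \<open>w\<close> is any vector with the right components there. Along an
orbit \<open>w = \<theta>(t) - \<theta>(0) - t \<omega>\<close> is small, whereas \<open>\<theta>(t) - \<theta>(0)\<close> is not.\<close>

lemma torus_mean_signed_form_lower:
  assumes "\<bar>\<sigma>\<bar> \<le> 1" and w: "\<And>j. j \<notin> J \<Longrightarrow> w $ j = \<theta> $ j - \<theta>' $ j"
  shows "torus_mean J (\<lambda>x. signed_form \<sigma> j x y) \<theta> \<ge> torus_mean J (\<lambda>x. signed_form \<sigma> j x y') \<theta>' - Lg * (norm w + norm (y - y'))"
proof -
  interpret prob_space "torus_measure J" by (rule prob_space_torus)
  have Lg0: "Lg \<ge> 0" using L_pos by (simp add: Lg_def)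
  have cont: "continuous_on UNIV (\<lambda>x. signed_form \<sigma> j x y)" for y
    unfolding signed_form_def using bounded_bilinear.continuous_on[OF bounded_bilinear_matrix_vector continuous_DA continuous_on_const]
    by (intro continuous_intros) auto
  have int: "integrable (torus_measure J) (\<lambda>s. signed_form \<sigma> j (fill J \<theta> s) y)" for \<theta> y
    by (rule integrable_fill[OF cont]) (use abs_signed_form_le[OF assms(1)] in simp)
  have "(LINT s|torus_measure J. signed_form \<sigma> j (fill J \<theta>' s) y' - Lg * (norm w + norm (y - y')))
      \<le> (LINT s|torus_measure J. signed_form \<sigma> j (fill J \<theta> s) y)"
  proof (rule integral_mono)
    fix s
    have "norm (fill J \<theta>' s - fill J \<theta> s) \<le> norm w"
      by (rule norm_le_componentwise_cart) (auto simp: fill_def w)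
    hence "Lg * (norm (fill J \<theta>' s - fill J \<theta> s) + norm (y' - y)) \<le> Lg * (norm w + norm (y - y'))"
      using Lg0 by (intro mult_left_mono add_mono) (auto simp: norm_minus_commute)
    thus "signed_form \<sigma> j (fill J \<theta>' s) y' - Lg * (norm w + norm (y - y')) \<le> signed_form \<sigma> j (fill J \<theta> s) y"
      using lipschitz_signed_form[OF assms(1), of j "fill J \<theta>' s" y' "fill J \<theta> s" y] by linarith
  qed (use int in auto)
  thus ?thesis using int by (simp add: torus_mean_def prob_space)
qed

end

section \<open>The rescaled Hamiltonian system\<close>

lemma differentiable_bilinear:
  assumes "bounded_bilinear h" "f differentiable (at x)" "g differentiable (at x)"
  shows "(\<lambda>x. h (f x) (g x)) differentiable (at x)"
  using bounded_bilinear.FDERIV[OF assms(1)] assms(2,3) unfolding differentiable_def by blast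

lemma norm_fst_snd_le: "norm (fst w) \<le> norm w" "norm (snd w) \<le> norm w"
  by (cases w; simp add: norm_fst_le norm_snd_le)+

text \<open>The condition \<open>\<epsilon> C2 \<le> 1\<close> lets the terms of order \<open>\<epsilon>\<^sup>2\<close> be absorbed into those of order \<open>\<epsilon>\<close>, so
that speed bounds, and with them \<open>\<delta>\<close>, do not depend on \<open>C2\<close>.\<close>

locale scaled_hamiltonian = C3_matrix_field A l C n L Lg
  for A :: "(real, 'n::{finite,linorder}) vec \<Rightarrow> ((real, 'n) vec, 'n) vec" and l :: nat and C n L Lg :: real +
  fixes H R :: "(real, 'n) vec \<times> (real, 'n) vec \<Rightarrow> real" and \<omega> :: "(real, 'n) vec" and \<epsilon> C2 :: real
  assumes \<epsilon>: "\<epsilon> > 0" and C2: "C2 > 0" "\<epsilon> * C2 \<le> 1" and H_smooth: "Ck l H"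
    and H_eq: "\<And>\<theta> I. H (\<theta>, I) = \<omega> \<bullet> I + (A \<theta> *v I) \<bullet> I + R (\<theta>, I)"
    and R_bound: "Ck_norm l (UNIV \<times> {I. infnorm I < 3}) (\<lambda>(\<theta>, I). R (\<theta>, \<epsilon> *\<^sub>R I) / \<epsilon> ^ 3) \<le> ereal C2"
begin

definition G :: "(real, 'n) vec \<times> (real, 'n) vec \<Rightarrow> real" where
  "G z = R (fst z, \<epsilon> *\<^sub>R snd z) / \<epsilon> ^ 3"

definition strip :: "((real, 'n) vec \<times> (real, 'n) vec) set" where
  "strip = UNIV \<times> {I. infnorm I < 3}"

lemma G_bound: "Ck_norm l strip G \<le> ereal C2"
proof -
  have "(\<lambda>(\<theta>, I). R (\<theta>, \<epsilon> *\<^sub>R I) / \<epsilon> ^ 3) = G" by (simp add: G_def fun_eq_iff)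
  thus ?thesis using R_bound by (simp add: strip_def)
qed

text \<open>The right-hand side consists of functions of known smoothness, from which the derivatives of the
remainder are computed.\<close>

lemma G_eq:
  "G z = (H (fst z, \<epsilon> *\<^sub>R snd z) - \<epsilon> * (\<omega> \<bullet> snd z) - \<epsilon>\<^sup>2 * ((A (fst z) *v snd z) \<bullet> snd z)) / \<epsilon> ^ 3"
  by (simp add: G_def H_eq matrix_vector_mult_scaleR power2_eq_square)

abbreviation H' :: "(real, 'n) vec \<times> (real, 'n) vec \<Rightarrow> (real, 'n) vec \<times> (real, 'n) vec \<Rightarrow> real" where
  "H' z \<equiv> frechet_derivative H (at z)"

lemma H_derivative: "(H has_derivative H' z) (at z)"
  using Ck_has_derivative[OF H_smooth] l by simp

lemma G_derivative:
  "(G has_derivative (\<lambda>h. (H' (fst z, \<epsilon> *\<^sub>R snd z) (fst h, \<epsilon> *\<^sub>R snd h) - \<epsilon> * (\<omega> \<bullet> snd h) -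
      \<epsilon>\<^sup>2 * ((A (fst z) *v snd z) \<bullet> snd h + (A (fst z) *v snd h + frechet_derivative A (at (fst z)) (fst h) *v snd z) \<bullet> snd z)) / \<epsilon> ^ 3)) (at z)"
proof -
  have H1: "((\<lambda>z. H (fst z, \<epsilon> *\<^sub>R snd z)) has_derivative (\<lambda>h. H' (fst z, \<epsilon> *\<^sub>R snd z) (fst h, \<epsilon> *\<^sub>R snd h))) (at z)"
    by (rule has_derivative_compose[where f = "\<lambda>z. (fst z, \<epsilon> *\<^sub>R snd z)" and g = H
          and f' = "\<lambda>h. (fst h, \<epsilon> *\<^sub>R snd h)" and g' = "H' (fst z, \<epsilon> *\<^sub>R snd z)"])
      (auto intro!: derivative_eq_intros H_derivative)
  have "((\<lambda>z. A (fst z)) has_derivative (\<lambda>h. frechet_derivative A (at (fst z)) (fst h))) (at z)"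
    by (rule has_derivative_compose[where f = fst and g = A and f' = fst and g' = "frechet_derivative A (at (fst z))"])
      (auto intro!: derivative_eq_intros has_derivative_A)
  from bounded_bilinear.FDERIV[OF bounded_bilinear_matrix_vector this bounded_linear_imp_has_derivative[OF bounded_linear_snd]]
  have A1: "((\<lambda>z. A (fst z) *v snd z) has_derivative
      (\<lambda>h. A (fst z) *v snd h + frechet_derivative A (at (fst z)) (fst h) *v snd z)) (at z)"
    .
  show ?thesis unfolding G_eq[abs_def]
    by (rule derivative_eq_intros H1 A1 refl)+ (use \<epsilon> in \<open>auto simp: fun_eq_iff field_simps\<close>)
qed

lemma G_partial_angle:
  "partial (axis j 1, 0) G z = (H' (fst z, \<epsilon> *\<^sub>R snd z) (axis j 1, 0) - \<epsilon>\<^sup>2 * ((DA j (fst z) *v snd z) \<bullet> snd z)) / \<epsilon> ^ 3"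
  using fun_cong[OF frechet_derivative_at[OF G_derivative[of z]], of "(axis j 1, 0)"] by (simp add: DA_def)

lemma G_partial_action:
  "partial (0, axis j 1) G z = (\<epsilon> * H' (fst z, \<epsilon> *\<^sub>R snd z) (0, axis j 1) - \<epsilon> * \<omega> $ j -
      \<epsilon>\<^sup>2 * ((A (fst z) *v snd z) \<bullet> axis j 1 + (A (fst z) *v axis j 1) \<bullet> snd z)) / \<epsilon> ^ 3"
proof -
  interpret H': bounded_linear "H' (fst z, \<epsilon> *\<^sub>R snd z)" by (rule has_derivative_bounded_linear[OF H_derivative])
  interpret A': bounded_linear "frechet_derivative A (at (fst z))" by (rule has_derivative_bounded_linear[OF has_derivative_A])
  have "H' (fst z, \<epsilon> *\<^sub>R snd z) (0, \<epsilon> *\<^sub>R axis j 1) = \<epsilon> * H' (fst z, \<epsilon> *\<^sub>R snd z) (0, axis j 1)"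
    using H'.scaleR[of \<epsilon> "(0, axis j 1)"] by simp
  thus ?thesis
    using fun_cong[OF frechet_derivative_at[OF G_derivative[of z]], of "(0, axis j 1)"]
    by (simp add: A'.zero inner_axis)
qed

lemma partial_H_differentiable:
  assumes "b \<in> Basis"
  shows "(\<lambda>z. H' (fst z, \<epsilon> *\<^sub>R snd z) b) differentiable (at z)"
proof -
  have "partial b H differentiable (at x)" for x
    using iterated_deriv_has_derivative[OF H_smooth, of "[b]" x] assms l by (auto simp: differentiable_def)
  moreover have "(\<lambda>z. (fst z, \<epsilon> *\<^sub>R snd z)) differentiable (at z)"
    unfolding differentiable_def by (rule exI, (rule derivative_eq_intros refl)+)
  ultimately show ?thesis by (rule differentiable_compose)
qed

lemma snd_differentiable: "snd differentiable (at z)" and fst_differentiable: "fst differentiable (at z)"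
  unfolding differentiable_def by (auto intro!: exI derivative_intros)

lemma partial_G_differentiable:
  assumes "b \<in> Basis"
  shows "partial b G differentiable (at z)"
proof -
  note bil = differentiable_bilinear[OF bounded_bilinear_inner] differentiable_bilinear[OF bounded_bilinear_matrix_vector]
  have A1: "(\<lambda>z :: (real, 'n) vec \<times> (real, 'n) vec. A (fst z)) differentiable (at z)"
    by (rule differentiable_compose[OF _ fst_differentiable]) (use has_derivative_A in \<open>auto simp: differentiable_def\<close>)
  have A2: "(\<lambda>z :: (real, 'n) vec \<times> (real, 'n) vec. DA j (fst z)) differentiable (at z)" for j
    by (rule differentiable_compose[OF differentiable_DA fst_differentiable])
  from assms consider j where "b = (axis j 1, 0)" | j where "b = (0, axis j 1)"
    by (auto simp: Basis_prod_def Basis_vec_def)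
  thus ?thesis
  proof cases
    case (1 j)
    hence "b \<in> Basis" using assms by simp
    note P = partial_H_differentiable[OF this, of z]
    show ?thesis unfolding 1 G_partial_angle[abs_def] divide_inverse
      by (intro differentiable_mult differentiable_diff differentiable_const bil A2 snd_differentiable P[unfolded 1])
  next
    case (2 j)
    note P = partial_H_differentiable[OF assms, of z]
    show ?thesis unfolding 2 G_partial_action[abs_def] divide_inverse
      by (intro differentiable_mult differentiable_diff differentiable_add differentiable_const bil A1 snd_differentiable P[unfolded 2])
  qed
qed

lemma partial_G_bounds:
  assumes b: "b \<in> Basis"
  shows "\<bar>partial b G (\<theta>, cut I)\<bar> \<le> C2"
    and "\<bar>partial b G (\<theta>, cut I) - partial b G (\<theta>', cut I')\<bar> \<le> 2 * n * C2 * norm ((\<theta>, I) - (\<theta>', I'))"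
proof -
  have in_strip: "(\<theta>, cut I) \<in> strip" for \<theta> I
    using infnorm_cut[of I] by (simp add: strip_def)
  show "\<bar>partial b G (\<theta>, cut I)\<bar> \<le> C2"
    using norm_iterated_deriv_le[OF G_bound, of "[b]"] b l in_strip by simp
  have "convex strip" unfolding strip_def by (intro convex_Times convex_infnorm_less) simp
  from lipschitz_iterated_deriv[OF G_bound, of "[b]" "(\<theta>, cut I)" "(\<theta>', cut I')", OF _ _ this]
  have "\<bar>partial b G (\<theta>, cut I) - partial b G (\<theta>', cut I')\<bar> \<le> 2 * n * C2 * norm ((\<theta>, cut I) - (\<theta>', cut I'))"
    using b l in_strip partial_G_differentiable[OF b] by (simp add: n_def mult_ac)
  also have "\<dots> \<le> 2 * n * C2 * norm ((\<theta>, I) - (\<theta>', I'))"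
    using C2 n_ge_1 norm_cut_diff[of I I'] by (intro mult_left_mono) (auto simp: norm_Pair intro!: real_sqrt_le_mono power_mono)
  finally show "\<bar>partial b G (\<theta>, cut I) - partial b G (\<theta>', cut I')\<bar> \<le> 2 * n * C2 * norm ((\<theta>, I) - (\<theta>', I'))" .
qed

text \<open>Together with the next definition, the vector field of the rescaled system with truncated actions.
The form \<open>(A I) \<cdot> I\<close> is differentiated as a bilinear expression.\<close>

definition angle_speed :: "(real, 'n) vec \<times> (real, 'n) vec \<Rightarrow> (real, 'n) vec" where
  "angle_speed z = (\<chi> j. \<omega> $ j + \<epsilon> * ((A (fst z) *v cut (snd z)) \<bullet> axis j 1 + (A (fst z) *v axis j 1) \<bullet> cut (snd z))
     + \<epsilon>\<^sup>2 * partial (0, axis j 1) G (fst z, cut (snd z)))"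

definition action_speed :: "(real, 'n) vec \<times> (real, 'n) vec \<Rightarrow> (real, 'n) vec" where
  "action_speed z = (\<chi> j. \<epsilon> * signed_form (- 1) j (fst z) (snd z) - \<epsilon>\<^sup>2 * partial (axis j 1, 0) G (fst z, cut (snd z)))"

lemma gradients:
  assumes "infnorm I \<le> 2"
  shows "grad_action H (\<theta>, \<epsilon> *\<^sub>R I) = angle_speed (\<theta>, I)"
    and "- grad_angle H (\<theta>, \<epsilon> *\<^sub>R I) = \<epsilon> *\<^sub>R action_speed (\<theta>, I)"
proof -
  show "grad_action H (\<theta>, \<epsilon> *\<^sub>R I) = angle_speed (\<theta>, I)"
    using \<epsilon> unfolding grad_action_def angle_speed_def G_partial_action
    by (simp add: cut_eq[OF assms] vec_eq_iff field_simps power2_eq_square power3_eq_cube)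
  show "- grad_angle H (\<theta>, \<epsilon> *\<^sub>R I) = \<epsilon> *\<^sub>R action_speed (\<theta>, I)"
    using \<epsilon> unfolding grad_angle_def action_speed_def G_partial_angle signed_form_def
    by (simp add: cut_eq[OF assms] vec_eq_iff field_simps power2_eq_square power3_eq_cube)
qed

definition B :: real where "B = n * (2 * Lg + 1)"

lemma Basis_pairs: "(axis j 1, 0) \<in> (Basis :: ((real, 'n) vec \<times> (real, 'n) vec) set)"
  "(0, axis j 1) \<in> (Basis :: ((real, 'n) vec \<times> (real, 'n) vec) set)"
  using axis_Basis by (auto simp: Basis_prod_def)

lemma norm_axis_le: "norm (axis j 1 :: (real, 'n) vec) \<le> 2 * n"
  using n_ge_1 by simp

lemma eps_sq_C2: "\<epsilon>\<^sup>2 * C2 \<le> \<epsilon>"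
  using C2 \<epsilon> by (simp add: power2_eq_square mult_left_le mult.assoc)

lemma Lg_nonneg: "Lg \<ge> 0" using L_pos by (simp add: Lg_def)

lemma angle_speed_bound: "norm (angle_speed z - \<omega>) \<le> B * \<epsilon>"
proof -
  have "\<bar>(angle_speed z - \<omega>) $ j\<bar> \<le> (2 * Lg + 1) * \<epsilon>" for j
  proof -
    have q: "\<bar>(A (fst z) *v v) \<bullet> w\<bar> \<le> Lg" if "norm v \<le> 2 * n" "norm w \<le> 2 * n" for v w
    proof -
      have "\<bar>(A (fst z) *v v) \<bullet> w\<bar> \<le> norm (A (fst z)) * (2 * n)\<^sup>2" by (rule matrix_form_le[OF that])
      also have "\<dots> \<le> L * (2 * n)\<^sup>2" by (intro mult_right_mono norm_A) auto
      finally show ?thesis by (simp add: Lg_def power2_eq_square mult_ac)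
    qed
    have "(angle_speed z - \<omega>) $ j = \<epsilon> * ((A (fst z) *v cut (snd z)) \<bullet> axis j 1 + (A (fst z) *v axis j 1) \<bullet> cut (snd z))
        + \<epsilon>\<^sup>2 * partial (0, axis j 1) G (fst z, cut (snd z))" by (simp add: angle_speed_def)
    also have "\<bar>\<dots>\<bar> \<le> \<epsilon> * \<bar>(A (fst z) *v cut (snd z)) \<bullet> axis j 1 + (A (fst z) *v axis j 1) \<bullet> cut (snd z)\<bar>
        + \<epsilon>\<^sup>2 * \<bar>partial (0, axis j 1) G (fst z, cut (snd z))\<bar>"
      using \<epsilon> by (intro order_trans[OF abs_triangle_ineq] add_mono) (auto simp: abs_mult)
    also have "\<dots> \<le> \<epsilon> * (Lg + Lg) + \<epsilon>\<^sup>2 * C2"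
      using \<epsilon> by (intro add_mono mult_left_mono order_trans[OF abs_triangle_ineq] q norm_cut_le norm_axis_le
          partial_G_bounds(1) Basis_pairs) auto
    also have "\<dots> \<le> (2 * Lg + 1) * \<epsilon>" using eps_sq_C2 by (simp add: algebra_simps)
    finally show ?thesis .
  qed
  from norm_le_card_times_bound[OF this] show ?thesis by (simp add: B_def mult_ac flip: n_def)
qed

lemma action_speed_close: "\<bar>action_speed z $ j - \<epsilon> * signed_form (- 1) j (fst z) (snd z)\<bar> \<le> C2 * \<epsilon>\<^sup>2"
  using partial_G_bounds(1)[OF Basis_pairs(1)[of j], where \<theta> = "fst z" and I = "snd z"] \<epsilon>
  by (simp add: action_speed_def abs_mult mult.commute)

lemma action_speed_component: "\<bar>action_speed z $ j\<bar> \<le> (Lg + 1) * \<epsilon>"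
proof -
  have "\<bar>\<epsilon> * signed_form (- 1) j (fst z) (snd z)\<bar> \<le> \<epsilon> * Lg"
    using \<epsilon> abs_signed_form_le[of "- 1"] by (simp add: abs_mult)
  thus ?thesis using action_speed_close[of z j] eps_sq_C2 by (simp add: algebra_simps)
qed

lemma action_speed_bound: "norm (action_speed z) \<le> B * \<epsilon>"
proof -
  have "norm (action_speed z) \<le> n * ((Lg + 1) * \<epsilon>)"
    unfolding n_def by (rule norm_le_card_times_bound[OF action_speed_component])
  also have "\<dots> \<le> B * \<epsilon>" using Lg_nonneg \<epsilon> n_ge_1 by (simp add: B_def mult_left_mono)
  finally show ?thesis .
qed

lemma speed_lipschitz:
  obtains K where "K > 0" "\<And>z z'. norm ((angle_speed z, action_speed z) - (angle_speed z', action_speed z')) \<le> K * norm (z - z')"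
proof -
  define K0 where "K0 = (2 * n)\<^sup>2 * L + L * (2 * n)"
  define K1 where "K1 = \<epsilon> * (2 * K0) + \<epsilon>\<^sup>2 * (2 * n * C2)"
  define K2 where "K2 = \<epsilon> * (2 * Lg) + \<epsilon>\<^sup>2 * (2 * n * C2)"
  have K0: "K0 \<ge> 0" using L_pos n_ge_1 by (simp add: K0_def)
  have fs: "norm (fst z - fst z') \<le> norm (z - z')" "norm (snd z - snd z') \<le> norm (z - z')"
    for z z' :: "(real, 'n) vec \<times> (real, 'n) vec"
    using norm_fst_snd_le[of "z - z'"] by simp_all
  have PG: "\<bar>partial b G (fst z, cut (snd z)) - partial b G (fst z', cut (snd z'))\<bar> \<le> 2 * n * C2 * norm (z - z')"
    if "b \<in> Basis" for b z z'
    using partial_G_bounds(2)[OF that, where \<theta> = "fst z" and I = "snd z" and \<theta>' = "fst z'" and I' = "snd z'"] by simp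
  have q: "\<bar>(A (fst z) *v v) \<bullet> w - (A (fst z') *v v') \<bullet> w'\<bar> \<le> K0 * norm (z - z')"
    if "norm v \<le> 2 * n" "norm w \<le> 2 * n" "norm v' \<le> 2 * n" "norm w' \<le> 2 * n"
      "norm (v - v') + norm (w - w') \<le> norm (z - z')"
    for v w v' w' and z z' :: "(real, 'n) vec \<times> (real, 'n) vec"
  proof -
    have "\<bar>(A (fst z) *v v) \<bullet> w - (A (fst z') *v v') \<bullet> w'\<bar> \<le>
        (2 * n)\<^sup>2 * norm (A (fst z) - A (fst z')) + L * (2 * n) * (norm (v - v') + norm (w - w'))"
      by (rule matrix_form_lipschitz[OF that(1-4) norm_A])
    also have "\<dots> \<le> (2 * n)\<^sup>2 * (L * norm (z - z')) + L * (2 * n) * norm (z - z')"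
      using L_pos n_ge_1 fs(1)[of z z'] that(5)
      by (intro add_mono mult_left_mono order_trans[OF lipschitz_A]) auto
    finally show ?thesis by (simp add: K0_def algebra_simps)
  qed
  have a: "\<bar>(angle_speed z - angle_speed z') $ j\<bar> \<le> K1 * norm (z - z')" for z z' j
  proof -
    let ?a = "\<lambda>z. (A (fst z) *v cut (snd z)) \<bullet> axis j 1" and ?b = "\<lambda>z. (A (fst z) *v axis j 1) \<bullet> cut (snd z)"
      and ?c = "\<lambda>z. partial (0, axis j 1) G (fst z, cut (snd z))"
    have cut: "norm (cut (snd z) - cut (snd z')) \<le> norm (z - z')"
      using norm_cut_diff[of "snd z" "snd z'"] fs(2)[of z z'] by simp
    have "(angle_speed z - angle_speed z') $ j = \<epsilon> * ((?a z - ?a z') + (?b z - ?b z')) + \<epsilon>\<^sup>2 * (?c z - ?c z')"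
      by (simp add: angle_speed_def algebra_simps)
    also have "\<bar>\<dots>\<bar> \<le> \<epsilon> * (\<bar>?a z - ?a z'\<bar> + \<bar>?b z - ?b z'\<bar>) + \<epsilon>\<^sup>2 * \<bar>?c z - ?c z'\<bar>"
      using \<epsilon> by (intro order_trans[OF abs_triangle_ineq] add_mono) (auto simp: abs_mult intro!: mult_left_mono)
    also have "\<dots> \<le> \<epsilon> * (K0 * norm (z - z') + K0 * norm (z - z')) + \<epsilon>\<^sup>2 * (2 * n * C2 * norm (z - z'))"
      using \<epsilon> cut by (intro add_mono mult_left_mono q PG Basis_pairs norm_cut_le norm_axis_le) auto
    finally show ?thesis by (simp add: K1_def algebra_simps)
  qed
  have b: "\<bar>(action_speed z - action_speed z') $ j\<bar> \<le> K2 * norm (z - z')" for z z' j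
  proof -
    let ?c = "\<lambda>z. partial (axis j 1, 0) G (fst z, cut (snd z))"
    have "(action_speed z - action_speed z') $ j =
        \<epsilon> * (signed_form (- 1) j (fst z) (snd z) - signed_form (- 1) j (fst z') (snd z')) - \<epsilon>\<^sup>2 * (?c z - ?c z')"
      by (simp add: action_speed_def algebra_simps)
    also have "\<bar>\<dots>\<bar> \<le> \<epsilon> * \<bar>signed_form (- 1) j (fst z) (snd z) - signed_form (- 1) j (fst z') (snd z')\<bar> + \<epsilon>\<^sup>2 * \<bar>?c z - ?c z'\<bar>"
      using \<epsilon> by (intro order_trans[OF abs_triangle_ineq4] add_mono) (auto simp: abs_mult)
    also have "\<dots> \<le> \<epsilon> * (Lg * (norm (z - z') + norm (z - z'))) + \<epsilon>\<^sup>2 * (2 * n * C2 * norm (z - z'))"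
      using \<epsilon> Lg_nonneg fs[of z z']
      by (intro add_mono mult_left_mono PG Basis_pairs order_trans[OF lipschitz_signed_form]) auto
    finally show ?thesis by (simp add: K2_def algebra_simps)
  qed
  show thesis
  proof (rule that[of "n * K1 + n * K2"])
    have "K1 > 0" "K2 \<ge> 0" using K0 \<epsilon> C2 n_ge_1 Lg_nonneg
      by (auto simp: K1_def K2_def intro!: add_nonneg_pos mult_pos_pos)
    thus "n * K1 + n * K2 > 0" using n_ge_1 by (intro add_pos_nonneg) auto
    fix z z'
    have "norm ((angle_speed z, action_speed z) - (angle_speed z', action_speed z'))
        \<le> norm (angle_speed z - angle_speed z') + norm (action_speed z - action_speed z')"
      using norm_Pair_le[of "angle_speed z - angle_speed z'" "action_speed z - action_speed z'"] by simp
    also have "\<dots> \<le> n * (K1 * norm (z - z')) + n * (K2 * norm (z - z'))"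
      unfolding n_def by (intro add_mono norm_le_card_times_bound a b)
    finally show "norm ((angle_speed z, action_speed z) - (angle_speed z', action_speed z')) \<le> (n * K1 + n * K2) * norm (z - z')"
      by (simp add: algebra_simps)
  qed
qed

text \<open>An orbit of the truncated system, defined for all times. It solves the Hamiltonian system wherever
the truncation is inactive.\<close>

lemma orbit:
  obtains \<theta> I where "\<theta> 0 = \<theta>0" "I 0 = I0"
    "\<And>t s. norm (\<theta> (t + s) - \<theta> t - s *\<^sub>R \<omega>) \<le> B * \<epsilon> * \<bar>s\<bar>"
    "\<And>t s. norm (I (t + s) - I t) \<le> B * \<epsilon> * \<bar>s\<bar>"
    "\<And>t j. ((\<lambda>t. I t $ j) has_real_derivative action_speed (\<theta> t, I t) $ j) (at t)"
    "\<And>j. \<exists>K. \<forall>s t. \<bar>action_speed (\<theta> t, I t) $ j - action_speed (\<theta> s, I s) $ j\<bar> \<le> K * \<bar>t - s\<bar>"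
    "\<And>S. (\<And>t. t \<in> S \<Longrightarrow> infnorm (I t) \<le> 2) \<Longrightarrow> hamiltonian_solution H S \<theta> (\<lambda>t. \<epsilon> *\<^sub>R I t)"
proof -
  let ?X = "\<lambda>z. (angle_speed z, action_speed z)"
  obtain K where K: "K > 0" "\<And>z z'. norm (?X z - ?X z') \<le> K * norm (z - z')" using speed_lipschitz by blast
  have Xb: "norm (?X z) \<le> norm \<omega> + B * \<epsilon> + B * \<epsilon>" for z
    using norm_Pair_le[of "angle_speed z" "action_speed z"] angle_speed_bound[of z] action_speed_bound[of z]
      norm_triangle_sub[of "angle_speed z" \<omega>] by linarith
  obtain z where z: "z 0 = (\<theta>0, I0)" "\<And>t. (z has_vector_derivative ?X (z t)) (at t)"
    by (rule lipschitz_bounded_ode_solution[of K ?X "norm \<omega> + B * \<epsilon> + B * \<epsilon>" "(\<theta>0, I0)"])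
      (use K Xb in auto)
  define \<theta> I where "\<theta> t = fst (z t)" and "I t = snd (z t)" for t
  have zt: "z t = (\<theta> t, I t)" for t by (simp add: \<theta>_def I_def)
  have d\<theta>: "(\<theta> has_vector_derivative angle_speed (\<theta> t, I t)) (at t)" for t
    using bounded_linear.has_vector_derivative[OF bounded_linear_fst z(2)[of t]] by (simp only: zt fst_conv)
  have dI: "(I has_vector_derivative action_speed (\<theta> t, I t)) (at t)" for t
    using bounded_linear.has_vector_derivative[OF bounded_linear_snd z(2)[of t]] by (simp only: zt snd_conv)
  have vbd: "norm (f x - f y) \<le> c * \<bar>x - y\<bar>"
    if "\<And>t. (f has_vector_derivative f' t) (at t)" "\<And>t. norm (f' t) \<le> c" for f' x y c
    and f :: "real \<Rightarrow> 'c::real_normed_vector"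
  proof -
    have "norm (f x - f y) \<le> c * norm (x - y)"
    proof (rule differentiable_bound[of UNIV f "\<lambda>t h. h *\<^sub>R f' t"])
      show "onorm (\<lambda>h. h *\<^sub>R f' t) \<le> c" for t
        using that(2)[of t] by (intro onorm_le) (auto simp: mult.commute[of c] intro: mult_left_mono)
    qed (use that(1) in \<open>auto simp: has_vector_derivative_def\<close>)
    thus ?thesis by simp
  qed
  show thesis
  proof (rule that[of \<theta> I])
    show "\<theta> 0 = \<theta>0" "I 0 = I0" by (simp_all add: \<theta>_def I_def z)
    show "norm (I (t + s) - I t) \<le> B * \<epsilon> * \<bar>s\<bar>" for t s
      using vbd[OF dI action_speed_bound, of "t + s" t] by simp
    show "norm (\<theta> (t + s) - \<theta> t - s *\<^sub>R \<omega>) \<le> B * \<epsilon> * \<bar>s\<bar>" for t s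
    proof -
      have "((\<lambda>t. \<theta> t - t *\<^sub>R \<omega>) has_vector_derivative angle_speed (\<theta> t, I t) - \<omega>) (at t)" for t
        by (rule derivative_eq_intros d\<theta> refl | simp)+
      from vbd[OF this angle_speed_bound, of "t + s" t] show ?thesis by (simp add: algebra_simps)
    qed
    show "((\<lambda>t. I t $ j) has_real_derivative action_speed (\<theta> t, I t) $ j) (at t)" for t j
      using bounded_linear.has_vector_derivative[OF bounded_linear_vec_nth dI[of t]]
      by (simp add: has_real_derivative_iff_has_vector_derivative)
    show "\<exists>K. \<forall>s t. \<bar>action_speed (\<theta> t, I t) $ j - action_speed (\<theta> s, I s) $ j\<bar> \<le> K * \<bar>t - s\<bar>" for j
    proof (intro exI allI)
      fix s t
      have "\<bar>action_speed (\<theta> t, I t) $ j - action_speed (\<theta> s, I s) $ j\<bar> \<le> norm (action_speed (z t) - action_speed (z s))"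
        using component_le_norm_cart[of "action_speed (z t) - action_speed (z s)" j] by (simp add: zt)
      also have "\<dots> \<le> norm (?X (z t) - ?X (z s))" using norm_fst_snd_le(2)[of "?X (z t) - ?X (z s)"] by simp
      also have "\<dots> \<le> K * norm (z t - z s)" by (rule K)
      also have "\<dots> \<le> K * ((norm \<omega> + B * \<epsilon> + B * \<epsilon>) * \<bar>t - s\<bar>)"
        using K(1) by (intro mult_left_mono vbd[OF z(2) Xb]) auto
      finally show "\<bar>action_speed (\<theta> t, I t) $ j - action_speed (\<theta> s, I s) $ j\<bar> \<le> (K * (norm \<omega> + B * \<epsilon> + B * \<epsilon>)) * \<bar>t - s\<bar>"
        by (simp add: mult.assoc)
    qed
    fix S assume S: "\<And>t. t \<in> S \<Longrightarrow> infnorm (I t) \<le> 2"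
    show "hamiltonian_solution H S \<theta> (\<lambda>t. \<epsilon> *\<^sub>R I t)"
      unfolding hamiltonian_solution_def
    proof (intro ballI conjI)
      fix t assume "t \<in> S"
      note grad = gradients[OF S[OF this], of "\<theta> t"]
      show "(\<theta> has_vector_derivative grad_action H (\<theta> t, \<epsilon> *\<^sub>R I t)) (at t within S)"
        unfolding grad by (rule has_vector_derivative_at_within[OF d\<theta>])
      show "((\<lambda>t. \<epsilon> *\<^sub>R I t) has_vector_derivative - grad_angle H (\<theta> t, \<epsilon> *\<^sub>R I t)) (at t within S)"
        unfolding grad
        by (rule has_vector_derivative_at_within[OF bounded_linear.has_vector_derivative[OF bounded_linear_scaleR_right dI]])
    qed
  qed
qed

end

section \<open>The drift of the actions\<close>

context scaled_hamiltonian begin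

text \<open>The averaging estimate with \<open>T = \<Psi>(Q)\<close> and with \<open>N - 1 = \<lfloor>Q/n\<rfloor>\<close>: the moduli of the components of a
frequency vector, each below \<open>N\<close>, then sum up to at most \<open>Q\<close>, and \<open>1/N \<le> n/Q \<le> 2 n \<mu>\<close>.\<close>

lemma drift_lower_bound:
  assumes M: "prob_space M" "sets M = sets borel" "integrable M (\<lambda>s. \<bar>s\<bar>)"
      "\<And>\<xi>. \<bar>\<xi>\<bar> \<ge> 4 \<Longrightarrow> char M \<xi> = 0"
    and \<omega>: "nonresonant d \<omega>" "\<And>j. j \<in> first_indices d \<Longrightarrow> \<omega> $ j = 0"
    and Q: "Q \<ge> 1" "\<epsilon> \<le> 2 * \<mu>" "\<epsilon> * Psi d \<omega> Q \<le> 2 * \<mu>" "1 / Q \<le> 2 * \<mu>" "Psi d \<omega> Q \<ge> 1"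
    and \<theta>: "\<And>t s. norm (\<theta> (t + s) - \<theta> t - s *\<^sub>R \<omega>) \<le> B * \<epsilon> * \<bar>s\<bar>"
    and I: "\<And>t s. norm (I (t + s) - I t) \<le> B * \<epsilon> * \<bar>s\<bar>"
    and dI: "\<And>t. ((\<lambda>t. I t $ j) has_real_derivative action_speed (\<theta> t, I t) $ j) (at t)"
    and lip: "\<And>s t. \<bar>action_speed (\<theta> t, I t) $ j - action_speed (\<theta> s, I s) $ j\<bar> \<le> K * \<bar>t - s\<bar>"
    and \<sigma>: "\<bar>\<sigma>\<bar> = 1" and \<delta>: "\<delta> > 0"
    and mean: "\<And>t. 0 \<le> t \<Longrightarrow> t \<le> \<delta> / \<epsilon> \<Longrightarrow> a \<le> torus_mean (last_indices d) (\<lambda>x. signed_form (- \<sigma>) j x (I t)) (\<theta> t)"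
  defines "m \<equiv> (LINT s|M. \<bar>s\<bar>)"
  shows "\<sigma> * (I (\<delta> / \<epsilon>) $ j - I 0 $ j) \<ge> \<delta> * a - (\<delta> * (n\<^sup>2 * Lg + 2 * C2 + 4 * Lg * B * m) + 4 * B * m) * \<mu>"
proof -
  let ?J = "last_indices d :: 'n set"
  define T where "T = Psi d \<omega> Q"
  define N where "N = nat \<lfloor>Q / n\<rfloor> + 1"
  define \<tau> where "\<tau> = \<delta> / \<epsilon>"
  have n0: "n > 0" using n_ge_1 by simp
  have B0: "B \<ge> 0" using n0 Lg_nonneg by (simp add: B_def)
  have m0: "m \<ge> 0" unfolding m_def by (rule Bochner_Integration.integral_nonneg) simp
  have small: "\<bar>T * freq_dot k \<omega>\<bar> \<ge> 1" if "\<And>i. i \<notin> ?J \<Longrightarrow> k $ i = 0" "\<And>i. \<bar>k $ i\<bar> < int N" "k \<noteq> 0" for k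
    unfolding T_def
  proof (rule Psi_times_divisor[OF \<omega>(1)])
    show "k \<in> last_int_vectors d" using that(1) by (auto simp: last_int_vectors_def)
    have "(\<Sum>i\<in>UNIV. \<bar>k $ i\<bar>) \<le> (\<Sum>i\<in>(UNIV :: 'n set). int N - 1)"
    proof (rule sum_mono)
      show "\<bar>k $ i\<bar> \<le> int N - 1" for i using that(2)[of i] by simp
    qed
    also have "\<dots> = int CARD('n) * \<lfloor>Q / n\<rfloor>" using Q(1) n0 by (simp add: N_def)
    finally have "real_of_int (\<Sum>i\<in>UNIV. \<bar>k $ i\<bar>) \<le> real_of_int (int CARD('n) * \<lfloor>Q / n\<rfloor>)"
      by (simp only: of_int_le_iff)
    also have "\<dots> = n * real_of_int \<lfloor>Q / n\<rfloor>" by (simp add: n_def)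
    also have "\<dots> \<le> n * (Q / n)" using n0 by (intro mult_left_mono) auto
    finally show "real_of_int (\<Sum>i\<in>UNIV. \<bar>k $ i\<bar>) \<le> Q" using n0 by simp
  qed fact
  have "\<sigma> * (I \<tau> $ j) - \<sigma> * (I 0 $ j) \<ge> \<tau> * (\<epsilon> * (a - card ?J * (2 * Lg / (4 * real N))) - C2 * \<epsilon>\<^sup>2 - 2 * Lg * B * \<epsilon>\<^sup>2 * T * m)
    - 2 * B * \<epsilon> * T * m"
    unfolding m_def
  proof (rule averaging_lower_bound[OF M _ small, where I = I and \<theta> = \<theta> and g = "signed_form (- \<sigma>) j" and K = Lg
        and u = "\<lambda>t. \<sigma> * (I t $ j)" and u' = "\<lambda>t. \<sigma> * (action_speed (\<theta> t, I t) $ j)" and K' = K])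
    show "((\<lambda>t. \<sigma> * (I t $ j)) has_real_derivative \<sigma> * (action_speed (\<theta> t, I t) $ j)) (at t)" for t
      by (intro DERIV_cmult dI)
    show "\<bar>\<sigma> * (action_speed (\<theta> t, I t) $ j)\<bar> \<le> B * \<epsilon>" for t
      using component_le_norm_cart[of "action_speed (\<theta> t, I t)" j] action_speed_bound[of "(\<theta> t, I t)"] \<sigma>
      by (simp add: abs_mult)
    show "\<bar>\<sigma> * (action_speed (\<theta> t, I t) $ j) - \<sigma> * (action_speed (\<theta> s, I s) $ j)\<bar> \<le> K * \<bar>t - s\<bar>" for s t
      using lip[of t s] \<sigma> by (simp add: abs_mult flip: right_diff_distrib)
    show "\<bar>\<sigma> * (action_speed (\<theta> t, I t) $ j) - \<epsilon> * signed_form (- \<sigma>) j (\<theta> t) (I t)\<bar> \<le> C2 * \<epsilon>\<^sup>2" for t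
    proof -
      have "\<sigma> * (action_speed (\<theta> t, I t) $ j) - \<epsilon> * signed_form (- \<sigma>) j (\<theta> t) (I t)
          = \<sigma> * (action_speed (\<theta> t, I t) $ j - \<epsilon> * signed_form (- 1) j (\<theta> t) (I t))"
        by (simp add: signed_form_def algebra_simps)
      thus ?thesis using action_speed_close[of "(\<theta> t, I t)" j] \<sigma> by (simp add: abs_mult)
    qed
    show "T \<ge> 0" using Q(5) by (simp add: T_def)
    show "\<tau> > 0" using \<delta> \<epsilon> by (simp add: \<tau>_def)
    show "a \<le> torus_mean ?J (\<lambda>x. signed_form (- \<sigma>) j x (I t)) (\<theta> t)" if "0 \<le> t" "t \<le> \<tau>" for t
      using mean that by (simp add: \<tau>_def)
  qed (use \<omega> \<sigma> \<epsilon> Lg_nonneg in \<open>auto simp: N_def intro!: periodic_C11_signed_form abs_signed_form_le lipschitz_signed_form \<theta> I\<close>)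
  moreover have "\<tau> * (\<epsilon> * (a - card ?J * (2 * Lg / (4 * real N))) - C2 * \<epsilon>\<^sup>2 - 2 * Lg * B * \<epsilon>\<^sup>2 * T * m)
     = \<delta> * a - (\<delta> * (card ?J * (2 * Lg / (4 * real N))) + \<delta> * C2 * \<epsilon> + \<delta> * 2 * Lg * B * m * (\<epsilon> * T))"
    using \<epsilon> by (simp add: \<tau>_def field_simps power2_eq_square)
  moreover have "\<delta> * (card ?J * (2 * Lg / (4 * real N))) \<le> \<delta> * (n\<^sup>2 * Lg * \<mu>)"
  proof (intro mult_left_mono)
    have "Q / n \<le> real N" using Q(1) n0 unfolding N_def by linarith
    hence "1 / real N \<le> 1 / (Q / n)" using Q(1) n0 by (intro frac_le) auto
    also have "\<dots> = n * (1 / Q)" by simp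
    also have "\<dots> \<le> n * (2 * \<mu>)" using n0 Q(4) by (intro mult_left_mono) auto
    finally have "1 / real N \<le> n * (2 * \<mu>)" .
    hence "(real (card ?J) * Lg / 2) * (1 / real N) \<le> (n * Lg / 2) * (n * (2 * \<mu>))"
      using Lg_nonneg n0 card_mono[of UNIV ?J] by (intro mult_mono divide_right_mono mult_right_mono) (auto simp: n_def)
    thus "card ?J * (2 * Lg / (4 * real N)) \<le> n\<^sup>2 * Lg * \<mu>" by (simp add: power2_eq_square mult_ac)
  qed (use \<delta> in auto)
  moreover have "\<delta> * C2 * \<epsilon> \<le> \<delta> * C2 * (2 * \<mu>)"
    using \<delta> C2 Q(2) by (intro mult_left_mono) auto
  moreover have "\<delta> * 2 * Lg * B * m * (\<epsilon> * T) \<le> \<delta> * 2 * Lg * B * m * (2 * \<mu>)"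
    using \<delta> Lg_nonneg B0 m0 Q(3) by (intro mult_left_mono) (auto simp: T_def)
  moreover have "2 * B * m * (\<epsilon> * T) \<le> 2 * B * m * (2 * \<mu>)"
    using B0 m0 Q(3) by (intro mult_left_mono) (auto simp: T_def)
  ultimately show ?thesis unfolding \<tau>_def[symmetric] by (simp add: algebra_simps)
qed

text \<open>The conditions on \<open>\<delta>\<close> have two purposes. By \<open>B \<delta> \<le> 1\<close> the actions stay in the box of radius 2 up to
the time \<open>\<delta>/\<epsilon>\<close>; by \<open>4 Lg B \<delta> \<le> - lam\<close> the mean force on \<open>I\<^sub>i\<close>, initially at least \<open>- lam\<close>, stays
above half of this. The condition on \<open>\<mu>\<close> keeps the averaging error at most half of the drift.\<close>

lemma unstable_orbit:
  fixes \<theta>s I0 :: "(real, 'n) vec"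
  assumes M: "prob_space M" "sets M = sets borel" "integrable M (\<lambda>s. \<bar>s\<bar>)"
      "\<And>\<xi>. \<bar>\<xi>\<bar> \<ge> 4 \<Longrightarrow> char M \<xi> = 0"
    and d: "d \<le> CARD('n) - 1"
    and \<omega>: "nonresonant d \<omega>" "\<And>j. j \<in> first_indices d \<Longrightarrow> \<omega> $ j = 0" "infnorm \<omega> = 1"
    and Psi1: "Psi d \<omega> 1 \<le> 1 / \<epsilon>"
    and i: "i \<in> first_indices d" and lam: "lam < 0"
    and twist: "\<And>I. (frechet_derivative (averaged d A) (at \<theta>s) (axis i 1) *v I) \<bullet> I \<le> lam * (infnorm I)\<^sup>2"
    and I0: "infnorm I0 = 1"
    and \<delta>: "\<delta> > 0" "B * \<delta> \<le> 1" "4 * Lg * B * \<delta> \<le> - lam"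
  defines "K \<equiv> \<delta> * (n\<^sup>2 * Lg + 2 * C2 + 4 * Lg * B * (LINT s|M. \<bar>s\<bar>)) + 4 * B * (LINT s|M. \<bar>s\<bar>)"
  assumes small_mu: "K * mu 1 d \<omega> \<epsilon> \<le> \<delta> * (- lam) / 4"
  shows "\<exists>\<theta> I. hamiltonian_solution H {0..\<delta> / \<epsilon>} \<theta> I \<and>
              I 0 = \<epsilon> *\<^sub>R I0 \<and>
              infnorm (I (\<delta> / \<epsilon>) - I 0) \<ge> I (\<delta> / \<epsilon>) $ i - I 0 $ i \<and>
              I (\<delta> / \<epsilon>) $ i - I 0 $ i \<ge> \<delta> * (- lam) / 4 * \<epsilon> \<and>
              (MAX j \<in> last_indices d. \<bar>I (\<delta> / \<epsilon>) $ j - I 0 $ j\<bar>) \<le> K * \<epsilon> * mu 1 d \<omega> \<epsilon>"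
proof -
  let ?J = "last_indices d :: 'n set" and ?\<mu> = "mu 1 d \<omega> \<epsilon>"
  obtain Q where Q: "Q \<ge> 1" "\<epsilon> \<le> 1 / Q" "\<epsilon> * Psi d \<omega> Q \<le> 1 / Q" "1 / Q \<le> 2 * ?\<mu>" "Psi d \<omega> Q \<ge> 1"
    using cutoff_exists[OF \<omega>(1,3) d \<epsilon> Psi1] by blast
  have Q': "\<epsilon> \<le> 2 * ?\<mu>" "\<epsilon> * Psi d \<omega> Q \<le> 2 * ?\<mu>" using Q by linarith+
  obtain \<theta> I where start: "\<theta> 0 = \<theta>s" "I 0 = I0"
    and \<theta>: "\<And>t s. norm (\<theta> (t + s) - \<theta> t - s *\<^sub>R \<omega>) \<le> B * \<epsilon> * \<bar>s\<bar>"
    and I: "\<And>t s. norm (I (t + s) - I t) \<le> B * \<epsilon> * \<bar>s\<bar>"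
    and dI: "\<And>t j. ((\<lambda>t. I t $ j) has_real_derivative action_speed (\<theta> t, I t) $ j) (at t)"
    and lip: "\<And>j. \<exists>K. \<forall>s t. \<bar>action_speed (\<theta> t, I t) $ j - action_speed (\<theta> s, I s) $ j\<bar> \<le> K * \<bar>t - s\<bar>"
    and sol: "\<And>S. (\<And>t. t \<in> S \<Longrightarrow> infnorm (I t) \<le> 2) \<Longrightarrow> hamiltonian_solution H S \<theta> (\<lambda>t. \<epsilon> *\<^sub>R I t)"
    using orbit[of \<theta>s I0] by blast
  have B0: "B \<ge> 0" using n_ge_1 Lg_nonneg by (simp add: B_def)
  \<comment> \<open>the sign \<open>\<sigma>\<close> turns upper bounds for the actions into lower bounds\<close>
  have drift: "\<sigma> * (I (\<delta> / \<epsilon>) $ j - I0 $ j) \<ge> \<delta> * a - K * ?\<mu>"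
    if "\<bar>\<sigma>\<bar> = 1" "\<And>t. 0 \<le> t \<Longrightarrow> t \<le> \<delta> / \<epsilon> \<Longrightarrow> a \<le> torus_mean ?J (\<lambda>x. signed_form (- \<sigma>) j x (I t)) (\<theta> t)" for \<sigma> a j
  proof -
    obtain K' where "\<And>s t. \<bar>action_speed (\<theta> t, I t) $ j - action_speed (\<theta> s, I s) $ j\<bar> \<le> K' * \<bar>t - s\<bar>"
      using lip[of j] by blast
    from drift_lower_bound[OF M \<omega>(1,2) Q(1) Q' Q(4,5) \<theta> I dI this that(1) \<delta>(1) that(2)]
    show ?thesis by (simp add: K_def start)
  qed
  have near: "norm (\<theta> t - \<theta>s - t *\<^sub>R \<omega>) \<le> B * \<delta>" "norm (I t - I0) \<le> B * \<delta>" if "0 \<le> t" "t \<le> \<delta> / \<epsilon>" for t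
  proof -
    have "\<epsilon> * t \<le> \<delta>" using that \<epsilon> by (simp add: field_simps)
    hence "B * (\<epsilon> * t) \<le> B * \<delta>" using B0 by (rule mult_left_mono)
    thus "norm (\<theta> t - \<theta>s - t *\<^sub>R \<omega>) \<le> B * \<delta>" "norm (I t - I0) \<le> B * \<delta>"
      using \<theta>[of 0 t] I[of 0 t] that by (simp_all add: start mult.assoc)
  qed
  have "infnorm (I t) \<le> 2" if "t \<in> {0..\<delta> / \<epsilon>}" for t
  proof -
    have "infnorm (I t) \<le> infnorm (I t - I0) + infnorm I0" using infnorm_triangle[of "I t - I0" I0] by simp
    also have "\<dots> \<le> 1 + 1" using infnorm_le_norm[of "I t - I0"] near(2)[of t] \<delta>(2) I0 that by simp
    finally show ?thesis by simp
  qed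
  hence "hamiltonian_solution H {0..\<delta> / \<epsilon>} \<theta> (\<lambda>t. \<epsilon> *\<^sub>R I t)" by (rule sol)
  moreover have growth: "I (\<delta> / \<epsilon>) $ i - I0 $ i \<ge> \<delta> * (- lam) / 4"
  proof -
    have "- lam / 2 \<le> torus_mean ?J (\<lambda>x. signed_form (- 1) i x (I t)) (\<theta> t)" if t: "0 \<le> t" "t \<le> \<delta> / \<epsilon>" for t
    proof -
      have "torus_mean ?J (\<lambda>x. signed_form (- 1) i x I0) \<theta>s \<ge> - lam"
        using twist[of I0] cut_eq[of I0] I0 by (simp add: torus_mean_signed_form averaged_partial[OF i])
      moreover have "torus_mean ?J (\<lambda>x. signed_form (- 1) i x (I t)) (\<theta> t) \<ge> torus_mean ?J (\<lambda>x. signed_form (- 1) i x I0) \<theta>s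
          - Lg * (norm (\<theta> t - \<theta>s - t *\<^sub>R \<omega>) + norm (I t - I0))"
        by (rule torus_mean_signed_form_lower) (use \<omega>(2) in auto)
      moreover have "Lg * (norm (\<theta> t - \<theta>s - t *\<^sub>R \<omega>) + norm (I t - I0)) \<le> Lg * (B * \<delta> + B * \<delta>)"
        using Lg_nonneg by (intro mult_left_mono add_mono near t)
      ultimately show ?thesis using \<delta>(3) by (simp add: algebra_simps)
    qed
    from drift[of 1, OF _ this] have "I (\<delta> / \<epsilon>) $ i - I0 $ i \<ge> \<delta> * (- lam / 2) - K * ?\<mu>" by simp
    thus ?thesis using small_mu by (simp add: algebra_simps)
  qed
  moreover have "\<bar>I (\<delta> / \<epsilon>) $ j - I0 $ j\<bar> \<le> K * ?\<mu>" if "j \<in> ?J" for j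
  proof -
    have "\<sigma> * (I (\<delta> / \<epsilon>) $ j - I0 $ j) \<ge> - (K * ?\<mu>)" if "\<bar>\<sigma>\<bar> = 1" for \<sigma>
      using drift[OF that, of 0 j] \<open>j \<in> ?J\<close> by (simp add: torus_mean_signed_form mean_DA_eq_0)
    from this[of 1] this[of "- 1"] show ?thesis by simp
  qed
  hence "\<bar>\<epsilon> * I (\<delta> / \<epsilon>) $ j - \<epsilon> * I0 $ j\<bar> \<le> K * \<epsilon> * ?\<mu>" if "j \<in> ?J" for j
    using mult_left_mono[of "\<bar>I (\<delta> / \<epsilon>) $ j - I0 $ j\<bar>" "K * ?\<mu>" \<epsilon>] \<epsilon> that
    by (simp add: abs_mult mult_ac flip: right_diff_distrib)
  moreover have "?J \<noteq> {}" using last_indices_nonempty[OF d] by blast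
  moreover have "\<epsilon> * I (\<delta> / \<epsilon>) $ i - \<epsilon> * I0 $ i \<ge> \<delta> * (- lam) / 4 * \<epsilon>"
    using mult_left_mono[OF growth, of \<epsilon>] \<epsilon> by (simp add: algebra_simps)
  moreover have "\<epsilon> * I (\<delta> / \<epsilon>) $ i - \<epsilon> * I0 $ i \<le> infnorm (\<epsilon> *\<^sub>R I (\<delta> / \<epsilon>) - \<epsilon> *\<^sub>R I0)"
    using component_le_infnorm_cart[of "\<epsilon> *\<^sub>R I (\<delta> / \<epsilon>) - \<epsilon> *\<^sub>R I0" i] by simp
  ultimately show ?thesis
    by (intro exI[of _ \<theta>] exI[of _ "\<lambda>t. \<epsilon> *\<^sub>R I t"]) (auto simp: start intro!: Max.boundedI)
qed

end

theorem theorem3: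
  assumes "CARD('n::{finite,linorder}) \<ge> 2"
  shows "\<exists>\<kappa>>0. \<forall>C1>0. \<forall>lam<0. \<exists>c>0. \<exists>\<delta>>0. \<forall>C2>0. \<exists>\<mu>0>0. \<exists>C>0.
    \<forall>(l::nat) (d::nat) (\<omega> :: (real, 'n) vec) (A :: (real, 'n) vec \<Rightarrow> ((real, 'n) vec, 'n) vec)
      (R :: (real, 'n) vec \<times> (real, 'n) vec \<Rightarrow> real) (H :: (real, 'n) vec \<times> (real, 'n) vec \<Rightarrow> real)
      (\<theta>s :: (real, 'n) vec) (i :: 'n).
      3 \<le> l \<and> 1 \<le> d \<and> d \<le> CARD('n) - 1 \<and>
      (\<forall>j \<in> first_indices d. \<omega> $ j = 0) \<and> nonresonant d \<omega> \<and> infnorm \<omega> = 1 \<and>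
      (\<forall>I. torus_periodic (\<lambda>\<theta>. H (\<theta>, I))) \<and> Ck l H \<and>
      torus_periodic A \<and> (\<forall>\<theta>. transpose (A \<theta>) = A \<theta>) \<and> Ck l A \<and>
      (\<forall>\<theta> I. H (\<theta>, I) = \<omega> \<bullet> I + (A \<theta> *v I) \<bullet> I + R (\<theta>, I)) \<and>
      (\<forall>\<theta>. (\<lambda>I. R (\<theta>, I)) \<in> O[at 0](\<lambda>I. infnorm I ^ 3)) \<and>
      i \<in> first_indices d \<and>
      neg_definite (frechet_derivative (averaged d A) (at \<theta>s) (axis i 1)) \<and>
      (\<forall>I. (frechet_derivative (averaged d A) (at \<theta>s) (axis i 1) *v I) \<bullet> I \<le> lam * (infnorm I)\<^sup>2)
      \<longrightarrow>
      (\<forall>\<epsilon>>0. Psi d \<omega> 1 \<le> \<kappa> / \<epsilon> \<and>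
         Ck_norm l UNIV A \<le> ereal C1 \<and>
         Ck_norm l (UNIV \<times> {I. infnorm I < 3}) (\<lambda>(\<theta>, I). R (\<theta>, \<epsilon> *\<^sub>R I) / \<epsilon> ^ 3) \<le> ereal C2 \<and>
         0 < mu \<kappa> d \<omega> \<epsilon> \<and> mu \<kappa> d \<omega> \<epsilon> \<le> \<mu>0 \<longrightarrow>
         (\<forall>I0 :: (real, 'n) vec. infnorm I0 = 1 \<longrightarrow>
           (\<exists>\<theta> I. hamiltonian_solution H {0..\<delta> / \<epsilon>} \<theta> I \<and>
              I 0 = \<epsilon> *\<^sub>R I0 \<and>
              infnorm (I (\<delta> / \<epsilon>) - I 0) \<ge> I (\<delta> / \<epsilon>) $ i - I 0 $ i \<and>
              I (\<delta> / \<epsilon>) $ i - I 0 $ i \<ge> c * \<epsilon> \<and>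
              (MAX j \<in> last_indices d. \<bar>I (\<delta> / \<epsilon>) $ j - I 0 $ j\<bar>) \<le> C * \<epsilon> * mu \<kappa> d \<omega> \<epsilon>)))"
proof -
  obtain M :: "real measure" where M: "prob_space M" "sets M = sets borel" "integrable M (\<lambda>s. \<bar>s\<bar>)"
      "\<And>\<xi>. \<bar>\<xi>\<bar> \<ge> 4 \<Longrightarrow> char M \<xi> = 0"
    by (rule bandlimited_prob_measure) blast
  define m where "m = (LINT s|M. \<bar>s\<bar>)"
  define n where "n = real CARD('n)"
  define L where "L C1 = n\<^sup>2 * C1" for C1
  define Lg where "Lg C1 = 4 * n\<^sup>2 * L C1" for C1
  define b where "b C1 = n * (2 * Lg C1 + 1)" for C1
  \<comment> \<open>the two bounds on \<open>\<delta>\<close> required for the orbit\<close>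
  define \<delta> where "\<delta> C1 lam = min (1 / b C1) (- lam / (4 * Lg C1 * b C1))" for C1 lam
  define K where "K C1 lam C2 = \<delta> C1 lam * (n\<^sup>2 * Lg C1 + 2 * C2 + 4 * Lg C1 * b C1 * m) + 4 * b C1 * m" for C1 lam C2
  \<comment> \<open>since \<open>\<epsilon> \<le> 2 \<mu>\<close>, the first bound gives \<open>\<epsilon> C2 \<le> 1\<close>; the second one controls the averaging error\<close>
  define \<mu>0 where "\<mu>0 C1 lam C2 = min (1 / (2 * C2)) (\<delta> C1 lam * (- lam) / 4 / K C1 lam C2)" for C1 lam C2
  have n1: "n \<ge> 1" by (simp add: n_def Suc_leI)
  have m0: "m \<ge> 0" unfolding m_def by (rule Bochner_Integration.integral_nonneg) simp
  have Lg0: "Lg C1 > 0" if "C1 > 0" for C1 using that n1 by (simp add: Lg_def L_def)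
  have B0: "b C1 > 0" if "C1 > 0" for C1
    using Lg0[OF that] n1 by (auto simp: b_def intro!: mult_pos_pos add_pos_pos)
  have \<delta>0: "\<delta> C1 lam > 0" if "C1 > 0" "lam < 0" for C1 lam
    using Lg0[OF that(1)] B0[OF that(1)] that by (simp add: \<delta>_def divide_neg_pos)
  have \<delta>1: "b C1 * \<delta> C1 lam \<le> 1" "4 * Lg C1 * b C1 * \<delta> C1 lam \<le> - lam" if "C1 > 0" for C1 lam
  proof -
    have "\<delta> C1 lam \<le> 1 / b C1" "\<delta> C1 lam \<le> - lam / (4 * Lg C1 * b C1)" by (auto simp: \<delta>_def)
    moreover have "4 * Lg C1 * b C1 > 0" using Lg0[OF that] B0[OF that] by simp
    ultimately have "\<delta> C1 lam * b C1 \<le> 1" "\<delta> C1 lam * (4 * Lg C1 * b C1) \<le> - lam"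
      using B0[OF that] by (simp_all only: pos_le_divide_eq)
    thus "b C1 * \<delta> C1 lam \<le> 1" "4 * Lg C1 * b C1 * \<delta> C1 lam \<le> - lam"
      by (simp_all add: mult_ac)
  qed
  have K0: "K C1 lam C2 > 0" if "C1 > 0" "lam < 0" "C2 > 0" for C1 lam C2
    using Lg0[OF that(1)] B0[OF that(1)] \<delta>0[OF that(1,2)] m0 that n1 unfolding K_def
    by (intro add_pos_nonneg mult_pos_pos mult_nonneg_nonneg) auto
  have \<mu>00: "\<mu>0 C1 lam C2 > 0" if "C1 > 0" "lam < 0" "C2 > 0" for C1 lam C2
    using K0[OF that] \<delta>0[OF that(1,2)] that by (simp add: \<mu>0_def divide_neg_pos mult_pos_neg)
  show ?thesis
    apply (rule exI[of _ 1], rule conjI, simp, intro allI impI)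
    subgoal for C1 lam
      apply (rule exI[of _ "\<delta> C1 lam * (- lam) / 4"], rule conjI, simp add: \<delta>0 mult_pos_neg)
      apply (rule exI[of _ "\<delta> C1 lam"], rule conjI, rule \<delta>0, assumption+, intro allI impI)
      subgoal for C2
        apply (rule exI[of _ "\<mu>0 C1 lam C2"], rule conjI, rule \<mu>00, assumption+)
        apply (rule exI[of _ "K C1 lam C2"], rule conjI, rule K0, assumption+)
        apply (intro allI impI, elim conjE)
        subgoal premises hyps for l d \<omega> A R H \<theta>s i \<epsilon> I0
        proof -
          note pos = hyps(1-3)
          have eps: "\<epsilon> > 0" and d: "d \<le> CARD('n) - 1" and I0: "infnorm I0 = 1"
            and \<omega>: "nonresonant d \<omega>" "\<And>j. j \<in> first_indices d \<Longrightarrow> \<omega> $ j = 0" "infnorm \<omega> = 1"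
            and Psi1: "Psi d \<omega> 1 \<le> 1 / \<epsilon>" and mu: "mu 1 d \<omega> \<epsilon> \<le> \<mu>0 C1 lam C2"
            and i: "i \<in> first_indices d"
            and twist: "\<And>I. (frechet_derivative (averaged d A) (at \<theta>s) (axis i 1) *v I) \<bullet> I \<le> lam * (infnorm I)\<^sup>2"
            using hyps by blast+
          obtain Q where "\<epsilon> \<le> 1 / Q" "1 / Q \<le> 2 * mu 1 d \<omega> \<epsilon>"
            using cutoff_exists[OF \<omega>(1,3) d eps Psi1] by blast
          hence "\<epsilon> \<le> 2 * \<mu>0 C1 lam C2" using mu by linarith
          also have "\<dots> \<le> 1 / C2" by (simp add: \<mu>0_def)
          finally have "\<epsilon> * C2 \<le> 1" using pos by (simp add: field_simps)
          then interpret scaled_hamiltonian A l C1 n "L C1" "Lg C1" H R \<omega> \<epsilon> C2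
            using hyps by unfold_locales (auto simp: n_def L_def Lg_def)
          have B_eq: "scaled_hamiltonian.B n (Lg C1) = b C1" by (simp add: B_def b_def)
          have "K C1 lam C2 * mu 1 d \<omega> \<epsilon> \<le> K C1 lam C2 * (\<delta> C1 lam * (- lam) / 4 / K C1 lam C2)"
            using mu K0[OF pos] by (intro mult_left_mono) (auto simp: \<mu>0_def)
          hence small_mu: "K C1 lam C2 * mu 1 d \<omega> \<epsilon> \<le> \<delta> C1 lam * (- lam) / 4" using K0[OF pos] by simp
          show ?thesis
            using unstable_orbit[OF M d \<omega> Psi1 i pos(2) twist I0 \<delta>0[OF pos(1,2)]] \<delta>1[OF pos(1)] small_mu
            unfolding B_eq K_def m_def by blast
        qed
        done
      done
    done
qed

end
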